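(* Let $1<p<N$, let $\Omega\subset\mathbb{R}^N$ be a bounded, strictly convex, open set with $C^2$ boundary, and let $f:\overline{\Omega}\times\mathbb{R}\to\mathbb{R}$ be a Carathéodory function. Assume: (H0) $|f(x,s)|\le |a(x)|\,\tilde f(s)$, where $a\in L^r(\Omega)$ with $r>N/p$, and $\tilde f:\mathbb{R}\to[0,+\infty)$ is continuous, satisfies $\tilde f(s)>0$ for $|s|>s_0$ (for some $s_0\ge 0$), and $$\lim_{s\to\pm\infty}\frac{\tilde f(s)}{|s|^{p^*_{N/r}-1}}=0;$$ (H1) there is a constant $c_0>0$ such that $$\limsup_{s\to+\infty}\frac{\max_{[-s,s]}\tilde f}{\max\{\tilde f(-s),\tilde f(s)\}}\le c_0 .$$ Define $$h(s):=\frac{|s|^{p^*_{N/r}-1}}{\max\{\tilde f(-s),\tilde f(s)\}}\quad\text{for }|s|>s_0,\qquad A:=\begin{cases}1,&\text{if } r\le N,\\[2pt] \dfrac{p^*_{N/r}-1}{p^*_{N/p}},&\text{if } r>N.\end{cases}$$ Then there exists a constant $C_0>0$, independent of the solution, such that for every weak solution $u\in W_0^{1,p}(\Omega)$ of $-\Delta_p u=f(x,u)$ in $\Omega$, $u=0$ on $\partial\Omega$, at least one of the following holds: (i) $\|u\|_\infty\le C_0$; (ii) $s_0<\|u\|_\infty<\infty$ and for every $\varepsilon>0$ there exists a constant $C>0$ such that $$h\big(\|u\|_\infty\big)\le C\,\|a\|_r^{\,A+\varepsilon}\,\big(1+\|u\|_{p^*}\big)^{(p^*_{N/r}-p)(A+\varepsilon)},$$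 where $C$ depends only on $\varepsilon$, $c_0$, $r$, $N$ and $\Omega$ (and on the fixed exponent $p$), and is independent of the solution $u$.
   Context: $\Delta_p u=\operatorname{div}(|\nabla u|^{p-2}\nabla u)$ is the $p$-Laplacian. $p^*=\frac{Np}{N-p}$ is the critical Sobolev exponent, and $(p^* )'=\frac{p^*}{p^*-1}$. For an exponent $\rho>1$, $p^*_{N/\rho}:=p^*\left(1-\frac1\rho\right)$; in particular $p^*_{N/r}=p^*(1-\frac1r)$ and $p^*_{N/p}=p^*(1-\frac1p)=\frac{N(p-1)}{N-p}$. $\|\cdot\|_q$ denotes the norm of $L^q(\Omega)$. $f$ is Carathéodory: $f(\cdot,s)$ is measurable for all $s\in\mathbb{R}$ and $f(x,\cdot)$ is continuous for almost all $x\in\Omega$. A weak solution is $u\in W_0^{1,p}(\Omega)$ such that $f(\cdot,u)\in L^{(p^* )'}(\Omega)$ and $\int_\Omega|\nabla u|^{p-2}\nabla u\cdot\nabla\varphi\,dx=\int_\Omega f(x,u)\varphi\,dx$ for all $\varphi\in W_0^{1,p}(\Omega)$. *)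

theory Defs
  imports "HOL-Probability.Essential_Supremum"
begin

section \<open>Domains\<close>

definition strictly_convex :: "'a::euclidean_space set \<Rightarrow> bool" where
  "strictly_convex S \<longleftrightarrow>
     (\<forall>x\<in>closure S. \<forall>y\<in>closure S. x \<noteq> y \<longrightarrow> open_segment x y \<subseteq> interior S)"

text \<open>A function on a Euclidean space is \<open>C^(k+1)\<close> iff it is differentiable and its partial
  derivatives are \<open>C^k\<close>.\<close>

primrec Ck :: "nat \<Rightarrow> ('a::euclidean_space \<Rightarrow> real) \<Rightarrow> bool" where
  "Ck 0 \<phi> \<longleftrightarrow> continuous_on UNIV \<phi>"
| "Ck (Suc k) \<phi> \<longleftrightarrow> (\<forall>x. \<phi> differentiable (at x)) \<and>
     (\<forall>i\<in>Basis. Ck k (\<lambda>x. frechet_derivative \<phi> (at x) i))"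

text \<open>Near each boundary point the set lies strictly above a \<open>C^2\<close> graph over a hyperplane, the
  unit vector \<open>e\<close> playing the role of the last coordinate axis after a rotation. The graph
  function is evaluated only at the projection \<open>x - (x \<bullet> e) *\<^sub>R e\<close> onto the hyperplane
  orthogonal to \<open>e\<close>, so that it is a \<open>C^2\<close> function of the remaining coordinates.\<close>

definition C2_boundary :: "'a::euclidean_space set \<Rightarrow> bool" where
  "C2_boundary S \<longleftrightarrow> (\<forall>x0\<in>frontier S. \<exists>\<delta>>0. \<exists>e \<gamma>. norm e = 1 \<and> Ck 2 \<gamma> \<and>
     S \<inter> ball x0 \<delta> = {x \<in> ball x0 \<delta>. x \<bullet> e > \<gamma> (x - (x \<bullet> e) *\<^sub>R e)})"


section \<open>Lebesgue and Sobolev spaces\<close>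

text \<open>Elements of these spaces are represented by functions, not by classes of functions that
  agree almost everywhere.\<close>

definition lp_space :: "'a measure \<Rightarrow> real \<Rightarrow> ('a \<Rightarrow> 'b::euclidean_space) set" where
  "lp_space M q = {g \<in> borel_measurable M. integrable M (\<lambda>x. norm (g x) powr q)}"

text \<open>Meaningful only on \<^const>\<open>lp_space\<close>: the integral of a non-integrable function is 0.\<close>

definition lp_norm :: "'a measure \<Rightarrow> real \<Rightarrow> ('a \<Rightarrow> 'b::euclidean_space) \<Rightarrow> real" where
  "lp_norm M q g = (LINT x|M. norm (g x) powr q) powr (1 / q)"

definition linf_norm :: "'a measure \<Rightarrow> ('a \<Rightarrow> real) \<Rightarrow> ennreal" where
  "linf_norm M g = esssup M (\<lambda>x. ennreal \<bar>g x\<bar>)"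

definition test_functions :: "'a::euclidean_space set \<Rightarrow> ('a \<Rightarrow> real) set" where
  "test_functions \<Omega> = {\<phi>. (\<forall>k. Ck k \<phi>) \<and>
     (\<exists>K. compact K \<and> K \<subseteq> \<Omega> \<and> (\<forall>x. x \<notin> K \<longrightarrow> \<phi> x = 0))}"

definition locally_integrable :: "'a::euclidean_space set \<Rightarrow> ('a \<Rightarrow> 'b::euclidean_space) \<Rightarrow> bool" where
  "locally_integrable \<Omega> g \<longleftrightarrow> (\<forall>K. compact K \<longrightarrow> K \<subseteq> \<Omega> \<longrightarrow> g absolutely_integrable_on K)"

definition has_weak_gradient ::
    "'a::euclidean_space set \<Rightarrow> ('a \<Rightarrow> real) \<Rightarrow> ('a \<Rightarrow> 'a) \<Rightarrow> bool" where
  "has_weak_gradient \<Omega> u g \<longleftrightarrow> locally_integrable \<Omega> u \<and> locally_integrable \<Omega> g \<and>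
     (\<forall>\<phi>\<in>test_functions \<Omega>. \<forall>i\<in>Basis.
        (LINT x|lebesgue_on \<Omega>. u x * frechet_derivative \<phi> (at x) i) =
        - (LINT x|lebesgue_on \<Omega>. (g x \<bullet> i) * \<phi> x))"

text \<open>The weak gradient is unique up to null sets, so the choice below is immaterial under
  integrals.\<close>

definition weak_gradient :: "'a::euclidean_space set \<Rightarrow> ('a \<Rightarrow> real) \<Rightarrow> 'a \<Rightarrow> 'a" where
  "weak_gradient \<Omega> u = (SOME g. has_weak_gradient \<Omega> u g)"

definition sobolev_space :: "'a::euclidean_space set \<Rightarrow> real \<Rightarrow> ('a \<Rightarrow> real) set" where
  "sobolev_space \<Omega> p = {u \<in> lp_space (lebesgue_on \<Omega>) p.
     \<exists>g \<in> lp_space (lebesgue_on \<Omega>) p. has_weak_gradient \<Omega> u g}"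

definition sobolev_norm :: "'a::euclidean_space set \<Rightarrow> real \<Rightarrow> ('a \<Rightarrow> real) \<Rightarrow> real" where
  "sobolev_norm \<Omega> p u =
     lp_norm (lebesgue_on \<Omega>) p u + lp_norm (lebesgue_on \<Omega>) p (weak_gradient \<Omega> u)"

text \<open>The closure of the test functions in the Sobolev space.\<close>

definition sobolev_space0 :: "'a::euclidean_space set \<Rightarrow> real \<Rightarrow> ('a \<Rightarrow> real) set" where
  "sobolev_space0 \<Omega> p = {u \<in> sobolev_space \<Omega> p.
     \<exists>\<psi>. (\<forall>k::nat. \<psi> k \<in> test_functions \<Omega>) \<and>
         (\<lambda>k. sobolev_norm \<Omega> p (\<lambda>x. u x - \<psi> k x)) \<longlonglongrightarrow> 0}"


section \<open>Exponents\<close>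

definition sobolev_exp :: "real \<Rightarrow> real \<Rightarrow> real" where
  "sobolev_exp N p = N * p / (N - p)"

definition conj_exp :: "real \<Rightarrow> real" where
  "conj_exp q = q / (q - 1)"

text \<open>The exponent written \<open>p^*_(N/\<rho>)\<close>.\<close>

definition sobolev_exp_sub :: "real \<Rightarrow> real \<Rightarrow> real \<Rightarrow> real" where
  "sobolev_exp_sub N p \<rho> = sobolev_exp N p * (1 - 1 / \<rho>)"

definition A_exp :: "real \<Rightarrow> real \<Rightarrow> real \<Rightarrow> real" where
  "A_exp N p r =
     (if r \<le> N then 1 else (sobolev_exp_sub N p r - 1) / sobolev_exp_sub N p p)"


section \<open>The problem\<close>

definition caratheodory :: "'a::euclidean_space set \<Rightarrow> ('a \<Rightarrow> real \<Rightarrow> real) \<Rightarrow> bool" where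
  "caratheodory \<Omega> f \<longleftrightarrow>
     (\<forall>s. (\<lambda>x. f x s) \<in> borel_measurable (lebesgue_on (closure \<Omega>))) \<and>
     (AE x in lebesgue_on \<Omega>. continuous_on UNIV (f x))"

text \<open>Weak solutions of \<open>-\<Delta>\<^sub>p u = f(x,u)\<close> with zero boundary values. For \<open>p < 2\<close> the flux
  \<open>|\<nabla>u|^(p-2) \<nabla>u\<close> vanishes where the gradient does.\<close>

definition weak_solution ::
    "'a::euclidean_space set \<Rightarrow> real \<Rightarrow> ('a \<Rightarrow> real \<Rightarrow> real) \<Rightarrow> ('a \<Rightarrow> real) \<Rightarrow> bool" where
  "weak_solution \<Omega> p f u \<longleftrightarrow>
     u \<in> sobolev_space0 \<Omega> p \<and>
     (\<lambda>x. f x (u x)) \<in> lp_space (lebesgue_on \<Omega>) (conj_exp (sobolev_exp DIM('a) p)) \<and>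
     (\<forall>\<phi>\<in>sobolev_space0 \<Omega> p.
        (LINT x|lebesgue_on \<Omega>. (norm (weak_gradient \<Omega> u x) powr (p - 2) *\<^sub>R weak_gradient \<Omega> u x)
            \<bullet> weak_gradient \<Omega> \<phi> x) =
        (LINT x|lebesgue_on \<Omega>. f x (u x) * \<phi> x))"

text \<open>\<open>F\<close> is the growth function of the nonlinearity; only values at \<open>|s| > s\<^sub>0\<close>, where \<open>F\<close> is
  positive, are relevant.\<close>

definition h_fun :: "real \<Rightarrow> real \<Rightarrow> real \<Rightarrow> (real \<Rightarrow> real) \<Rightarrow> real \<Rightarrow> real" where
  "h_fun N p r F s = \<bar>s\<bar> powr (sobolev_exp_sub N p r - 1) / max (F (- s)) (F s)"

text \<open>The majorant of \<open>f\<close> is required for almost every \<open>x\<close>, since \<open>a\<close> is only an element of a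
  Lebesgue space.\<close>

definition H0 :: "'a::euclidean_space set \<Rightarrow> real \<Rightarrow> real \<Rightarrow> ('a \<Rightarrow> real \<Rightarrow> real) \<Rightarrow>
    ('a \<Rightarrow> real) \<Rightarrow> (real \<Rightarrow> real) \<Rightarrow> real \<Rightarrow> bool" where
  "H0 \<Omega> p r f a F s0 \<longleftrightarrow>
     (AE x in lebesgue_on \<Omega>. \<forall>s. \<bar>f x s\<bar> \<le> \<bar>a x\<bar> * F s) \<and>
     a \<in> lp_space (lebesgue_on \<Omega>) r \<and>
     continuous_on UNIV F \<and> (\<forall>s. 0 \<le> F s) \<and>
     0 \<le> s0 \<and> (\<forall>s. s0 < \<bar>s\<bar> \<longrightarrow> 0 < F s) \<and>
     ((\<lambda>s. F s / \<bar>s\<bar> powr (sobolev_exp_sub DIM('a) p r - 1)) \<longlongrightarrow> 0) at_top \<and>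
     ((\<lambda>s. F s / \<bar>s\<bar> powr (sobolev_exp_sub DIM('a) p r - 1)) \<longlongrightarrow> 0) at_bot"

text \<open>The maximum of the continuous \<open>F\<close> over the compact interval is written as a supremum.\<close>

definition H1 :: "(real \<Rightarrow> real) \<Rightarrow> real \<Rightarrow> bool" where
  "H1 F c0 \<longleftrightarrow>
     Limsup at_top (\<lambda>s. ereal ((SUP t\<in>{- s..s}. F t) / max (F (- s)) (F s))) \<le> ereal c0"

end

theory Submission
  imports Defs "HOL-Real_Asymp.Real_Asymp"
begin

text \<open>Write \<open>q\<close> for the critical exponent \<open>p^*\<close>, \<open>m = q(1 - 1/r)\<close> for the exponent \<open>p^*_(N/r)\<close>, and
  \<open>G_k(u)\<close> for \<open>u\<close> with the band \<open>[-k,k]\<close> collapsed to \<open>0\<close>, so that \<open>|G_k(u)| = max 0 (|u| - k)\<close>.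
  Testing the equation with \<open>G_k(u)\<close> and applying the Sobolev inequality to \<open>G_k(u)\<close> gives
  \<open>\<parallel>G_k(u)\<parallel>_q^p \<le> C \<integral> |f(x,u)| |G_k(u)|\<close> (\<open>weak_solution_excess_bound\<close>). This family of inequalities,
  for all levels \<open>k\<close>, is all that is used of the equation.

  Suppose \<open>|f(x,u)| \<le> L |a|\<close>, and let \<open>a_k\<close> be the measure of \<open>{|u| > k}\<close>. Hoelder's inequality turns the
  above into \<open>\<parallel>G_k(u)\<parallel>_q \<le> (C L \<parallel>a\<parallel>_r)^(1/(p-1)) (a_k^(1/q))^\<gamma>\<close> with \<open>\<gamma> = (m-1)/(p-1)\<close>, and \<open>\<gamma> > 1\<close>
  precisely because \<open>r > N/p\<close>. As \<open>(l - k) a_l^(1/q) \<le> \<parallel>G_k(u)\<parallel>_q\<close> for \<open>l > k\<close>, Stampacchia's iteration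
  makes \<open>a_l\<close> vanish at a finite distance above \<open>k\<close>, controlled by \<open>a_k\<close>. Starting at half the essential
  supremum, \<open>k = s/2\<close>, where \<open>a_k\<close> is bounded by Chebyshev's inequality, this becomes
  \<open>s^(m-1) \<le> C L \<parallel>a\<parallel>_r \<parallel>u\<parallel>_q^(m-p)\<close> (\<open>sup_bound_of_bounded_coefficient\<close>). By the growth conditions one may
  take \<open>L = (c_0 + 1) max(F(-s), F(s))\<close> for large \<open>s\<close>, and dividing by \<open>max(F(-s), F(s))\<close> yields
  \<open>h(s) \<le> C \<parallel>a\<parallel>_r \<parallel>u\<parallel>_q^(m-p)\<close>. Since \<open>h(s)\<close> tends to infinity, the left side is at least \<open>1\<close> beyond
  some \<open>C_0\<close>; then so is the right side, which may therefore be raised to the power \<open>A + \<epsilon> \<ge> 1\<close>.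

  That \<open>s\<close> is finite follows from the same iteration (\<open>critical_growth_bounded\<close>): from
  \<open>|f(x,u)| \<le> |a| |u|^(m-1)\<close> for large \<open>|u|\<close> one gets an additional term \<open>\<parallel>G_k(u)\<parallel>_q^m\<close> on the right, which is
  absorbed for high levels because \<open>\<parallel>G_k(u)\<parallel>_q\<close> tends to \<open>0\<close> and \<open>m > p\<close>.

  Two tools precede this argument. The Sobolev inequality is proved first in weak form, by averaging the
  fundamental theorem of calculus over rays, and then strengthened by Maz'ya's truncation at dyadic
  levels. Smooth truncations of a solution are admissible test functions with the expected gradient,
  because composing the approximating test functions with a smooth function that vanishes at \<open>0\<close> gives
  test functions again, and because weak gradients are unique almost everywhere.\<close>

section \<open>Calculus of C^k functions\<close>

lemma Ck_SucI:
  fixes \<phi> :: "'a::euclidean_space \<Rightarrow> real"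
  assumes "\<And>x. (\<phi> has_derivative \<phi>' x) (at x)" "\<And>i. i \<in> Basis \<Longrightarrow> Ck k (\<lambda>x. \<phi>' x i)"
  shows "Ck (Suc k) \<phi>"
proof -
  have "\<phi>' x = frechet_derivative \<phi> (at x)" for x
    using assms(1) by (rule frechet_derivative_at)
  then show ?thesis using assms by (auto simp: differentiable_def)
qed

lemma Ck_Suc_has_derivative:
  "Ck (Suc k) \<phi> \<Longrightarrow> (\<phi> has_derivative frechet_derivative \<phi> (at x)) (at x)"
  by (simp add: frechet_derivative_works)

lemma Ck_continuous: "Ck k \<phi> \<Longrightarrow> continuous_on S \<phi>"
proof (cases k)
  case (Suc n)
  assume "Ck k \<phi>"
  then have "\<forall>x. \<phi> differentiable (at x)" using Suc by simp
  then show ?thesis by (meson continuous_at_imp_continuous_on differentiable_imp_continuous_within)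
qed (auto intro: continuous_on_subset)

lemma Ck_Suc_imp_Ck: "Ck (Suc k) \<phi> \<Longrightarrow> Ck k \<phi>"
proof (induction k arbitrary: \<phi>)
  case 0 then show ?case using Ck_continuous by (metis Ck.simps(1))
next
  case (Suc k) 
  then show ?case by (metis Ck.simps(2))
qed

lemma Ck_const: "Ck k (\<lambda>x. c)"
proof (induction k arbitrary: c)
  case (Suc k)
  show ?case by (rule Ck_SucI[where \<phi>'="\<lambda>_ _. 0"]) (auto intro: Suc derivative_eq_intros)
qed simp

lemma Ck_bounded_linear: "bounded_linear f \<Longrightarrow> Ck k f"
proof (cases k)
  case (Suc n)
  assume "bounded_linear f"
  then show ?thesis unfolding Suc
    by (intro Ck_SucI[where \<phi>'="\<lambda>_. f"]) (auto intro: Ck_const bounded_linear_imp_has_derivative)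
qed (auto simp: linear_continuous_on)

lemma Ck_add: "Ck k f \<Longrightarrow> Ck k g \<Longrightarrow> Ck k (\<lambda>x. f x + g x)"
proof (induction k arbitrary: f g)
  case (Suc k)
  show ?case
    by (rule Ck_SucI[OF has_derivative_add[OF Ck_Suc_has_derivative[OF Suc.prems(1)]
          Ck_Suc_has_derivative[OF Suc.prems(2)]]]) (use Suc in auto)
qed (auto intro: continuous_intros)

lemma Ck_mult: "Ck k f \<Longrightarrow> Ck k g \<Longrightarrow> Ck k (\<lambda>x. f x * g x)"
proof (induction k arbitrary: f g)
  case (Suc k)
  show ?case
  proof (rule Ck_SucI[OF has_derivative_mult[OF Ck_Suc_has_derivative[OF Suc.prems(1)]
          Ck_Suc_has_derivative[OF Suc.prems(2)]]])
    fix i :: 'a assume "i \<in> Basis"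
    then show "Ck k (\<lambda>x. f x * frechet_derivative g (at x) i + frechet_derivative f (at x) i * g x)"
      using Suc Ck_Suc_imp_Ck[OF Suc.prems(1)] Ck_Suc_imp_Ck[OF Suc.prems(2)]
      by (intro Ck_add Suc.IH) auto
  qed
qed (auto intro: continuous_intros)

lemma Ck_minus: "Ck k f \<Longrightarrow> Ck k g \<Longrightarrow> Ck k (\<lambda>x. f x - g x)"
  using Ck_add[OF _ Ck_mult[OF Ck_const[of k "-1"]], of f g] by simp

lemma Ck_prod: "finite I \<Longrightarrow> (\<And>i. i \<in> I \<Longrightarrow> Ck k (f i)) \<Longrightarrow> Ck k (\<lambda>x. \<Prod>i\<in>I. f i x)"
  by (induction I rule: finite_induct) (auto intro: Ck_const Ck_mult)

lemma Ck_compose: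
  fixes h :: "real \<Rightarrow> real" and f :: "'a::euclidean_space \<Rightarrow> real"
  shows "Ck k h \<Longrightarrow> Ck k f \<Longrightarrow> Ck k (\<lambda>x. h (f x))"
proof (induction k arbitrary: h f)
  case 0
  then show ?case using continuous_on_compose2[of UNIV h UNIV f] by auto
next
  case (Suc k)
  have lin: "linear (frechet_derivative h (at y))" for y
    using Suc.prems(1) by (simp add: linear_frechet_derivative)
  have eq: "frechet_derivative h (at y) t = frechet_derivative h (at y) 1 * t" for y t
    using linear_scale[OF lin, of y t 1] by (simp add: mult.commute)
  show ?case
  proof (rule Ck_SucI)
    show "((\<lambda>x. h (f x)) has_derivative
        (\<lambda>v. frechet_derivative h (at (f x)) (frechet_derivative f (at x) v))) (at x)" for x
      by (rule has_derivative_compose[OF Ck_Suc_has_derivative[OF Suc.prems(2)]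
            Ck_Suc_has_derivative[OF Suc.prems(1)]])
    fix i :: 'a assume i: "i \<in> Basis"
    have "Ck k (\<lambda>x. frechet_derivative h (at (f x)) 1 * frechet_derivative f (at x) i)"
      using Suc i Ck_Suc_imp_Ck[OF Suc.prems(2)]
      by (intro Ck_mult Suc.IH[where h="\<lambda>y. frechet_derivative h (at y) 1"]) auto
    then show "Ck k (\<lambda>x. frechet_derivative h (at (f x)) (frechet_derivative f (at x) i))"
      by (subst eq)
  qed
qed

lemma Ck_SucI_real:
  fixes h :: "real \<Rightarrow> real"
  assumes "\<And>x. (h has_real_derivative h' x) (at x)" "Ck k h'"
  shows "Ck (Suc k) h"
  using assms by (intro Ck_SucI[where \<phi>'="\<lambda>x t. h' x * t"]) (auto simp: has_field_derivative_def)

lemma Ck_id_real: "Ck k (\<lambda>t::real. t)"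
  by (rule Ck_bounded_linear) simp

text \<open>With \<open>\<alpha> = 1/2\<close> this provides a smooth approximation of the absolute value. Each differentiation lowers
  the exponent by one, so the induction needs all real exponents.\<close>

lemma Ck_square_plus_powr:
  fixes e :: real assumes "e > 0"
  shows "Ck k (\<lambda>t. (t\<^sup>2 + e) powr \<alpha>)"
proof (induction k arbitrary: \<alpha>)
  case 0
  have "t\<^sup>2 + e \<noteq> 0" for t using assms by (smt (verit) zero_le_power2)
  then show ?case by (auto intro!: continuous_intros)
next
  case (Suc k)
  have pos: "t\<^sup>2 + e > 0" for t using assms by (smt (verit) zero_le_power2)
  show ?case
  proof (rule Ck_SucI_real)
    show "((\<lambda>t. (t\<^sup>2 + e) powr \<alpha>) has_real_derivative \<alpha> * (2 * t) * (t\<^sup>2 + e) powr (\<alpha> - 1)) (at t)" for t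
      using pos[of t] by (auto intro!: derivative_eq_intros simp: powr_diff)
    show "Ck k (\<lambda>t. \<alpha> * (2 * t) * (t\<^sup>2 + e) powr (\<alpha> - 1))"
      by (intro Ck_mult Ck_const Ck_id_real Suc.IH)
  qed
qed

text \<open>The factor \<open>t^(-n)\<close> makes the family closed under differentiation up to linear combinations; \<open>n = 0\<close> is the
  standard smooth function that vanishes on the negative half-line.\<close>

definition flat_exp :: "real \<Rightarrow> nat \<Rightarrow> real \<Rightarrow> real" where
  "flat_exp c n t = (if t > 0 then exp (- c / t) / t ^ n else 0)"

lemma flat_exp_has_derivative:
  assumes "c > 0"
  shows "(flat_exp c n has_real_derivative
    (c * flat_exp c (n + 2) t - real n * flat_exp c (n + 1) t)) (at t)"
proof (cases t "0::real" rule: linorder_cases)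
  case less
  have "((\<lambda>t. 0) has_real_derivative 0) (at t)" by simp
  then have "(flat_exp c n has_real_derivative 0) (at t)"
    by (rule DERIV_cong_ev[THEN iffD1, rotated -1])
       (use less in \<open>auto simp: flat_exp_def eventually_at_filter intro!: eventually_mono[OF eventually_nhds_in_open[of "{..<0}"]]\<close>)
  then show ?thesis using less by (simp add: flat_exp_def)
next
  case greater
  have "((\<lambda>t. exp (- c / t) / t ^ n) has_real_derivative
    (c * flat_exp c (n + 2) t - real n * flat_exp c (n + 1) t)) (at t)"
  proof -
    have d1: "((\<lambda>t. exp (- c / t)) has_real_derivative exp (- c / t) * (c / t\<^sup>2)) (at t)"
      using greater by (auto intro!: derivative_eq_intros simp: power2_eq_square)
    have d2: "((\<lambda>t. t ^ n) has_real_derivative real n * t ^ (n - 1)) (at t)"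
      using DERIV_pow[of n t] by simp
    have n: "real n * t ^ n = real n * t ^ (n - 1) * t"
      by (cases n) auto
    have "((exp (- c / t) * (c / t\<^sup>2)) * t ^ n - exp (- c / t) * (real n * t ^ (n - 1))) / (t ^ n * t ^ n)
       = c * flat_exp c (n + 2) t - real n * flat_exp c (n + 1) t"
      using greater n by (simp add: flat_exp_def field_simps power2_eq_square)
    with DERIV_divide[OF d1 d2] greater show ?thesis by simp
  qed
  then show ?thesis
    by (rule DERIV_cong_ev[THEN iffD1, rotated -1])
       (use greater in \<open>auto simp: flat_exp_def eventually_at_filter intro!: eventually_mono[OF eventually_nhds_in_open[of "{0<..}"]]\<close>)
next
  case equal
  have R: "((\<lambda>t. (flat_exp c n t - flat_exp c n 0) / (t - 0)) \<longlongrightarrow> 0) (at_right 0)"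
  proof (rule Lim_transform_eventually)
    \<comment> \<open>The exponential decays faster than any power, so the one-sided derivative at \<open>0\<close> vanishes.\<close>
    show "((\<lambda>t. exp (- c / t) / t ^ (n + 1)) \<longlongrightarrow> 0) (at_right 0)"
      using assms by real_asymp
    show "\<forall>\<^sub>F t in at_right 0. exp (- c / t) / t ^ (n + 1) = (flat_exp c n t - flat_exp c n 0) / (t - 0)"
      by (auto simp: eventually_at_filter flat_exp_def)
  qed
  have L: "((\<lambda>t. (flat_exp c n t - flat_exp c n 0) / (t - 0)) \<longlongrightarrow> 0) (at_left 0)"
    by (rule Lim_transform_eventually[OF tendsto_const]) (auto simp: eventually_at_filter flat_exp_def)
  from L R have "(flat_exp c n has_real_derivative 0) (at 0)"
    unfolding has_field_derivative_iff by (simp add: filterlim_at_split)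
  then show ?thesis using equal by (simp add: flat_exp_def)
qed

lemma Ck_flat_exp: "c > 0 \<Longrightarrow> Ck k (flat_exp c n)"
proof (induction k arbitrary: n)
  case 0
  then show ?case
    using flat_exp_has_derivative DERIV_isCont continuous_at_imp_continuous_on by (metis Ck.simps(1))
next
  case (Suc k)
  show ?case
    by (rule Ck_SucI_real[OF flat_exp_has_derivative[OF Suc.prems]])
       (intro Ck_minus Ck_mult Ck_const Suc)
qed

section \<open>Integration by parts and uniqueness of weak gradients\<close>

definition grad :: "('a::euclidean_space \<Rightarrow> real) \<Rightarrow> 'a \<Rightarrow> 'a" where
  "grad \<phi> x = (\<Sum>i\<in>Basis. frechet_derivative \<phi> (at x) i *\<^sub>R i)"

definition C1_compact :: "('a::euclidean_space \<Rightarrow> real) \<Rightarrow> bool" where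
  "C1_compact \<phi> \<longleftrightarrow> Ck 1 \<phi> \<and> (\<exists>K. compact K \<and> (\<forall>x. x \<notin> K \<longrightarrow> \<phi> x = 0))"

lemma grad_inner_Basis: "i \<in> Basis \<Longrightarrow> grad \<phi> x \<bullet> i = frechet_derivative \<phi> (at x) i"
  by (simp add: grad_def inner_sum_left_Basis)

lemma grad_has_derivative:
  fixes \<phi> :: "'a::euclidean_space \<Rightarrow> real"
  assumes "Ck 1 \<phi>"
  shows "(\<phi> has_derivative (\<lambda>v. grad \<phi> x \<bullet> v)) (at x)"
proof -
  have d: "(\<phi> has_derivative frechet_derivative \<phi> (at x)) (at x)"
    using assms by (intro Ck_Suc_has_derivative[where k=0]) simp
  then have l: "linear (frechet_derivative \<phi> (at x))"
    by (rule has_derivative_linear)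
  have "frechet_derivative \<phi> (at x) v = grad \<phi> x \<bullet> v" for v
  proof -
    have "frechet_derivative \<phi> (at x) v = frechet_derivative \<phi> (at x) (\<Sum>i\<in>Basis. (v \<bullet> i) *\<^sub>R i)"
      by (simp add: euclidean_representation)
    also have "\<dots> = (\<Sum>i\<in>Basis. (v \<bullet> i) * frechet_derivative \<phi> (at x) i)"
      using l by (simp add: linear_sum linear_scale)
    also have "\<dots> = grad \<phi> x \<bullet> v"
      unfolding grad_def by (simp add: inner_sum_right inner_commute mult.commute)
    finally show ?thesis .
  qed
  then show ?thesis using d by (metis (no_types, lifting) ext)
qed

lemma grad_unique:
  fixes \<phi> :: "'a::euclidean_space \<Rightarrow> real"
  assumes "(\<phi> has_derivative (\<lambda>v. g \<bullet> v)) (at x)"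
  shows "grad \<phi> x = g"
proof -
  have "frechet_derivative \<phi> (at x) = (\<lambda>v. g \<bullet> v)"
    using frechet_derivative_at[OF assms] by simp
  then show ?thesis by (simp add: grad_def euclidean_representation)
qed

lemma continuous_on_grad:
  fixes \<phi> :: "'a::euclidean_space \<Rightarrow> real"
  assumes "Ck 1 \<phi>" shows "continuous_on S (grad \<phi>)"
proof -
  have "continuous_on UNIV (\<lambda>x. frechet_derivative \<phi> (at x) i)" if "i \<in> Basis" for i :: 'a
    using assms that by simp
  then show ?thesis unfolding grad_def
    by (auto intro!: continuous_intros intro: continuous_on_subset)
qed

lemma grad_eq_0_outside:
  fixes \<phi> :: "'a::euclidean_space \<Rightarrow> real"
  assumes "closed K" "\<And>x. x \<notin> K \<Longrightarrow> \<phi> x = 0" "x \<notin> K"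
  shows "grad \<phi> x = 0"
proof (rule grad_unique)
  have "((\<lambda>x. 0) has_derivative (\<lambda>v. 0)) (at x)" by simp
  then show "(\<phi> has_derivative (\<lambda>v. 0 \<bullet> v)) (at x)"
    unfolding inner_zero_left
    by (rule has_derivative_transform_within_open[where s="-K"]) (use assms in auto)
qed

lemma C1_compactE:
  fixes \<phi> :: "'a::euclidean_space \<Rightarrow> real"
  assumes "C1_compact \<phi>"
  obtains R B where "R > 0" "B > 0" "\<And>x. norm x > R \<Longrightarrow> \<phi> x = 0" "\<And>x. norm x > R \<Longrightarrow> grad \<phi> x = 0"
    "\<And>x. norm (grad \<phi> x) \<le> B"
proof -
  obtain K where K: "compact K" "\<And>x. x \<notin> K \<Longrightarrow> \<phi> x = 0" and C: "Ck 1 \<phi>"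
    using assms unfolding C1_compact_def by auto
  obtain R where R: "R > 0" "\<And>x. x \<in> K \<Longrightarrow> norm x \<le> R"
    using compact_imp_bounded[OF K(1)] unfolding bounded_pos by auto
  have z: "grad \<phi> x = 0" if "x \<notin> K" for x
    using grad_eq_0_outside[OF compact_imp_closed[OF K(1)] K(2) that] .
  have "bounded (grad \<phi> ` K)"
    using compact_continuous_image[OF continuous_on_grad[OF C] K(1)] compact_imp_bounded by blast
  then obtain B where B: "B > 0" "\<And>x. x \<in> K \<Longrightarrow> norm (grad \<phi> x) \<le> B"
    unfolding bounded_pos by auto
  have B': "norm (grad \<phi> x) \<le> B" for x
    by (cases "x \<in> K") (use B z in auto)
  show ?thesis
    by (rule that[OF R(1) B(1) _ _ B']) (use R(2) K(2) z in fastforce)+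
qed

lemma C1_compact_mult:
  "Ck 1 f \<Longrightarrow> C1_compact g \<Longrightarrow> C1_compact (\<lambda>x. f x * g x)"
  unfolding C1_compact_def by (metis Ck_mult mult_zero_right)

lemma integrable_continuous_bounded_support:
  fixes F :: "'a::euclidean_space \<Rightarrow> real"
  assumes "continuous_on UNIV F" "\<And>x. norm x > R \<Longrightarrow> F x = 0"
  shows "integrable lborel F"
proof -
  have "integrable lborel (\<lambda>x. indicator (cball 0 R) x *\<^sub>R F x)"
    using borel_integrable_compact[of "cball 0 R" F] continuous_on_subset[OF assms(1)] by simp
  moreover have "(\<lambda>x. indicator (cball 0 R) x *\<^sub>R F x) = F"
    using assms(2) by (auto simp: indicator_def fun_eq_iff)
  ultimately show ?thesis by simp
qed

text \<open>Translation invariance: every difference quotient in the direction \<open>e\<close> has integral \<open>0\<close>, and the quotients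
  converge boundedly to the derivative on a bounded set.\<close>

lemma integral_grad_eq_0:
  fixes w :: "'a::euclidean_space \<Rightarrow> real"
  assumes "C1_compact w"
  shows "(LINT x|lborel. grad w x \<bullet> e) = 0"
proof -
  obtain R B where RB: "R > 0" "B > 0" "\<And>x. norm x > R \<Longrightarrow> w x = 0"
    "\<And>x. norm x > R \<Longrightarrow> grad w x = 0" "\<And>x. norm (grad w x) \<le> B"
    using C1_compactE[OF assms] by metis
  have C: "Ck 1 w" using assms unfolding C1_compact_def by simp
  have cont: "continuous_on UNIV w" using C by (rule Ck_continuous)
  then have [measurable]: "w \<in> borel_measurable borel"
    by (simp add: borel_measurable_continuous_onI)
  have [measurable]: "grad w \<in> borel_measurable borel"
    by (rule borel_measurable_continuous_onI[OF continuous_on_grad[OF C]])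
  have lip: "\<bar>w (x + v) - w x\<bar> \<le> B * norm v" for x v
  proof -
    have "norm (w (x + v) - w x) \<le> B * norm ((x + v) - x)"
    proof (rule differentiable_bound[where S=UNIV])
      show "(w has_derivative (\<lambda>v. grad w y \<bullet> v)) (at y within UNIV)" for y
        using grad_has_derivative[OF C] by simp
      show "onorm (\<lambda>v. grad w y \<bullet> v) \<le> B" for y
      proof (rule onorm_le)
        show "norm (grad w y \<bullet> z) \<le> B * norm z" for z
          using Cauchy_Schwarz_ineq2[of "grad w y" z] RB(5)[of y]
          by (smt (verit) mult_right_mono norm_ge_zero real_norm_def)
      qed
    qed auto
    then show ?thesis by simp
  qed
  define q where "q n x = (w (x + (1 / real (Suc n)) *\<^sub>R e) - w x) * real (Suc n)" for n x
  \<comment> \<open>The support of a translate by at most \<open>norm e\<close> stays in the enlarged ball.\<close>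
  define D where "D x = indicator (cball 0 (R + norm e)) x * (B * norm e)" for x :: 'a
  have intD: "integrable lborel D"
  proof -
    have "emeasure lborel (cball (0::'a) (R + norm e)) < \<infinity>"
      by (rule emeasure_bounded_finite) simp
    then show ?thesis unfolding D_def by (intro integrable_mult_left) (simp add: integrable_real_indicator)
  qed
  have bound: "\<bar>q n x\<bar> \<le> D x" for n x
  proof (cases "norm x \<le> R + norm e")
    case True
    have "\<bar>q n x\<bar> \<le> (B * norm ((1 / real (Suc n)) *\<^sub>R e)) * real (Suc n)"
      unfolding q_def abs_mult using lip[of x "(1 / real (Suc n)) *\<^sub>R e"]
      by (metis abs_of_nat mult_right_mono of_nat_0_le_iff)
    also have "\<dots> = B * norm e" by simp
    finally show ?thesis using True by (simp add: D_def)
  next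
    case False
    have "norm ((1 / real (Suc n)) *\<^sub>R e) \<le> norm e" 
      using mult_right_mono[of "1 / real (Suc n)" 1 "norm e"] by simp
    then have "norm (x + (1 / real (Suc n)) *\<^sub>R e) > R"
      using False norm_diff_ineq[of x "(1 / real (Suc n)) *\<^sub>R e"] by linarith
    moreover have "norm x > R" using False norm_ge_zero[of e] by linarith
    ultimately show ?thesis using False RB(3) by (simp add: q_def D_def)
  qed
  have int_w: "integrable lborel w"
    by (rule integrable_continuous_bounded_support[OF cont RB(3)])
  have int_shift: "integrable lborel (\<lambda>x. w (x + v))" "(LINT x|lborel. w (x + v)) = (LINT x|lborel. w x)" for v
  proof -
    have e: "distr lborel borel ((+) v) = (lborel :: 'a measure)" using lborel_distr_plus .
    have "integrable (distr lborel borel ((+) v)) w" unfolding e by (rule int_w)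
    then show "integrable lborel (\<lambda>x. w (x + v))"
      by (subst (asm) integrable_distr_eq) (auto simp: add.commute)
    have "(LINT x|lborel. w x) = (LINT x|distr lborel borel ((+) v). w x)" unfolding e ..
    also have "\<dots> = (LINT x|lborel. w (x + v))"
      by (subst integral_distr) (auto simp: add.commute)
    finally show "(LINT x|lborel. w (x + v)) = (LINT x|lborel. w x)" ..
  qed
  have q0: "(LINT x|lborel. q n x) = 0" for n
    unfolding q_def using int_shift int_w by simp
  have lim: "(\<lambda>n. q n x) \<longlonglongrightarrow> grad w x \<bullet> e" for x
  proof -
    have "((\<lambda>t. w (x + t *\<^sub>R e)) has_derivative (\<lambda>t. grad w x \<bullet> (t *\<^sub>R e))) (at 0)"
      by (rule has_derivative_compose[of "\<lambda>t. x + t *\<^sub>R e" "\<lambda>t. t *\<^sub>R e"])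
         (use grad_has_derivative[OF C, of x] in \<open>auto intro!: derivative_eq_intros\<close>)
    then have "((\<lambda>t. w (x + t *\<^sub>R e)) has_real_derivative (grad w x \<bullet> e)) (at 0)"
      unfolding has_field_derivative_def by (simp add: mult.commute[of "grad w x \<bullet> e", abs_def])
    then have "((\<lambda>t. (w (x + t *\<^sub>R e) - w x) / t) \<longlongrightarrow> grad w x \<bullet> e) (at 0)"
      by (simp add: has_field_derivative_iff)
    moreover have "filterlim (\<lambda>n. 1 / real (Suc n)) (at 0) sequentially"
      unfolding filterlim_at using LIMSEQ_inverse_real_of_nat
      by (auto simp: inverse_eq_divide)
    ultimately have "(\<lambda>n. (w (x + (1 / real (Suc n)) *\<^sub>R e) - w x) / (1 / real (Suc n))) \<longlonglongrightarrow> grad w x \<bullet> e"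
      by (rule filterlim_compose)
    then show ?thesis by (simp add: q_def)
  qed
  have "(\<lambda>n. LINT x|lborel. q n x) \<longlonglongrightarrow> (LINT x|lborel. grad w x \<bullet> e)"
    by (rule integral_dominated_convergence[where w=D]) (use intD bound lim in \<open>auto simp: q_def\<close>)
  then show ?thesis unfolding q0 using LIMSEQ_unique tendsto_const by metis
qed

lemma integral_lebesgue_on_supported:
  fixes F :: "'a::euclidean_space \<Rightarrow> real"
  assumes "open \<Omega>" "F \<in> borel_measurable borel" "\<And>x. x \<notin> \<Omega> \<Longrightarrow> F x = 0"
  shows "(LINT x|lebesgue_on \<Omega>. F x) = (LINT x|lborel. F x)"
proof -
  have "(LINT x|lebesgue_on \<Omega>. F x) = (LINT x|lebesgue. indicator \<Omega> x *\<^sub>R F x)"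
    using assms(1) by (intro integral_restrict_space) auto
  also have "(\<lambda>x. indicator \<Omega> x *\<^sub>R F x) = F" using assms(3) by (auto simp: indicator_def fun_eq_iff)
  finally show ?thesis using assms(2) by (simp add: integral_completion)
qed

lemma test_functionsD:
  assumes "\<phi> \<in> test_functions \<Omega>"
  shows "Ck k \<phi>" "C1_compact \<phi>" "x \<notin> \<Omega> \<Longrightarrow> \<phi> x = 0" "x \<notin> \<Omega> \<Longrightarrow> grad \<phi> x = 0"
proof -
  obtain K where K: "compact K" "K \<subseteq> \<Omega>" "\<And>x. x \<notin> K \<Longrightarrow> \<phi> x = 0" and C: "\<And>k. Ck k \<phi>"
    using assms unfolding test_functions_def by auto
  show "Ck k \<phi>" "C1_compact \<phi>" using K C unfolding C1_compact_def by blast+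
  show "x \<notin> \<Omega> \<Longrightarrow> \<phi> x = 0" using K by auto
  show "x \<notin> \<Omega> \<Longrightarrow> grad \<phi> x = 0"
    using grad_eq_0_outside[of K \<phi> x] compact_imp_closed[OF K(1)] K(2,3) by blast
qed

lemma grad_mult:
  assumes "Ck 1 f" "Ck 1 g"
  shows "grad (\<lambda>x. f x * g x) x = f x *\<^sub>R grad g x + g x *\<^sub>R grad f x"
  by (rule grad_unique)
     (use has_derivative_mult[OF grad_has_derivative[OF assms(1), of x] grad_has_derivative[OF assms(2), of x]]
      in \<open>simp add: inner_add_left mult.commute\<close>)

lemma locally_integrable_continuous:
  fixes g :: "'a::euclidean_space \<Rightarrow> 'b::euclidean_space"
  assumes "continuous_on UNIV g" shows "locally_integrable \<Omega> g"
  unfolding locally_integrable_def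
proof (intro allI impI)
  fix K :: "'a set" assume K: "compact K"
  have "set_integrable lborel K g"
    unfolding set_integrable_def
    by (rule borel_integrable_compact[OF K]) (use assms continuous_on_subset in blast)
  then show "g absolutely_integrable_on K"
    unfolding set_integrable_def by (subst integrable_completion) auto
qed

text \<open>The product \<open>\<psi> \<phi>\<close> has compact support, so the integral of its gradient vanishes.\<close>

lemma integration_by_parts_test:
  fixes \<psi> \<phi> :: "'a::euclidean_space \<Rightarrow> real"
  assumes "open \<Omega>" "\<phi> \<in> test_functions \<Omega>" "Ck 1 \<psi>" "i \<in> Basis"
  shows "(LINT x|lebesgue_on \<Omega>. \<psi> x * frechet_derivative \<phi> (at x) i) =
        - (LINT x|lebesgue_on \<Omega>. (grad \<psi> x \<bullet> i) * \<phi> x)"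
proof -
  note \<phi> = test_functionsD[OF assms(2)]
  have C: "C1_compact (\<lambda>x. \<psi> x * \<phi> x)" using C1_compact_mult assms(3) \<phi>(2) by blast
  have eq: "grad (\<lambda>x. \<psi> x * \<phi> x) x = \<psi> x *\<^sub>R grad \<phi> x + \<phi> x *\<^sub>R grad \<psi> x" for x
    using grad_mult[OF assms(3) \<phi>(1)] .
  have c: "continuous_on UNIV \<psi>" "continuous_on UNIV \<phi>" "continuous_on UNIV (grad \<psi>)" "continuous_on UNIV (grad \<phi>)"
    using Ck_continuous[OF assms(3)] Ck_continuous[OF \<phi>(1)] continuous_on_grad[OF assms(3)] continuous_on_grad[OF \<phi>(1)]
    by auto
  obtain R where R: "\<And>x. norm x > R \<Longrightarrow> \<phi> x = 0" "\<And>x. norm x > R \<Longrightarrow> grad \<phi> x = 0"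
    using C1_compactE[OF \<phi>(2)] by metis
  note int = integrable_continuous_bounded_support[where R=R]
  have i1: "integrable lborel (\<lambda>x. \<psi> x * (grad \<phi> x \<bullet> i))" 
    by (rule int) (use c R in \<open>auto intro!: continuous_intros\<close>)
  have i2: "integrable lborel (\<lambda>x. (grad \<psi> x \<bullet> i) * \<phi> x)"
    by (rule int) (use c R in \<open>auto intro!: continuous_intros\<close>)
  have "0 = (LINT x|lborel. \<psi> x * (grad \<phi> x \<bullet> i) + (grad \<psi> x \<bullet> i) * \<phi> x)"
    using integral_grad_eq_0[OF C, of i] unfolding eq by (simp add: inner_add_left algebra_simps)
  also have "\<dots> = (LINT x|lborel. \<psi> x * (grad \<phi> x \<bullet> i)) + (LINT x|lborel. (grad \<psi> x \<bullet> i) * \<phi> x)"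
    using i1 i2 by simp
  finally have "(LINT x|lborel. \<psi> x * (grad \<phi> x \<bullet> i)) = - (LINT x|lborel. (grad \<psi> x \<bullet> i) * \<phi> x)" by simp
  moreover have "(LINT x|lebesgue_on \<Omega>. \<psi> x * (grad \<phi> x \<bullet> i)) = (LINT x|lborel. \<psi> x * (grad \<phi> x \<bullet> i))"
    using \<phi> c by (intro integral_lebesgue_on_supported assms) (auto intro!: borel_measurable_continuous_onI continuous_intros)
  moreover have "(LINT x|lebesgue_on \<Omega>. (grad \<psi> x \<bullet> i) * \<phi> x) = (LINT x|lborel. (grad \<psi> x \<bullet> i) * \<phi> x)"
    using \<phi> c by (intro integral_lebesgue_on_supported assms) (auto intro!: borel_measurable_continuous_onI continuous_intros)
  ultimately show ?thesis using assms(4) by (simp add: grad_inner_Basis)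
qed

text \<open>A product of one-dimensional factors that is positive exactly on \<open>box a b\<close>; as \<open>c\<close> tends to \<open>0\<close> it converges
  pointwise to the indicator of the box.\<close>

definition box_bump :: "'a::euclidean_space \<Rightarrow> 'a \<Rightarrow> real \<Rightarrow> 'a \<Rightarrow> real" where
  "box_bump a b c x = (\<Prod>i\<in>Basis. flat_exp c 0 (x \<bullet> i - a \<bullet> i) * flat_exp c 0 (b \<bullet> i - x \<bullet> i))"

lemma flat_exp_0_bounds: "c > 0 \<Longrightarrow> 0 \<le> flat_exp c 0 t" "c > 0 \<Longrightarrow> flat_exp c 0 t \<le> 1"
  by (auto simp: flat_exp_def)

lemma box_bump_eq_0: "x \<notin> box a b \<Longrightarrow> box_bump a b c x = 0"
  unfolding box_bump_def mem_box by (subst prod_zero_iff) (auto simp: flat_exp_def)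

lemma box_bump_bounds: "c > 0 \<Longrightarrow> 0 \<le> box_bump a b c x \<and> box_bump a b c x \<le> 1"
  unfolding box_bump_def
  by (auto intro!: prod_nonneg prod_le_1 mult_nonneg_nonneg mult_le_one flat_exp_0_bounds)

lemma box_bump_test: 
  assumes "c > 0" "cbox a b \<subseteq> \<Omega>" shows "box_bump a b c \<in> test_functions \<Omega>"
proof -
  have 1: "Ck k (\<lambda>x::'a. x \<bullet> i - t)" "Ck k (\<lambda>x::'a. t - x \<bullet> i)" for k i t
    by (intro Ck_minus Ck_const Ck_bounded_linear bounded_linear_inner_left)+
  have 2: "Ck k (\<lambda>x::'a. flat_exp c 0 (x \<bullet> i - t))" "Ck k (\<lambda>x::'a. flat_exp c 0 (t - x \<bullet> i))" for k i t
    by (rule Ck_compose[OF Ck_flat_exp[OF assms(1)] 1(1)] Ck_compose[OF Ck_flat_exp[OF assms(1)] 1(2)])+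
  have "Ck k (box_bump a b c)" for k
    unfolding box_bump_def by (intro Ck_prod Ck_mult 2) auto
  moreover have "\<forall>x. x \<notin> cbox a b \<longrightarrow> box_bump a b c x = 0"
    using box_bump_eq_0 box_subset_cbox by blast
  ultimately show ?thesis unfolding test_functions_def using assms(2)
    by (intro CollectI conjI allI exI[of _ "cbox a b"]) auto
qed

lemma box_bump_tendsto: "(\<lambda>n. box_bump a b (1 / real (Suc n)) x) \<longlonglongrightarrow> indicator (box a b) x"
proof (cases "x \<in> box a b")
  case False then show ?thesis by (simp add: box_bump_eq_0)
next
  case True
  have e: "(\<lambda>n. flat_exp (1 / real (Suc n)) 0 t) \<longlonglongrightarrow> 1" if "t > 0" for t
  proof -
    have "(\<lambda>n. exp (- (1 / real (Suc n)) / t)) \<longlonglongrightarrow> 1"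
      using that by real_asymp
    then show ?thesis using that by (simp add: flat_exp_def)
  qed
  have "(\<lambda>n. box_bump a b (1 / real (Suc n)) x) \<longlonglongrightarrow> (\<Prod>i\<in>(Basis::'a set). 1 * 1)"
    unfolding box_bump_def
    by (intro tendsto_prod tendsto_mult e) (use True in \<open>auto simp: mem_box\<close>)
  then show ?thesis using True by simp
qed

text \<open>By Lebesgue's differentiation theorem almost every value of \<open>d\<close> is a limit of averages over small cubes, and
  those vanish. Countably many boxes exhaust the open set.\<close>

lemma AE_zero_if_integral_cbox_zero:
  fixes d :: "'a::euclidean_space \<Rightarrow> real"
  assumes "open \<Omega>" "\<And>a b. cbox a b \<subseteq> \<Omega> \<Longrightarrow> d absolutely_integrable_on cbox a b"
    "\<And>a b. cbox a b \<subseteq> \<Omega> \<Longrightarrow> integral (cbox a b) d = 0"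
  shows "AE x in lebesgue_on \<Omega>. d x = 0"
proof -
  have *: "negligible {x \<in> box a b. d x \<noteq> 0}" if ab: "cbox a b \<subseteq> \<Omega>" for a b
  proof -
    define f where "f x = (if x \<in> cbox a b then d x else 0)" for x
    have dint: "d integrable_on cbox a b" by (rule set_lebesgue_integral_eq_integral(1)[OF assms(2)[OF ab]])
    have fint: "f integrable_on cbox u v" for u v
    proof -
      obtain y z where yz: "cbox a b \<inter> cbox u v = cbox y z" by (rule that[OF Int_interval])
      then have "d integrable_on cbox y z"
        by (intro integrable_on_subcbox[OF dint]) blast
      then show ?thesis
        unfolding f_def integrable_restrict_Int yz .
    qed
    obtain N where N: "negligible N" "\<And>x e. \<lbrakk>x \<notin> N; 0 < e\<rbrakk> \<Longrightarrow>
               \<exists>\<delta>>0. \<forall>h. 0 < h \<and> h < \<delta> \<longrightarrow> norm(integral (cbox x (x + h *\<^sub>R One)) f /\<^sub>R h ^ DIM('a) - f x) < e"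
      using integrable_ccontinuous_explicit[of f, OF fint] that by auto
    have "d x = 0" if x: "x \<in> box a b" "x \<notin> N" for x
    proof (rule ccontr)
      assume "d x \<noteq> 0"
      then obtain \<delta> where \<delta>: "\<delta> > 0" "\<And>h. 0 < h \<Longrightarrow> h < \<delta> \<Longrightarrow>
          norm(integral (cbox x (x + h *\<^sub>R One)) f /\<^sub>R h ^ DIM('a) - f x) < \<bar>d x\<bar>"
        using N(2)[OF x(2), of "\<bar>d x\<bar>"] by auto
      have fin: "finite ((\<lambda>i. b \<bullet> i - x \<bullet> i) ` (Basis :: 'a set))" "((\<lambda>i. b \<bullet> i - x \<bullet> i) ` (Basis :: 'a set)) \<noteq> {}"
        by auto
      define h where "h = min (\<delta>/2) (Min ((\<lambda>i. b \<bullet> i - x \<bullet> i) ` (Basis :: 'a set)))"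
      have h: "0 < h" "h < \<delta>" and hb: "\<And>i. i \<in> Basis \<Longrightarrow> h \<le> b \<bullet> i - x \<bullet> i"
        using \<delta>(1) x(1) fin unfolding h_def by (auto simp: mem_box Min_gr_iff min.coboundedI2)
      have sub: "cbox x (x + h *\<^sub>R One) \<subseteq> cbox a b"
        using x(1) hb h by (fastforce simp: mem_box inner_add_left)
      have "integral (cbox x (x + h *\<^sub>R One)) f = integral (cbox x (x + h *\<^sub>R One)) d"
        using sub by (intro Henstock_Kurzweil_Integration.integral_cong) (auto simp: f_def)
      also have "\<dots> = 0" using assms(3) sub ab by blast
      finally show False using \<delta>(2)[OF h] x box_subset_cbox[of a b] by (auto simp: f_def)
    qed
    then have "{x \<in> box a b. d x \<noteq> 0} \<subseteq> N" by auto
    then show ?thesis by (rule negligible_subset[OF N(1)])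
  qed
  have neg: "negligible {x \<in> \<Omega>. d x \<noteq> 0}"
    if D: "countable \<D>" "\<Union>\<D> = \<Omega>" "\<forall>S\<in>\<D>. \<exists>a b. S = box a b \<and> cbox a b \<subseteq> \<Omega>" for \<D>
  proof -
    have "negligible (\<Union>S\<in>\<D>. {x \<in> S. d x \<noteq> 0})"
    proof (rule negligible_countable_Union)
      fix T assume "T \<in> (\<lambda>S. {x \<in> S. d x \<noteq> 0}) ` \<D>"
      then obtain a b where "T = {x \<in> box a b. d x \<noteq> 0}" "cbox a b \<subseteq> \<Omega>" using D(3) by (elim imageE) metis
      then show "negligible T" using *[of a b] by simp
    qed (use D(1) in simp)
    moreover have "{x \<in> \<Omega>. d x \<noteq> 0} \<subseteq> (\<Union>S\<in>\<D>. {x \<in> S. d x \<noteq> 0})" using D(2) by blast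
    ultimately show ?thesis by (rule negligible_subset)
  qed
  have "\<exists>\<D>. countable \<D> \<and> \<Union>\<D> = \<Omega> \<and> (\<forall>S\<in>\<D>. \<exists>a b. S = box a b \<and> cbox a b \<subseteq> \<Omega>)"
  proof -
    define \<F> where "\<F> = {S. \<exists>a b. S = box a b \<and> cbox a b \<subseteq> \<Omega>}"
    have "\<And>S. S \<in> \<F> \<Longrightarrow> open S" unfolding \<F>_def by auto
    then obtain \<D> where \<D>: "\<D> \<subseteq> \<F>" "countable \<D>" "\<Union>\<D> = \<Union>\<F>"
      using Lindelof[of \<F>] by metis
    have "\<Union>\<F> = \<Omega>"
    proof
      show "\<Union>\<F> \<subseteq> \<Omega>" unfolding \<F>_def using box_subset_cbox by fastforce
      show "\<Omega> \<subseteq> \<Union>\<F>"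
      proof
        fix x assume "x \<in> \<Omega>"
        then obtain a b where "cbox a b \<subseteq> \<Omega>" "x \<in> box a b"
          using assms(1) open_contains_cbox by metis
        then show "x \<in> \<Union>\<F>" unfolding \<F>_def by blast
      qed
    qed
    then show ?thesis using \<D> unfolding \<F>_def by (intro exI[of _ \<D>]) auto
  qed
  then have "negligible {x \<in> \<Omega>. d x \<noteq> 0}" using neg by (elim exE conjE)
  then have "AE x in lebesgue. x \<notin> {x \<in> \<Omega>. d x \<noteq> 0}"
    by (intro AE_not_in) (simp add: negligible_iff_null_sets)
  then have "AE x in lebesgue. x \<in> \<Omega> \<longrightarrow> d x = 0" by eventually_elim auto
  then show ?thesis using assms(1) by (subst AE_restrict_space_iff) auto
qed


lemma bounded_test_function:
  assumes "\<phi> \<in> test_functions \<Omega>"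
  obtains K B where "compact K" "K \<subseteq> \<Omega>" "\<And>x. x \<notin> K \<Longrightarrow> \<phi> x = 0" "\<And>x. x \<notin> K \<Longrightarrow> grad \<phi> x = 0"
    "\<And>x. \<bar>\<phi> x\<bar> \<le> B" "\<And>x. norm (grad \<phi> x) \<le> B" "B > 0"
proof -
  obtain K where K: "compact K" "K \<subseteq> \<Omega>" "\<And>x. x \<notin> K \<Longrightarrow> \<phi> x = 0"
    using assms unfolding test_functions_def by auto
  have g: "grad \<phi> x = 0" if "x \<notin> K" for x
    by (rule grad_eq_0_outside[OF compact_imp_closed[OF K(1)] _ that]) (rule K(3))
  note \<phi> = test_functionsD[OF assms]
  have "bounded (\<phi> ` K)" "bounded (grad \<phi> ` K)"
    using compact_continuous_image[OF Ck_continuous[OF \<phi>(1)] K(1)]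
      compact_continuous_image[OF continuous_on_grad[OF \<phi>(1)] K(1)] compact_imp_bounded by blast+
  then obtain B1 B2 where B: "B1 > 0" "B2 > 0" "\<And>x. x \<in> K \<Longrightarrow> \<bar>\<phi> x\<bar> \<le> B1" "\<And>x. x \<in> K \<Longrightarrow> norm (grad \<phi> x) \<le> B2"
    unfolding bounded_pos by auto
  show ?thesis
  proof (rule that[of K "B1 + B2"])
    show "\<bar>\<phi> x\<bar> \<le> B1 + B2" for x by (cases "x \<in> K") (use B K in fastforce)+
    show "norm (grad \<phi> x) \<le> B1 + B2" for x by (cases "x \<in> K") (use B g in fastforce)+
  qed (use K g B in auto)
qed

text \<open>Pairings with test functions and with their derivatives are integrable by this lemma.\<close>

lemma locally_integrable_mult:
  fixes k \<phi> :: "'a::euclidean_space \<Rightarrow> real"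
  assumes "open \<Omega>" "locally_integrable \<Omega> k" "continuous_on UNIV \<phi>" "compact K" "K \<subseteq> \<Omega>"
    "\<And>x. x \<notin> K \<Longrightarrow> \<phi> x = 0"
  shows "integrable (lebesgue_on \<Omega>) (\<lambda>x. k x * \<phi> x)"
proof -
  have [measurable]: "\<phi> \<in> borel_measurable lebesgue"
    by (intro measurable_completion) (simp add: borel_measurable_continuous_onI[OF assms(3)])
  have "bounded (\<phi> ` K)"
    using compact_continuous_image[OF continuous_on_subset[OF assms(3)] assms(4)] compact_imp_bounded by blast
  then obtain B where B: "B > 0" "\<And>x. x \<in> K \<Longrightarrow> \<bar>\<phi> x\<bar> \<le> B"
    unfolding bounded_pos by auto
  have kK: "integrable lebesgue (\<lambda>x. indicator K x *\<^sub>R k x)"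
    using assms(2,4,5) unfolding locally_integrable_def set_integrable_def by blast
  have "integrable lebesgue (\<lambda>x. (indicator K x *\<^sub>R k x) * \<phi> x)"
  proof (rule Bochner_Integration.integrable_bound[OF integrable_mult_right[OF kK, of B]])
    show "(\<lambda>x. (indicator K x *\<^sub>R k x) * \<phi> x) \<in> borel_measurable lebesgue"
      using borel_measurable_integrable[OF kK] by (intro borel_measurable_times) auto
    show "AE x in lebesgue. norm ((indicator K x *\<^sub>R k x) * \<phi> x) \<le> norm (B * (indicator K x *\<^sub>R k x))"
      using B by (auto intro!: AE_I2 simp: indicator_def abs_mult mult.commute[of B] mult_left_mono)
  qed
  moreover have "(\<lambda>x. (indicator K x *\<^sub>R k x) * \<phi> x) = (\<lambda>x. indicator \<Omega> x *\<^sub>R (k x * \<phi> x))"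
    using assms(5,6) by (auto simp: indicator_def fun_eq_iff)
  ultimately show ?thesis
    using assms(1) by (subst integrable_restrict_space) auto
qed

lemma locally_integrable_inner:
  fixes g :: "'a::euclidean_space \<Rightarrow> 'b::euclidean_space"
  shows "locally_integrable \<Omega> g \<Longrightarrow> locally_integrable \<Omega> (\<lambda>x. g x \<bullet> i)"
  unfolding locally_integrable_def set_integrable_def
  by (auto dest!: integrable_inner_left[of i] simp flip: inner_scaleR_left)

lemma locally_integrable_diff:
  fixes g :: "'a::euclidean_space \<Rightarrow> 'b::euclidean_space"
  shows "locally_integrable \<Omega> g \<Longrightarrow> locally_integrable \<Omega> h \<Longrightarrow> locally_integrable \<Omega> (\<lambda>x. g x - h x)"
  unfolding locally_integrable_def by (auto intro: set_integral_diff)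

text \<open>The fundamental lemma of the calculus of variations: bumps converging to the indicator of a box show that
  \<open>d\<close> has integral \<open>0\<close> over every box.\<close>

lemma AE_zero_if_orthogonal_to_test_functions:
  fixes d :: "'a::euclidean_space \<Rightarrow> real"
  assumes "open \<Omega>" "locally_integrable \<Omega> d"
    and orth: "\<And>\<phi>. \<phi> \<in> test_functions \<Omega> \<Longrightarrow> (LINT x|lebesgue_on \<Omega>. d x * \<phi> x) = 0"
  shows "AE x in lebesgue_on \<Omega>. d x = 0"
proof (rule AE_zero_if_integral_cbox_zero[OF assms(1)])
  fix a b :: 'a assume ab: "cbox a b \<subseteq> \<Omega>"
  let ?d = "\<lambda>x. indicator (cbox a b) x *\<^sub>R d x"
  show dab: "d absolutely_integrable_on cbox a b"
    using assms(2) ab unfolding locally_integrable_def by auto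
  then have int: "integrable lebesgue (\<lambda>x. ?d x)" unfolding set_integrable_def .
  let ?\<phi> = "\<lambda>n. box_bump a b (1 / real (Suc n))"
  have t: "?\<phi> n \<in> test_functions \<Omega>" for n by (rule box_bump_test[OF _ ab]) simp
  have m: "(\<lambda>x. ?\<phi> n x * (?d x)) \<in> borel_measurable lebesgue" for n
  proof (intro borel_measurable_times borel_measurable_integrable[OF int])
    show "?\<phi> n \<in> borel_measurable lebesgue"
      by (intro measurable_completion) 
        (simp del: of_nat_Suc add: borel_measurable_continuous_onI[OF Ck_continuous[OF test_functionsD(1)[OF t]]])
  qed
  have "(\<lambda>n. LINT x|lebesgue. ?\<phi> n x * (?d x))
      \<longlonglongrightarrow> (LINT x|lebesgue. indicator (box a b) x * (?d x))"
  proof (rule integral_dominated_convergence[where w="\<lambda>x. norm (?d x)"])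
    show "(\<lambda>x. indicator (box a b) x * (?d x)) \<in> borel_measurable lebesgue"
      by (intro borel_measurable_times borel_measurable_integrable[OF int] borel_measurable_indicator) auto
    show "integrable lebesgue (\<lambda>x. norm (?d x))" using int by (rule integrable_norm)
    show "AE x in lebesgue. (\<lambda>n. ?\<phi> n x * (?d x)) \<longlonglongrightarrow> indicator (box a b) x * (?d x)"
      by (intro AE_I2 tendsto_mult box_bump_tendsto tendsto_const)
    show "AE x in lebesgue. norm (?\<phi> n x * (?d x)) \<le> norm (?d x)" for n
      using box_bump_bounds[of "1 / real (Suc n)" a b] by (intro AE_I2) (auto simp: abs_mult mult_left_le_one_le)
  qed (use m in auto)
  moreover have "(LINT x|lebesgue. ?\<phi> n x * (?d x)) = 0" for n
  proof -
    have "(\<lambda>x. ?\<phi> n x * (?d x)) = (\<lambda>x. indicator \<Omega> x *\<^sub>R (d x * ?\<phi> n x))"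
      using box_bump_eq_0[of _ a b] box_subset_cbox[of a b] ab by (auto simp: indicator_def fun_eq_iff)
    moreover have "(LINT x|lebesgue_on \<Omega>. d x * ?\<phi> n x) = (LINT x|lebesgue. indicator \<Omega> x *\<^sub>R (d x * ?\<phi> n x))"
      using assms(1) by (intro integral_restrict_space) auto
    ultimately show ?thesis using orth[OF t] by metis
  qed
  ultimately have "(LINT x|lebesgue. indicator (box a b) x * (?d x)) = 0"
    by (simp del: of_nat_Suc add: LIMSEQ_const_iff)
  moreover have "(\<lambda>x. indicator (box a b) x * (?d x)) = (\<lambda>x. indicator (box a b) x *\<^sub>R d x)"
    using box_subset_cbox[of a b] by (auto simp: indicator_def fun_eq_iff)
  moreover have "d absolutely_integrable_on box a b"
    by (rule set_integrable_subset[OF dab _ box_subset_cbox]) simp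
  ultimately have "integral (box a b) d = 0"
    using set_lebesgue_integral_eq_integral(2)[of "box a b" d] unfolding set_lebesgue_integral_def by simp
  then show "integral (cbox a b) d = 0" by (simp add: integral_open_interval)
qed

lemma integrable_test_pairing:
  fixes \<phi> :: "'a::euclidean_space \<Rightarrow> real"
  assumes "open \<Omega>" "\<phi> \<in> test_functions \<Omega>"
  shows "locally_integrable \<Omega> v \<Longrightarrow> integrable (lebesgue_on \<Omega>) (\<lambda>x. v x * (grad \<phi> x \<bullet> i))"
    and "locally_integrable \<Omega> w \<Longrightarrow> integrable (lebesgue_on \<Omega>) (\<lambda>x. (w x \<bullet> j) * \<phi> x)"
proof -
  have C: "Ck 1 \<phi>" by (rule test_functionsD(1)[OF assms(2)])
  obtain K where K: "compact K" "K \<subseteq> \<Omega>" "\<And>x. x \<notin> K \<Longrightarrow> \<phi> x = 0" "\<And>x. x \<notin> K \<Longrightarrow> grad \<phi> x = 0"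
    by (rule bounded_test_function[OF assms(2)]) blast
  have c: "continuous_on UNIV \<phi>" "continuous_on UNIV (\<lambda>x. grad \<phi> x \<bullet> i)"
    using Ck_continuous[OF C] continuous_on_grad[OF C] by (auto intro!: continuous_intros)
  show "integrable (lebesgue_on \<Omega>) (\<lambda>x. v x * (grad \<phi> x \<bullet> i))" if "locally_integrable \<Omega> v"
    by (rule locally_integrable_mult[OF assms(1) that c(2) K(1,2)]) (simp add: K(4))
  show "integrable (lebesgue_on \<Omega>) (\<lambda>x. (w x \<bullet> j) * \<phi> x)" if "locally_integrable \<Omega> w"
    by (rule locally_integrable_mult[OF assms(1) locally_integrable_inner[OF that] c(1) K(1,2)]) (simp add: K(3))
qed

lemma weak_gradient_unique:
  fixes u :: "'a::euclidean_space \<Rightarrow> real"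
  assumes "open \<Omega>" "has_weak_gradient \<Omega> u g" "has_weak_gradient \<Omega> u g'"
  shows "AE x in lebesgue_on \<Omega>. g x = g' x"
proof -
  have l: "locally_integrable \<Omega> g" "locally_integrable \<Omega> g'" using assms unfolding has_weak_gradient_def by auto
  have "AE x in lebesgue_on \<Omega>. g x \<bullet> i - g' x \<bullet> i = 0" if i: "i \<in> Basis" for i
  proof (rule AE_zero_if_orthogonal_to_test_functions[OF assms(1)])
    show "locally_integrable \<Omega> (\<lambda>x. g x \<bullet> i - g' x \<bullet> i)" using l by (intro locally_integrable_diff locally_integrable_inner)
    fix \<phi> assume t: "\<phi> \<in> test_functions \<Omega>"
    note int = integrable_test_pairing(2)[OF assms(1) t]
    have "(LINT x|lebesgue_on \<Omega>. (g x \<bullet> i) * \<phi> x) = (LINT x|lebesgue_on \<Omega>. (g' x \<bullet> i) * \<phi> x)"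
    proof -
      have "- (LINT x|lebesgue_on \<Omega>. (g x \<bullet> i) * \<phi> x) = - (LINT x|lebesgue_on \<Omega>. (g' x \<bullet> i) * \<phi> x)"
        using assms(2,3)[unfolded has_weak_gradient_def, THEN conjunct2, THEN conjunct2, rule_format, OF t i]
        by (rule trans[OF sym])
      then show ?thesis by simp
    qed
    then show "(LINT x|lebesgue_on \<Omega>. (g x \<bullet> i - g' x \<bullet> i) * \<phi> x) = 0"
      using int[OF l(1), of i] int[OF l(2), of i] by (simp add: left_diff_distrib)
  qed
  then have "AE x in lebesgue_on \<Omega>. \<forall>i\<in>Basis. g x \<bullet> i - g' x \<bullet> i = 0"
    by (intro AE_finite_allI) auto
  then show ?thesis by eventually_elim (rule euclidean_eqI, simp)
qed

text \<open>Uniqueness ties the gradient selected by the choice operator to any weak gradient found by a computation.\<close>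

lemma weak_gradient_eq_AE:
  fixes u :: "'a::euclidean_space \<Rightarrow> real"
  assumes "open \<Omega>" "has_weak_gradient \<Omega> u g"
  shows "AE x in lebesgue_on \<Omega>. weak_gradient \<Omega> u x = g x" "has_weak_gradient \<Omega> u (weak_gradient \<Omega> u)"
proof -
  show "has_weak_gradient \<Omega> u (weak_gradient \<Omega> u)"
    unfolding weak_gradient_def using assms(2) by (rule someI[where P="has_weak_gradient \<Omega> u"])
  then show "AE x in lebesgue_on \<Omega>. weak_gradient \<Omega> u x = g x"
    using weak_gradient_unique assms by blast
qed

lemma has_weak_gradient_C1:
  fixes \<psi> :: "'a::euclidean_space \<Rightarrow> real"
  assumes "open \<Omega>" "Ck 1 \<psi>" shows "has_weak_gradient \<Omega> \<psi> (grad \<psi>)"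
  unfolding has_weak_gradient_def
  using integration_by_parts_test[OF assms(1) _ assms(2)] continuous_on_grad[OF assms(2)] Ck_continuous[OF assms(2)]
  by (auto intro: locally_integrable_continuous)

section \<open>The Sobolev inequality for compactly supported C^1 functions\<close>

text \<open>Young's inequality after normalising both factors. Taking upper bounds \<open>A\<close> and \<open>B\<close> instead of the integrals
  themselves keeps all powers in the real numbers.\<close>

lemma nn_integral_Hoelder:
  fixes f g :: "'a \<Rightarrow> real"
  assumes [measurable]: "f \<in> borel_measurable M" "g \<in> borel_measurable M"
    and nn: "\<And>x. 0 \<le> f x" "\<And>x. 0 \<le> g x" and pq: "1 < p" "1 < q" "1 / p + 1 / q = 1"
    and A: "(\<integral>\<^sup>+x. ennreal (f x powr p) \<partial>M) \<le> ennreal A" "0 \<le> A"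
    and B: "(\<integral>\<^sup>+x. ennreal (g x powr q) \<partial>M) \<le> ennreal B" "0 \<le> B"
  shows "(\<integral>\<^sup>+x. ennreal (f x * g x) \<partial>M) \<le> ennreal (A powr (1 / p) * B powr (1 / q))"
proof (cases "A = 0 \<or> B = 0")
  case True
  have "AE x in M. f x * g x = 0"
    using True
  proof
    assume "A = 0"
    then have "(\<integral>\<^sup>+x. ennreal (f x powr p) \<partial>M) = 0" using A by simp
    then have "AE x in M. ennreal (f x powr p) = 0" by (subst (asm) nn_integral_0_iff_AE) auto
    then show ?thesis by eventually_elim (simp add: nn)
  next
    assume "B = 0"
    then have "(\<integral>\<^sup>+x. ennreal (g x powr q) \<partial>M) = 0" using B by simp
    then have "AE x in M. ennreal (g x powr q) = 0" by (subst (asm) nn_integral_0_iff_AE) auto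
    then show ?thesis by eventually_elim (simp add: nn)
  qed
  then have "(\<integral>\<^sup>+x. ennreal (f x * g x) \<partial>M) = (\<integral>\<^sup>+x. 0 \<partial>M)"
    by (intro nn_integral_cong_AE) (auto elim: eventually_mono)
  then show ?thesis by simp
next
  case False
  then have pos: "A > 0" "B > 0" using A B by auto
  define c where "c = A powr (1 / p) * B powr (1 / q)"
  have c: "c > 0" using pos by (simp add: c_def)
  define \<alpha> \<beta> where "\<alpha> = c / (p * A)" and "\<beta> = c / (q * B)"
  have pt: "f x * g x \<le> \<alpha> * f x powr p + \<beta> * g x powr q" for x
  proof -
    have "(f x / A powr (1 / p)) * (g x / B powr (1 / q))
        \<le> (f x / A powr (1 / p)) powr p / p + (g x / B powr (1 / q)) powr q / q"
      by (rule Youngs_inequality) (use pq nn in auto)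
    also have "\<dots> = f x powr p / (p * A) + g x powr q / (q * B)"
      using pos pq nn by (simp add: powr_divide powr_powr mult.commute)
    finally have "f x * g x / c \<le> f x powr p / (p * A) + g x powr q / (q * B)"
      by (simp add: c_def)
    then show ?thesis using c by (simp add: \<alpha>_def \<beta>_def field_simps)
  qed
  have nnc: "0 \<le> \<alpha>" "0 \<le> \<beta>" using c pos pq by (auto simp: \<alpha>_def \<beta>_def)
  have "(\<integral>\<^sup>+x. ennreal (f x * g x) \<partial>M)
      \<le> (\<integral>\<^sup>+x. ennreal (\<alpha>) * ennreal (f x powr p) + ennreal (\<beta>) * ennreal (g x powr q) \<partial>M)"
  proof (intro nn_integral_mono)
    fix x
    show "ennreal (f x * g x) \<le> ennreal \<alpha> * ennreal (f x powr p) + ennreal \<beta> * ennreal (g x powr q)"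
      using ennreal_leI[OF pt[of x]] nnc by (simp add: ennreal_mult' ennreal_plus)
  qed
  also have "\<dots> = ennreal (\<alpha>) * (\<integral>\<^sup>+x. ennreal (f x powr p) \<partial>M) + ennreal (\<beta>) * (\<integral>\<^sup>+x. ennreal (g x powr q) \<partial>M)"
    by (subst nn_integral_add) (auto simp: nn_integral_cmult)
  also have "\<dots> \<le> ennreal (\<alpha>) * ennreal A + ennreal (\<beta>) * ennreal B"
    using A B by (intro add_mono mult_left_mono) auto
  also have "\<dots> = ennreal (\<alpha> * A + \<beta> * B)"
    using nnc A B by (simp add: ennreal_mult' ennreal_plus)
  also have "\<alpha> * A + \<beta> * B = c * (1 / p + 1 / q)"
    using pos pq by (simp add: \<alpha>_def \<beta>_def field_simps)
  finally show ?thesis using pq by (simp add: c_def)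
qed

text \<open>The ray from \<open>x\<close> in the direction \<open>\<omega>\<close> eventually leaves the support, so \<open>u x\<close> is the integral of the derivative along
  it. For \<open>\<omega> = 0\<close> the ray never moves and the bound can fail where the gradient vanishes.\<close>

lemma ray_bound:
  fixes u :: "'a::euclidean_space \<Rightarrow> real"
  assumes "C1_compact u" "\<omega> \<noteq> 0" "norm \<omega> \<le> 1"
  shows "ennreal \<bar>u x\<bar> \<le> (\<integral>\<^sup>+t. ennreal (norm (grad u (x + t *\<^sub>R \<omega>))) * indicator {0..} t \<partial>lborel)"
proof -
  have C: "Ck 1 u" using assms(1) unfolding C1_compact_def by simp
  obtain R where R: "R > 0" "\<And>x. norm x > R \<Longrightarrow> u x = 0"
    using C1_compactE[OF assms(1)] by metis
  define T where "T = (R + norm x + 1) / norm \<omega>"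
  have T: "T \<ge> 0" using R assms(2) by (auto simp: T_def)
  have "norm (T *\<^sub>R \<omega>) = R + norm x + 1" using R(1) assms(2) by (simp add: T_def abs_of_pos add_pos_nonneg)
  then have uT: "u (x + T *\<^sub>R \<omega>) = 0"
    using norm_diff_ineq[of "T *\<^sub>R \<omega>" x] by (intro R(2)) (simp add: add.commute)
  define f where "f t = grad u (x + t *\<^sub>R \<omega>) \<bullet> \<omega>" for t
  have der: "((\<lambda>t. u (x + t *\<^sub>R \<omega>)) has_vector_derivative f t) (at t within {0..T})" for t
  proof -
    have "((\<lambda>t. u (x + t *\<^sub>R \<omega>)) has_derivative (\<lambda>s. grad u (x + t *\<^sub>R \<omega>) \<bullet> (s *\<^sub>R \<omega>))) (at t)"
      by (rule has_derivative_compose[of "\<lambda>t. x + t *\<^sub>R \<omega>" "\<lambda>t. t *\<^sub>R \<omega>"])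
         (use grad_has_derivative[OF C, of "x + t *\<^sub>R \<omega>"] in \<open>auto intro!: derivative_eq_intros\<close>)
    then have "((\<lambda>t. u (x + t *\<^sub>R \<omega>)) has_vector_derivative f t) (at t)"
      by (simp add: has_vector_derivative_def f_def)
    then show ?thesis by (rule has_vector_derivative_at_within)
  qed
  have cf: "continuous_on {0..T} f"
    unfolding f_def
    by (intro continuous_intros continuous_on_compose2[OF continuous_on_grad[OF C, of UNIV]]) auto
  have hb: "has_bochner_integral lborel (\<lambda>t. indicator {0..T} t *\<^sub>R f t) (u (x + T *\<^sub>R \<omega>) - u (x + 0 *\<^sub>R \<omega>))"
    by (rule has_bochner_integral_FTC_Icc[OF T der cf])
  then have "\<bar>u x\<bar> = norm (LINT t|lborel. indicator {0..T} t *\<^sub>R f t)"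
    using uT by (simp add: has_bochner_integral_iff)
  then have "ennreal \<bar>u x\<bar> \<le> (\<integral>\<^sup>+t. ennreal (norm (indicator {0..T} t *\<^sub>R f t)) \<partial>lborel)"
    using integral_norm_bound_ennreal[of lborel "\<lambda>t. indicator {0..T} t *\<^sub>R f t"] hb
    by (simp add: has_bochner_integral_iff)
  also have "\<dots> \<le> (\<integral>\<^sup>+t. ennreal (norm (grad u (x + t *\<^sub>R \<omega>))) * indicator {0..} t \<partial>lborel)"
  proof (intro nn_integral_mono)
    fix t :: real
    have "\<bar>f t\<bar> \<le> norm (grad u (x + t *\<^sub>R \<omega>)) * norm \<omega>" unfolding f_def by (rule Cauchy_Schwarz_ineq2)
    also have "\<dots> \<le> norm (grad u (x + t *\<^sub>R \<omega>))" using assms(3) by (simp add: mult_left_le)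
    finally show "ennreal (norm (indicator {0..T} t *\<^sub>R f t)) \<le> ennreal (norm (grad u (x + t *\<^sub>R \<omega>))) * indicator {0..} t"
      by (auto simp: indicator_def intro!: ennreal_leI)
  qed
  finally show ?thesis .
qed

lemma nn_integral_powr_tail:
  fixes T a :: real assumes "T > 0" "a > 1"
  shows "(\<integral>\<^sup>+t. ennreal (t powr (- a)) * indicator {T..} t \<partial>lborel) = ennreal (T powr (1 - a) / (a - 1))"
proof -
  have "(\<integral>\<^sup>+t. ennreal (t powr (- a)) * indicator {T..} t \<partial>lborel) = ennreal (0 - (- (T powr (1 - a) / (a - 1))))"
  proof (rule nn_integral_FTC_atLeast[where F="\<lambda>t. - (t powr (1 - a) / (a - 1))"])
    show "((\<lambda>t. - (t powr (1 - a) / (a - 1))) has_real_derivative t powr - a) (at t)" if "T \<le> t" for t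
    proof -
      have "((\<lambda>t. t powr (1 - a)) has_real_derivative (1 - a) * t powr (1 - a - 1)) (at t)"
        using that assms by (intro has_real_derivative_powr) auto
      then have "((\<lambda>t. - (t powr (1 - a) / (a - 1))) has_real_derivative - ((1 - a) * t powr (1 - a - 1) / (a - 1))) (at t)"
        by (intro DERIV_minus DERIV_cdivide)
      moreover have "- ((1 - a) * t powr (1 - a - 1) / (a - 1)) = t powr - a"
        using assms by (simp add: field_simps)
      ultimately show ?thesis by simp
    qed
    have "((\<lambda>t. t powr (1 - a)) \<longlongrightarrow> 0) at_top"
      using assms by (intro tendsto_neg_powr filterlim_ident) auto
    then have "((\<lambda>t. - (t powr (1 - a) / (a - 1))) \<longlongrightarrow> - (0 / (a - 1))) at_top"
      by (intro tendsto_intros) (use assms in auto)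
    then show "((\<lambda>t. - (t powr (1 - a) / (a - 1))) \<longlongrightarrow> 0) at_top" by simp
  qed auto
  then show ?thesis by simp
qed

lemma nn_integral_lborel_shift_scale:
  fixes g :: "'a::euclidean_space \<Rightarrow> ennreal"
  assumes [measurable]: "g \<in> borel_measurable borel" and t: "t > 0"
  shows "(\<integral>\<^sup>+\<omega>. g (x + t *\<^sub>R \<omega>) \<partial>lborel) = ennreal (t powr (- real DIM('a))) * (\<integral>\<^sup>+y. g y \<partial>lborel)"
proof -
  have "(\<integral>\<^sup>+y. g y \<partial>lborel) = (\<integral>\<^sup>+y. g y \<partial>density (distr lborel borel (\<lambda>\<omega>. x + t *\<^sub>R \<omega>)) (\<lambda>_. \<bar>t\<bar> ^ DIM('a)))"
    using lborel_affine[of t x] t by simp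
  also have "\<dots> = ennreal (t ^ DIM('a)) * (\<integral>\<^sup>+\<omega>. g (x + t *\<^sub>R \<omega>) \<partial>lborel)"
    using t by (simp add: nn_integral_density nn_integral_distr nn_integral_cmult)
  finally have "ennreal (t powr (- real DIM('a))) * (\<integral>\<^sup>+y. g y \<partial>lborel)
     = ennreal (t powr (- real DIM('a)) * t ^ DIM('a)) * (\<integral>\<^sup>+\<omega>. g (x + t *\<^sub>R \<omega>) \<partial>lborel)"
    using t by (simp add: ennreal_mult' mult.assoc)
  also have "t powr (- real DIM('a)) * t ^ DIM('a) = 1"
    using t by (simp add: powr_minus powr_realpow)
  finally show ?thesis by simp
qed

lemma nn_integral_lborel_shift:
  fixes g :: "'a::euclidean_space \<Rightarrow> ennreal"
  assumes [measurable]: "g \<in> borel_measurable borel"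
  shows "(\<integral>\<^sup>+x. g (x + v) \<partial>lborel) = (\<integral>\<^sup>+y. g y \<partial>lborel)"
proof -
  have "(\<integral>\<^sup>+y. g y \<partial>lborel) = (\<integral>\<^sup>+y. g y \<partial>distr lborel borel ((+) v))"
    by (simp add: lborel_distr_plus)
  also have "\<dots> = (\<integral>\<^sup>+x. g (x + v) \<partial>lborel)"
    by (subst nn_integral_distr) (auto simp: add.commute)
  finally show ?thesis ..
qed


text \<open>The exponent of \<open>e\<close> is \<open>1 - 1/p^*\<close>, so with \<open>E\<close> a level set of \<open>u\<close> this is the weak-type Sobolev inequality.
  
  The bound on rays is averaged over \<open>x \<in> E\<close> and over directions \<open>\<omega>\<close> in the punctured unit ball \<open>B\<close>. For fixed \<open>t\<close>
  the double integral of \<open>|\<nabla>u(x + t \<omega>)|^p\<close> over \<open>E \<times> B\<close> can be computed in either order: integrating over \<open>x\<close>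
  first bounds it by \<open>|B| \<parallel>\<nabla>u\<parallel>_p^p\<close>, integrating over \<open>\<omega>\<close> first by \<open>|E| t^(-N) \<parallel>\<nabla>u\<parallel>_p^p\<close>. After Hoelder's
  inequality the first bound is used for \<open>t \<le> |E|^(1/N)\<close> and the second beyond, where \<open>t^(-N/p)\<close> is integrable
  because \<open>p < N\<close>.\<close>

lemma weak_sobolev:
  fixes p :: real
  assumes p: "1 < p" "p < real DIM('a::euclidean_space)"
  obtains C where "C > 0" "\<And>(u :: 'a \<Rightarrow> real) E D e.
    \<lbrakk>C1_compact u; E \<in> sets lborel; emeasure lborel E \<le> ennreal e; 0 \<le> e;
     (\<integral>\<^sup>+x. ennreal (norm (grad u x) powr p) \<partial>lborel) \<le> ennreal D; 0 \<le> D\<rbrakk> \<Longrightarrow>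
    (\<integral>\<^sup>+x. ennreal \<bar>u x\<bar> * indicator E x \<partial>lborel) \<le> ennreal (C * D powr (1 / p) * e powr (1 - 1 / p + 1 / real DIM('a)))"
proof -
  define B where "B = ball (0::'a) 1 - {0}"
  define \<beta> where "\<beta> = measure lborel (ball (0::'a) 1)"
  have \<beta>: "\<beta> > 0" unfolding \<beta>_def by (rule content_ball_pos) simp
  have B[measurable]: "B \<in> sets borel" unfolding B_def by simp
  have emB: "emeasure lborel B = ennreal \<beta>"
  proof -
    have "emeasure lborel B = emeasure lborel (ball (0::'a) 1)"
      unfolding B_def by (rule emeasure_Diff_null_set) (auto simp: null_sets_def)
    also have "\<dots> = ennreal \<beta>"
      unfolding \<beta>_def using emeasure_bounded_finite[of "ball (0::'a) 1"]
      by (intro emeasure_eq_ennreal_measure) auto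
    finally show ?thesis .
  qed
  define N where "N = real DIM('a)"
  define q where "q = p / (p - 1)"
  have q: "q > 1" "1 / p + 1 / q = 1" using p by (auto simp: q_def field_simps)
  have Np: "N / p > 1" "N > 0" using p by (auto simp: N_def)
  define C where "C = (1 / \<beta>) * \<beta> powr (1 / q) * (\<beta> powr (1 / p) + 1 / (N / p - 1))"
  have Cpos: "C > 0" using \<beta> Np unfolding C_def by (intro mult_pos_pos add_pos_pos) auto
  show ?thesis
  proof (rule that[OF Cpos])
    fix u :: "'a \<Rightarrow> real" and E :: "'a set" and D e :: real
    let ?U = "\<integral>\<^sup>+x. ennreal \<bar>u x\<bar> * indicator E x \<partial>lborel"
    let ?c = "(e * \<beta>) powr (1 / q)"
    let ?a = "(\<beta> * D) powr (1 / p)"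
    let ?b = "(e * D) powr (1 / p)"
    let ?T = "e powr (1 / N)"
    assume u: "C1_compact u" and E: "E \<in> sets lborel" and Ee: "emeasure lborel E \<le> ennreal e" "0 \<le> e"
      and D: "(\<integral>\<^sup>+x. ennreal (norm (grad u x) powr p) \<partial>lborel) \<le> ennreal D" "0 \<le> D"
    have E'[measurable]: "E \<in> sets borel" using E by simp
    have C1: "Ck 1 u" using u unfolding C1_compact_def by simp
    have [measurable]: "u \<in> borel_measurable borel"
      by (rule borel_measurable_continuous_onI[OF Ck_continuous[OF C1]])
    define g where "g x = norm (grad u x)" for x
    let ?F = "\<lambda>t x \<omega>. ennreal (g (x + t *\<^sub>R \<omega>)) * indicator B \<omega> * indicator E x"
    let ?G = "\<lambda>t x \<omega>. ennreal (g (x + t *\<^sub>R \<omega>) powr p) * indicator B \<omega> * indicator E x"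
    have [measurable]: "g \<in> borel_measurable borel"
      unfolding g_def by (intro borel_measurable_continuous_onI continuous_on_norm continuous_on_grad[OF C1])
    have g0: "g x \<ge> 0" for x by (simp add: g_def)
    have D': "(\<integral>\<^sup>+x. ennreal (g x powr p) \<partial>lborel) \<le> ennreal D" using D by (simp add: g_def)
    show "?U \<le> ennreal (C * D powr (1 / p) * e powr (1 - 1 / p + 1 / real DIM('a)))"
    proof (cases "e = 0")
      case True
      then have "E \<in> null_sets lborel" using Ee E by (auto simp: null_sets_def)
      then have "AE x in lborel. ennreal \<bar>u x\<bar> * indicator E x = 0"
        by (rule AE_not_in[THEN eventually_mono]) auto
      then have "?U = 0"
        by (subst nn_integral_0_iff_AE) auto
      then show ?thesis by simp
    next
      case False
      then have e: "e > 0" using Ee by simp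
      define J where "J t = (\<integral>\<^sup>+x. \<integral>\<^sup>+\<omega>. ?F t x \<omega> \<partial>lborel \<partial>lborel)" for t :: real
      define K where "K t = (\<integral>\<^sup>+x. \<integral>\<^sup>+\<omega>. ?G t x \<omega> \<partial>lborel \<partial>lborel)" for t :: real
      \<comment> \<open>Integration over \<open>x\<close> first, by translation invariance.\<close>
      have K1: "K t \<le> ennreal (\<beta> * D)" for t
      proof -
        have "K t = (\<integral>\<^sup>+\<omega>. \<integral>\<^sup>+x. ?G t x \<omega> \<partial>lborel \<partial>lborel)"
          unfolding K_def by (rule lborel_pair.Fubini') measurable
        also have "\<dots> \<le> (\<integral>\<^sup>+\<omega>. ennreal D * indicator B \<omega> \<partial>lborel)"
        proof (rule nn_integral_mono)
          fix \<omega> :: 'a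
          have "(\<integral>\<^sup>+x. ?G t x \<omega> \<partial>lborel)
            \<le> (\<integral>\<^sup>+x. ennreal (g (x + t *\<^sub>R \<omega>) powr p) * indicator B \<omega> \<partial>lborel)"
            by (intro nn_integral_mono) (auto simp: indicator_def)
          also have "\<dots> = (\<integral>\<^sup>+x. ennreal (g (x + t *\<^sub>R \<omega>) powr p) \<partial>lborel) * indicator B \<omega>"
            by (rule nn_integral_multc) measurable
          also have "(\<integral>\<^sup>+x. ennreal (g (x + t *\<^sub>R \<omega>) powr p) \<partial>lborel) = (\<integral>\<^sup>+x. ennreal (g x powr p) \<partial>lborel)"
            by (rule nn_integral_lborel_shift[where g="\<lambda>x. ennreal (g x powr p)"]) measurable
          also have "\<dots> * indicator B \<omega> \<le> ennreal D * indicator B \<omega>"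
            by (rule mult_right_mono[OF D']) simp
          finally show "(\<integral>\<^sup>+x. ?G t x \<omega> \<partial>lborel) \<le> ennreal D * indicator B \<omega>" .
        qed
        also have "\<dots> = ennreal (\<beta> * D)"
          using \<beta> D by (subst nn_integral_cmult_indicator) (auto simp: emB ennreal_mult' mult.commute)
        finally show ?thesis .
      qed
      \<comment> \<open>Integration over \<open>\<omega>\<close> first; the substitution \<open>y = x + t \<omega>\<close> produces the factor \<open>t^(-N)\<close>.\<close>
      have K2: "K t \<le> ennreal (e * D * t powr (- N))" if t: "t > 0" for t
      proof -
        have "K t \<le> (\<integral>\<^sup>+x. ennreal (t powr (- N) * D) * indicator E x \<partial>lborel)"
          unfolding K_def
        proof (rule nn_integral_mono)
          fix x :: 'a
          have "(\<integral>\<^sup>+\<omega>. ?G t x \<omega> \<partial>lborel)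
            \<le> (\<integral>\<^sup>+\<omega>. ennreal (g (x + t *\<^sub>R \<omega>) powr p) * indicator E x \<partial>lborel)"
            by (intro nn_integral_mono) (auto simp: indicator_def)
          also have "\<dots> = (\<integral>\<^sup>+\<omega>. ennreal (g (x + t *\<^sub>R \<omega>) powr p) \<partial>lborel) * indicator E x"
            by (rule nn_integral_multc) measurable
          also have "(\<integral>\<^sup>+\<omega>. ennreal (g (x + t *\<^sub>R \<omega>) powr p) \<partial>lborel) = ennreal (t powr (- N)) * (\<integral>\<^sup>+x. ennreal (g x powr p) \<partial>lborel)"
            unfolding N_def by (rule nn_integral_lborel_shift_scale[where g="\<lambda>x. ennreal (g x powr p)"]) (use t in measurable)
          also have "\<dots> * indicator E x \<le> (ennreal (t powr (- N)) * ennreal D) * indicator E x"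
            by (intro mult_right_mono mult_left_mono D') auto
          finally show "(\<integral>\<^sup>+\<omega>. ?G t x \<omega> \<partial>lborel) \<le> ennreal (t powr (- N) * D) * indicator E x"
            by (simp add: ennreal_mult')
        qed
        also have "\<dots> = ennreal (t powr (- N) * D) * emeasure lborel E"
          by (rule nn_integral_cmult_indicator[OF E])
        also have "\<dots> \<le> ennreal (t powr (- N) * D) * ennreal e" by (intro mult_left_mono Ee) simp
        finally show ?thesis using D Ee by (simp add: ennreal_mult'[symmetric] mult_ac)
      qed
      \<comment> \<open>Hoelder's inequality on \<open>E \<times> B\<close>, with the indicator as second factor.\<close>
      have J1: "J t \<le> ennreal (k powr (1 / p) * ?c)" if k: "K t \<le> ennreal k" "0 \<le> k" for t k
      proof -
        let ?M = "(lborel :: 'a measure) \<Otimes>\<^sub>M (lborel :: 'a measure)"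
        define F where "F z = g (fst z + t *\<^sub>R snd z) * (indicator B (snd z) * indicator E (fst z))" for z :: "'a \<times> 'a"
        define G where "G z = (indicator B (snd z) * indicator E (fst z) :: real)" for z :: "'a \<times> 'a"
        have [measurable]: "F \<in> borel_measurable ?M" "G \<in> borel_measurable ?M"
          unfolding F_def G_def by measurable
        have "(\<integral>\<^sup>+z. ennreal (F z * G z) \<partial>?M) \<le> ennreal (k powr (1 / p) * ?c)"
        proof (rule nn_integral_Hoelder)
          show "0 \<le> F x" "0 \<le> G x" for x by (simp_all add: F_def G_def g0)
          have "(\<integral>\<^sup>+z. ennreal (F z powr p) \<partial>?M) = K t"
            unfolding K_def using p
            by (subst lborel.nn_integral_fst[symmetric]) (auto simp: F_def indicator_def intro!: nn_integral_cong)
          then show "(\<integral>\<^sup>+z. ennreal (F z powr p) \<partial>?M) \<le> ennreal k" using k by simp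
          have "(\<integral>\<^sup>+z. ennreal (G z powr q) \<partial>?M) = (\<integral>\<^sup>+x. \<integral>\<^sup>+\<omega>. indicator E x * indicator B \<omega> \<partial>lborel \<partial>lborel)"
            by (subst lborel.nn_integral_fst[symmetric]) (auto simp: G_def indicator_def intro!: nn_integral_cong)
          also have "\<dots> = emeasure lborel E * ennreal \<beta>"
            by (simp add: nn_integral_cmult nn_integral_multc emB)
          also have "\<dots> \<le> ennreal e * ennreal \<beta>" by (intro mult_right_mono Ee) simp
          finally show "(\<integral>\<^sup>+z. ennreal (G z powr q) \<partial>?M) \<le> ennreal (e * \<beta>)" using Ee by (simp add: ennreal_mult')
          show "0 \<le> e * \<beta>" using Ee \<beta> by simp
        qed (use p q k in auto)
        moreover have "(\<integral>\<^sup>+z. ennreal (F z * G z) \<partial>?M) = J t"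
          unfolding J_def
          by (subst lborel.nn_integral_fst[symmetric]) (auto simp: F_def G_def indicator_def intro!: nn_integral_cong)
        ultimately show ?thesis by simp
      qed
      have "ennreal \<beta> * ?U
          = (\<integral>\<^sup>+x. \<integral>\<^sup>+\<omega>. ennreal \<bar>u x\<bar> * indicator E x * indicator B \<omega> \<partial>lborel \<partial>lborel)"
        by (simp add: nn_integral_cmult nn_integral_multc emB mult.commute)
      also have "\<dots> \<le> (\<integral>\<^sup>+x. \<integral>\<^sup>+\<omega>. \<integral>\<^sup>+t. ?F t x \<omega> * indicator {0..} t \<partial>lborel \<partial>lborel \<partial>lborel)"
      proof (intro nn_integral_mono)
        fix x \<omega> :: 'a
        show "ennreal \<bar>u x\<bar> * indicator E x * indicator B \<omega> \<le> (\<integral>\<^sup>+t. ?F t x \<omega> * indicator {0..} t \<partial>lborel)"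
          using ray_bound[OF u, of \<omega> x] unfolding g_def by (auto simp: indicator_def B_def)
      qed
      also have "\<dots> = (\<integral>\<^sup>+x. \<integral>\<^sup>+t. \<integral>\<^sup>+\<omega>. ?F t x \<omega> * indicator {0..} t \<partial>lborel \<partial>lborel \<partial>lborel)"
        by (intro nn_integral_cong lborel_pair.Fubini'[symmetric]) measurable
      also have "\<dots> = (\<integral>\<^sup>+t. \<integral>\<^sup>+x. \<integral>\<^sup>+\<omega>. ?F t x \<omega> * indicator {0..} t \<partial>lborel \<partial>lborel \<partial>lborel)"
        by (rule lborel_pair.Fubini'[symmetric]) measurable
      also have "\<dots> = (\<integral>\<^sup>+t. J t * indicator {0..} t \<partial>lborel)"
        unfolding J_def by (simp add: nn_integral_multc)
      also have "\<dots> \<le> (\<integral>\<^sup>+t. ennreal (?a * ?c) * indicator {0..?T} t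
           + ennreal (?b * ?c) * (ennreal (t powr (- (N / p))) * indicator {?T..} t) \<partial>lborel)"
      proof (intro nn_integral_mono)
        fix t :: real
        have "J t \<le> ennreal (?a * ?c)"
          using J1[OF K1] \<beta> D by simp
        moreover have "J t \<le> ennreal (?b * ?c) * ennreal (t powr (- (N / p)))"
          if "t > 0"
        proof -
          have "J t \<le> ennreal ((e * D * t powr (- N)) powr (1 / p) * ?c)"
            using J1[OF K2[OF that]] e D by simp
          also have "(e * D * t powr (- N)) powr (1 / p) = ?b * t powr (- (N / p))"
            using that e D by (simp add: powr_mult powr_powr)
          finally show ?thesis by (simp add: ennreal_mult'[symmetric] mult_ac)
        qed
        moreover have "?T > 0" using e by simp
        ultimately show "J t * indicator {0..} t \<le> ennreal (?a * ?c) * indicator {0..?T} t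
           + ennreal (?b * ?c) * (ennreal (t powr (- (N / p))) * indicator {?T..} t)"
          by (cases "t \<le> ?T") (auto simp: indicator_def intro: add_increasing2)
      qed
      also have "\<dots> = ennreal (?a * ?c) * ennreal ?T
           + ennreal (?b * ?c) * ennreal (?T powr (1 - N / p) / (N / p - 1))"
        using nn_integral_powr_tail[of "?T" "N / p"] e Np
        by (subst nn_integral_add) (auto simp: nn_integral_cmult)
      also have "\<dots> = ennreal ((?a * ?c) * ?T
           + (?b * ?c) * (?T powr (1 - N / p) / (N / p - 1)))"
      proof -
        have "ennreal a * ennreal b + ennreal c * ennreal d = ennreal (a * b + c * d)"
          if "0 \<le> a" "0 \<le> b" "0 \<le> c" "0 \<le> d" for a b c d
          using that by (simp add: ennreal_mult ennreal_plus)
        then show ?thesis using Np by simp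
      qed
      also have "(?a * ?c) * ?T
           + (?b * ?c) * (?T powr (1 - N / p) / (N / p - 1))
         = \<beta> * (C * D powr (1 / p) * e powr (1 / q + 1 / N))"
      proof -
        have "?T powr (1 - N / p) = e powr (1 / N - 1 / p)"
          using Np by (simp add: powr_powr field_simps)
        moreover have "e powr (1 / p) * e powr (1 / N - 1 / p) = ?T" "e powr (1 / q) * ?T = e powr (1 / q + 1 / N)"
          using e by (simp_all add: powr_add[symmetric])
        ultimately have eq: "?b * ?T powr (1 - N / p) = D powr (1 / p) * ?T"
          using D e by (simp add: powr_mult)
        have gen: "x * y * (z / w) = (x * z) * y * (1 / w)" for x y z w :: real by simp
        have "(?b * ?c) * (?T powr (1 - N / p) / (N / p - 1))
           = (D powr (1 / p) * ?T) * ?c * (1 / (N / p - 1))"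
          by (subst gen) (simp only: eq)
        moreover have "?c = e powr (1 / q) * \<beta> powr (1 / q)" "?a = \<beta> powr (1 / p) * D powr (1 / p)"
          using e \<beta> D by (simp_all add: powr_mult)
        moreover have "bp * d * (ee * bq) * en + d * en * (ee * bq) * k = \<beta> * ((1 / \<beta> * bq * (bp + k)) * d * (ee * en))"
          for bp d ee bq en k :: real
        proof -
          have "\<beta> * (1 / \<beta> * bq * (bp + k) * d * (ee * en)) = (\<beta> * (1 / \<beta>)) * (bq * (bp + k) * d * (ee * en))"
            by (simp only: mult.assoc)
          also have "\<beta> * (1 / \<beta>) = 1" using \<beta> by simp
          finally show ?thesis by (simp add: algebra_simps)
        qed
        ultimately show ?thesis
          unfolding C_def \<open>e powr (1 / q) * ?T = e powr (1 / q + 1 / N)\<close>[symmetric] by (simp only:)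
      qed
      finally have "ennreal \<beta> * ?U
          \<le> ennreal \<beta> * ennreal (C * D powr (1 / p) * e powr (1 / q + 1 / N))"
        using \<beta> by (simp add: ennreal_mult')
      then have "?U \<le> ennreal (C * D powr (1 / p) * e powr (1 / q + 1 / N))"
        using \<beta> by (subst (asm) ennreal_mult_le_mult_iff) auto
      moreover have "1 / q = 1 - 1 / p" using q by simp
      ultimately show ?thesis by (simp add: N_def)
    qed
  qed
qed


lemma grad_compose:
  assumes "Ck 1 u" "(h has_real_derivative h' (u x)) (at (u x))"
  shows "grad (\<lambda>x. h (u x)) x = h' (u x) *\<^sub>R grad u x"
proof (rule grad_unique)
  have "(h has_derivative (\<lambda>t. h' (u x) * t)) (at (u x))"
    using assms(2) by (simp add: has_field_derivative_def)
  from has_derivative_compose[OF grad_has_derivative[OF assms(1), of x] this]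
  show "((\<lambda>x. h (u x)) has_derivative (\<lambda>v. (h' (u x) *\<^sub>R grad u x) \<bullet> v)) (at x)"
    by simp
qed

text \<open>The elementary building block of C^1 splines.\<close>

lemma DERIV_pos_part_square:
  fixes t :: real
  shows "((\<lambda>t. (max 0 (t - c))\<^sup>2) has_real_derivative 2 * max 0 (t - c)) (at t)"
proof (cases t c rule: linorder_cases)
  case less
  have "((\<lambda>t. 0) has_real_derivative 0) (at t)" by simp
  then have "((\<lambda>t. (max 0 (t - c))\<^sup>2) has_real_derivative 0) (at t)"
    by (rule has_field_derivative_transform_within_open[where S="{..<c}"]) (use less in auto)
  then show ?thesis using less by simp
next
  case greater
  have "((\<lambda>t. (t - c)\<^sup>2) has_real_derivative 2 * (t - c)) (at t)"
    by (auto intro!: derivative_eq_intros)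
  then have "((\<lambda>t. (max 0 (t - c))\<^sup>2) has_real_derivative 2 * (t - c)) (at t)"
    by (rule has_field_derivative_transform_within_open[where S="{c<..}"]) (use greater in auto)
  then show ?thesis using greater by simp
next
  case equal
  have "((\<lambda>t. (max 0 (t - c))\<^sup>2) has_real_derivative 0) (at c)"
    unfolding has_field_derivative_iff
  proof (rule Lim_null_comparison)
    show "\<forall>\<^sub>F t in at c. norm (((max 0 (t - c))\<^sup>2 - (max 0 (c - c))\<^sup>2) / (t - c)) \<le> \<bar>t - c\<bar>"
      by (intro always_eventually) (auto simp: max_def power2_eq_square)
    have "((\<lambda>t. \<bar>t - c\<bar>) \<longlongrightarrow> \<bar>c - c\<bar>) (at c)" by (intro tendsto_intros)
    then show "((\<lambda>t. \<bar>t - c\<bar>) \<longlongrightarrow> 0) (at c)" by simp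
  qed
  then show ?thesis using equal by simp
qed

text \<open>A C^1 transition from \<open>0\<close> on \<open>s \<le> 1\<close> to \<open>1\<close> on \<open>s \<ge> 2\<close>, as a quadratic spline with knots \<open>1\<close>, \<open>3/2\<close>, \<open>2\<close>.\<close>

definition ramp :: "real \<Rightarrow> real" where
  "ramp s = 2 * ((max 0 (s - 1))\<^sup>2 - 2 * (max 0 (s - 3 / 2))\<^sup>2 + (max 0 (s - 2))\<^sup>2)"

text \<open>The derivative of the ramp, a piecewise linear bump on the interval from \<open>1\<close> to \<open>2\<close>.\<close>

definition hat :: "real \<Rightarrow> real" where
  "hat s = 4 * (max 0 (s - 1) - 2 * max 0 (s - 3 / 2) + max 0 (s - 2))"

lemma ramp_has_derivative: "(ramp has_real_derivative hat s) (at s)"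
proof -
  have "((\<lambda>s. 2 * ((max 0 (s - 1))\<^sup>2 - 2 * (max 0 (s - 3 / 2))\<^sup>2 + (max 0 (s - 2))\<^sup>2)) has_real_derivative
     2 * (2 * max 0 (s - 1) - 2 * (2 * max 0 (s - 3 / 2)) + 2 * max 0 (s - 2))) (at s)"
    by (intro DERIV_cmult DERIV_add DERIV_diff DERIV_pos_part_square)
  then show ?thesis unfolding ramp_def[abs_def] hat_def by (simp add: algebra_simps)
qed

lemma hat_bounds: "0 \<le> hat s" "hat s \<le> 2" "\<not> (1 < s \<and> s \<le> 2) \<Longrightarrow> hat s = 0"
  unfolding hat_def by (auto simp: max_def)

lemma ramp_values: "s \<le> 1 \<Longrightarrow> ramp s = 0" "s \<ge> 2 \<Longrightarrow> ramp s = 1"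
  unfolding ramp_def by (simp_all add: max_def power2_eq_square algebra_simps)

text \<open>The weak inequality is applied to \<open>u\<close> truncated between the levels \<open>l\<close> and \<open>2l\<close> and rescaled to height \<open>1\<close>. The
  truncation equals \<open>1\<close> on the level set in question, while its gradient lives between the two levels only;
  this localisation is what makes the dyadic summation possible.\<close>

lemma sobolev_level_estimate:
  fixes p :: real
  assumes p: "1 < p" "p < real DIM('a::euclidean_space)"
  defines "q \<equiv> sobolev_exp (real DIM('a)) p"
  obtains C where "C > 0" "\<And>(u :: 'a \<Rightarrow> real) l D.
    \<lbrakk>C1_compact u; 0 < l; 0 \<le> D;
     (\<integral>\<^sup>+x. ennreal (norm (grad u x) powr p) * indicator {x. l < \<bar>u x\<bar> \<and> \<bar>u x\<bar> \<le> 2 * l} x \<partial>lborel) \<le> ennreal D\<rbrakk> \<Longrightarrow>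
    emeasure lborel {x. 2 * l \<le> \<bar>u x\<bar>} \<le> ennreal ((C / l) powr q * D powr (q / p))"
proof -
  obtain C where C: "C > 0" "\<And>(u :: 'a \<Rightarrow> real) E D e.
    \<lbrakk>C1_compact u; E \<in> sets lborel; emeasure lborel E \<le> ennreal e; 0 \<le> e;
     (\<integral>\<^sup>+x. ennreal (norm (grad u x) powr p) \<partial>lborel) \<le> ennreal D; 0 \<le> D\<rbrakk> \<Longrightarrow>
    (\<integral>\<^sup>+x. ennreal \<bar>u x\<bar> * indicator E x \<partial>lborel) \<le> ennreal (C * D powr (1 / p) * e powr (1 - 1 / p + 1 / real DIM('a)))"
    by (fact weak_sobolev[OF p])
  have q: "q > 0" "1 - 1 / p + 1 / real DIM('a) = 1 - 1 / q"
    using p unfolding q_def sobolev_exp_def by (auto simp: field_simps)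
  show ?thesis
  proof (rule that[of "2 * C"])
    show "2 * C > 0" using C(1) by simp
    fix u :: "'a \<Rightarrow> real" and l D :: real
    let ?I = "\<lambda>x. indicator {x. l < \<bar>u x\<bar> \<and> \<bar>u x\<bar> \<le> 2 * l} x"
    let ?N = "\<lambda>x. ennreal (norm (grad u x) powr p)"
    assume u: "C1_compact u" and l: "0 < l" and D: "0 \<le> D"
      "(\<integral>\<^sup>+x. ?N x * ?I x \<partial>lborel) \<le> ennreal D"
    have C1: "Ck 1 u" using u unfolding C1_compact_def by simp
    have um[measurable]: "u \<in> borel_measurable borel"
      by (rule borel_measurable_continuous_onI[OF Ck_continuous[OF C1]])
    have [measurable]: "grad u \<in> borel_measurable borel"
      by (rule borel_measurable_continuous_onI[OF continuous_on_grad[OF C1]])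
    \<comment> \<open>Even in \<open>s\<close>, so that both signs of \<open>u\<close> are covered; the two summands have disjoint supports.\<close>
    define h where "h s = ramp (s / l) + ramp (- s / l)" for s
    define h' where "h' s = (hat (s / l) - hat (- s / l)) / l" for s
    define v where "v x = h (u x)" for x
    have der: "(h has_real_derivative h' s) (at s)" for s
    proof -
      have 1: "((\<lambda>s. ramp (s / l)) has_real_derivative hat (s / l) * (1 / l)) (at s)"
        by (rule DERIV_chain2[OF ramp_has_derivative]) (use l in \<open>auto intro!: derivative_eq_intros\<close>)
      have 2: "((\<lambda>s. ramp (- s / l)) has_real_derivative hat (- s / l) * (- 1 / l)) (at s)"
        by (rule DERIV_chain2[OF ramp_has_derivative]) (use l in \<open>auto intro!: derivative_eq_intros\<close>)
      show ?thesis using DERIV_add[OF 1 2] unfolding h_def h'_def by (simp add: diff_divide_distrib)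
    qed
    have hat: "continuous_on UNIV hat" unfolding hat_def by (intro continuous_intros)
    have "continuous_on UNIV (\<lambda>s. hat (s / l))" "continuous_on UNIV (\<lambda>s. hat (- s / l))"
      by (rule continuous_on_compose2[OF hat]; use l in \<open>auto intro!: continuous_intros\<close>)+
    then have "continuous_on UNIV h'" unfolding h'_def
      by (intro continuous_on_divide continuous_on_diff continuous_on_const) (use l in auto)
    then have "Ck 1 h" unfolding One_nat_def using der by (intro Ck_SucI_real[of h h' 0]) (simp_all del: Ck.simps(2))
    then have Cv: "Ck 1 v" unfolding v_def[abs_def] by (rule Ck_compose[OF _ C1])
    have h0: "h 0 = 0" by (simp add: h_def ramp_values)
    have vc: "C1_compact v"
      using u Cv h0 unfolding C1_compact_def v_def by metis
    have gv: "grad v x = h' (u x) *\<^sub>R grad u x" for x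
      unfolding v_def by (rule grad_compose[where h=h and h'=h' and u=u, OF C1 der])
    have h'b: "\<bar>h' s\<bar> \<le> 2 / l * indicator {s. l < \<bar>s\<bar> \<and> \<bar>s\<bar> \<le> 2 * l} s" for s
    proof (cases "l < \<bar>s\<bar> \<and> \<bar>s\<bar> \<le> 2 * l")
      case True
      have "\<bar>hat (s / l) - hat (- s / l)\<bar> \<le> 2"
        using hat_bounds(1,2)[of "s / l"] hat_bounds(1,2)[of "- s / l"] by linarith
      then show ?thesis using True l unfolding h'_def by (simp add: abs_divide divide_right_mono)
    next
      case False
      then have "hat (s / l) = 0" "hat (- s / l) = 0"
        using l by (auto intro!: hat_bounds(3) simp: field_simps)
      then show ?thesis using l by (simp add: h'_def)
    qed
    have hE: "h s = 1" if "2 * l \<le> \<bar>s\<bar>" for s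
    proof (cases "s \<ge> 0")
      case True
      then have "s / l \<ge> 2" "- s / l \<le> 1" using that l by (auto simp: field_simps)
      then show ?thesis by (simp add: h_def ramp_values)
    next
      case False
      then have "- s / l \<ge> 2" "s / l \<le> 1" using that l by (auto simp: field_simps)
      then show ?thesis by (simp add: h_def ramp_values)
    qed
    define E where "E = {x. 2 * l \<le> \<bar>u x\<bar>}"
    have E[measurable]: "E \<in> sets borel" unfolding E_def by measurable
    obtain R where R: "\<And>x. norm x > R \<Longrightarrow> u x = 0" using C1_compactE[OF u] by metis
    have "x \<in> cball 0 R" if "x \<in> E" for x
    proof -
      have "u x \<noteq> 0" using that l unfolding E_def by auto
      then show ?thesis using R[of x] by (cases "norm x > R") auto
    qed
    then have "E \<subseteq> cball 0 R" by blast
    then have "emeasure lborel E < \<infinity>" by (intro emeasure_bounded_finite) (meson bounded_cball bounded_subset)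
    then have eE: "emeasure lborel E = ennreal (measure lborel E)" by (intro emeasure_eq_ennreal_measure) auto
    define e where "e = measure lborel E"
    have e0: "e \<ge> 0" by (simp add: e_def)
    have "(\<integral>\<^sup>+x. ennreal (norm (grad v x) powr p) \<partial>lborel)
        \<le> (\<integral>\<^sup>+x. ennreal ((2 / l) powr p) * (?N x * ?I x) \<partial>lborel)"
    proof (intro nn_integral_mono)
      fix x
      have "norm (grad v x) \<le> 2 / l * indicator {s. l < \<bar>s\<bar> \<and> \<bar>s\<bar> \<le> 2 * l} (u x) * norm (grad u x)"
        unfolding gv norm_scaleR by (intro mult_right_mono h'b) simp
      then have "norm (grad v x) powr p \<le> (2 / l * indicator {s. l < \<bar>s\<bar> \<and> \<bar>s\<bar> \<le> 2 * l} (u x) * norm (grad u x)) powr p"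
        using p by (intro powr_mono2) auto
      also have "\<dots> = (2 / l) powr p * (norm (grad u x) powr p * ?I x)"
        using l p by (auto simp: indicator_def powr_mult powr_divide)
      finally have "ennreal (norm (grad v x) powr p) \<le> ennreal ((2 / l) powr p * (norm (grad u x) powr p * ?I x))"
        by (rule ennreal_leI)
      also have "\<dots> = ennreal ((2 / l) powr p) * (?N x * ?I x)"
        by (subst ennreal_mult') (auto simp: indicator_def)
      finally show "ennreal (norm (grad v x) powr p) \<le> ennreal ((2 / l) powr p) * (?N x * ?I x)" .
    qed
    also have "\<dots> = ennreal ((2 / l) powr p) * (\<integral>\<^sup>+x. ?N x * ?I x \<partial>lborel)"
      by (rule nn_integral_cmult) measurable
    also have "\<dots> \<le> ennreal ((2 / l) powr p) * ennreal D" by (intro mult_left_mono D) simp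
    also have "\<dots> = ennreal ((2 / l) powr p * D)" by (simp add: ennreal_mult')
    finally have Dv: "(\<integral>\<^sup>+x. ennreal (norm (grad v x) powr p) \<partial>lborel) \<le> ennreal ((2 / l) powr p * D)" .
    have "ennreal e = (\<integral>\<^sup>+x. ennreal \<bar>v x\<bar> * indicator E x \<partial>lborel)"
    proof -
      have "(\<integral>\<^sup>+x. ennreal \<bar>v x\<bar> * indicator E x \<partial>lborel) = (\<integral>\<^sup>+x. indicator E x \<partial>lborel)"
        by (intro nn_integral_cong) (auto simp: indicator_def E_def v_def hE)
      then show ?thesis using eE by (simp add: e_def)
    qed
    also have "\<dots> \<le> ennreal (C * ((2 / l) powr p * D) powr (1 / p) * e powr (1 - 1 / p + 1 / real DIM('a)))"
      by (rule C(2)[OF vc _ _ e0 Dv]) (use eE D e_def in auto)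
    finally have "e \<le> C * ((2 / l) powr p * D) powr (1 / p) * e powr (1 - 1 / p + 1 / real DIM('a))"
      using C(1) by (subst (asm) ennreal_le_iff) auto
    also have "((2 / l) powr p * D) powr (1 / p) = 2 / l * D powr (1 / p)"
      using l p D by (simp add: powr_mult powr_powr)
    also have "1 - 1 / p + 1 / real DIM('a) = 1 - 1 / q" by (rule q(2))
    finally have le: "e \<le> (2 * C / l) * D powr (1 / p) * e powr (1 - 1 / q)" by (simp add: mult_ac)
    have "e \<le> (2 * C / l) powr q * D powr (q / p)"
    proof (cases "e = 0")
      case False
      then have e: "e > 0" using e0 by simp
      have "e powr (1 / q) * e powr (1 - 1 / q) \<le> ((2 * C / l) * D powr (1 / p)) * e powr (1 - 1 / q)"
        using le e by (simp add: powr_add[symmetric])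
      then have "e powr (1 / q) \<le> (2 * C / l) * D powr (1 / p)"
        using e by (subst (asm) mult_le_cancel_right) auto
      then have "(e powr (1 / q)) powr q \<le> ((2 * C / l) * D powr (1 / p)) powr q"
        using q(1) by (intro powr_mono2) auto
      also have "((2 * C / l) * D powr (1 / p)) powr q = (2 * C / l) powr q * D powr (q / p)"
        by (subst powr_mult) (auto simp: powr_powr)
      finally show ?thesis using q(1) e by (simp add: powr_powr)
    qed (simp add: e0)
    then show "emeasure lborel {x. 2 * l \<le> \<bar>u x\<bar>} \<le> ennreal ((2 * C / l) powr q * D powr (q / p))"
      using eE unfolding E_def e_def by (simp add: ennreal_leI)
  qed
qed

text \<open>Maz'ya's truncation argument. On the dyadic annulus \<open>B n\<close> the integral of \<open>|u|^q\<close> is bounded through the level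
  estimate by the \<open>q/p\<close>-th power of the energy \<open>a (n + 1)\<close> in the next lower annulus. Since \<open>q/p \<ge> 1\<close>, one factor
  \<open>a (n + 1)\<close> is kept for the summation and the rest is bounded by the total energy.\<close>

theorem sobolev_inequality_C1:
  fixes p :: real
  assumes p: "1 < p" "p < real DIM('a::euclidean_space)"
  defines "q \<equiv> sobolev_exp (real DIM('a)) p"
  obtains S where "S > 0" "\<And>(u :: 'a \<Rightarrow> real) D.
    \<lbrakk>C1_compact u; 0 \<le> D; (\<integral>\<^sup>+x. ennreal (norm (grad u x) powr p) \<partial>lborel) \<le> ennreal D\<rbrakk> \<Longrightarrow>
    (\<integral>\<^sup>+x. ennreal (\<bar>u x\<bar> powr q) \<partial>lborel) \<le> ennreal (S * D powr (q / p))"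
proof -
  obtain C where C: "C > 0" "\<And>(u :: 'a \<Rightarrow> real) l D.
    \<lbrakk>C1_compact u; 0 < l; 0 \<le> D;
     (\<integral>\<^sup>+x. ennreal (norm (grad u x) powr p) * indicator {x. l < \<bar>u x\<bar> \<and> \<bar>u x\<bar> \<le> 2 * l} x \<partial>lborel) \<le> ennreal D\<rbrakk> \<Longrightarrow>
    emeasure lborel {x. 2 * l \<le> \<bar>u x\<bar>} \<le> ennreal ((C / l) powr q * D powr (q / p))"
    unfolding q_def by (fact sobolev_level_estimate[OF p])
  have q: "q > 0" "q / p \<ge> 1"
    using p unfolding q_def sobolev_exp_def by (auto simp: field_simps)
  show ?thesis
  proof (rule that[of "(4 * C) powr q"])
    show "(4 * C) powr q > 0" using C(1) by simp
    fix u :: "'a \<Rightarrow> real" and D :: real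
    let ?N = "\<lambda>x. ennreal (norm (grad u x) powr p)"
    let ?W = "\<lambda>x. ennreal (\<bar>u x\<bar> powr q)"
    let ?c = "(4 * C) powr q * D powr (q / p - 1)"
    assume u: "C1_compact u" and D: "0 \<le> D" "(\<integral>\<^sup>+x. ?N x \<partial>lborel) \<le> ennreal D"
    have C1: "Ck 1 u" using u unfolding C1_compact_def by simp
    have [measurable]: "u \<in> borel_measurable borel"
      by (rule borel_measurable_continuous_onI[OF Ck_continuous[OF C1]])
    have [measurable]: "grad u \<in> borel_measurable borel"
      by (rule borel_measurable_continuous_onI[OF continuous_on_grad[OF C1]])
    obtain M where M: "M > 0" "\<And>x. \<bar>u x\<bar> \<le> M"
    proof -
      obtain K where K: "compact K" "\<And>x. x \<notin> K \<Longrightarrow> u x = 0" using u unfolding C1_compact_def by auto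
      have "bounded (u ` K)" using compact_continuous_image[OF Ck_continuous[OF C1] K(1)] compact_imp_bounded by blast
      then obtain M where "M > 0" "\<And>x. x \<in> K \<Longrightarrow> \<bar>u x\<bar> \<le> M" unfolding bounded_pos by auto
      then have "\<bar>u x\<bar> \<le> M" for x using K(2)[of x] by (cases "x \<in> K") auto
      then show ?thesis using that \<open>M > 0\<close> by blast
    qed
    \<comment> \<open>Levels descend from an upper bound of \<open>|u|\<close>, so that natural numbers index all dyadic levels.\<close>
    define m where "m n = M / 2 ^ n" for n :: nat
    have m: "m n > 0" "m n = 2 * m (Suc n)" for n using M by (auto simp: m_def)
    define B where "B n = {x. m (Suc n) < \<bar>u x\<bar> \<and> \<bar>u x\<bar> \<le> m n}" for n
    have B[measurable]: "B n \<in> sets borel" for n unfolding B_def by measurable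
    have mono: "m k \<le> m n" if "n \<le> k" for n k
      unfolding m_def using M that by (intro divide_left_mono power_increasing) auto
    have disj: "disjoint_family B"
      unfolding disjoint_family_on_def
    proof (intro ballI impI, rule ccontr)
      fix i j :: nat assume ij: "i \<noteq> j" "B i \<inter> B j \<noteq> {}"
      then obtain x where x: "m (Suc i) < \<bar>u x\<bar>" "\<bar>u x\<bar> \<le> m i" "m (Suc j) < \<bar>u x\<bar>" "\<bar>u x\<bar> \<le> m j"
        unfolding B_def by auto
      from ij(1) consider "Suc i \<le> j" | "Suc j \<le> i" by linarith
      then show False using x mono[of "Suc i" j] mono[of "Suc j" i] by cases auto
    qed
    have cover: "\<exists>n. x \<in> B n" if ux: "u x \<noteq> 0" for x
    proof -
      have "(\<lambda>n. M * (1/2) ^ n) \<longlonglongrightarrow> M * 0" by (intro tendsto_intros) auto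
      then have "m \<longlonglongrightarrow> 0" by (simp add: m_def[abs_def] power_divide)
      then have "\<exists>n. m n < \<bar>u x\<bar>"
        using order_tendstoD(2)[of m 0 sequentially "\<bar>u x\<bar>"] ux by (auto simp: eventually_sequentially)
      define k where "k = (LEAST n. m n < \<bar>u x\<bar>)"
      have k: "m k < \<bar>u x\<bar>" unfolding k_def by (rule LeastI_ex) fact
      have "k \<noteq> 0" using k M(2)[of x] by (intro notI) (simp add: m_def)
      then obtain n where n: "k = Suc n" using not0_implies_Suc by blast
      then have "\<not> m n < \<bar>u x\<bar>" using not_less_Least[of n "\<lambda>n. m n < \<bar>u x\<bar>"] unfolding k_def by simp
      then show ?thesis using k n unfolding B_def by auto
    qed
    define a where "a n = (\<integral>\<^sup>+x. ?N x * indicator (B n) x \<partial>lborel)" for n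
    have a_le: "a n \<le> ennreal D" for n
      unfolding a_def by (rule order_trans[OF nn_integral_mono D(2)]) (auto simp: indicator_def)
    have step: "(\<integral>\<^sup>+x. ?W x * indicator (B n) x \<partial>lborel)
        \<le> ennreal ?c * a (Suc n)" for n
    proof -
      define l where "l = m (Suc (Suc n))"
      have l: "l > 0" "m (Suc n) = 2 * l" "m n = 4 * l" using m[of n] m[of "Suc n"] m(1)[of "Suc (Suc n)"] by (auto simp: l_def)
      obtain d where d: "a (Suc n) = ennreal d" "0 \<le> d"
        using a_le[of "Suc n"] by (cases "a (Suc n)") (auto simp: top_unique)
      have dD: "d \<le> D" using a_le[of "Suc n"] d D(1) by simp
      have "B (Suc n) = {x. l < \<bar>u x\<bar> \<and> \<bar>u x\<bar> \<le> 2 * l}" unfolding B_def l(2) l_def by simp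
      then have ad: "(\<integral>\<^sup>+x. ?N x * indicator {x. l < \<bar>u x\<bar> \<and> \<bar>u x\<bar> \<le> 2 * l} x \<partial>lborel) \<le> ennreal d"
        using d(1) unfolding a_def by simp
      have "(\<integral>\<^sup>+x. ?W x * indicator (B n) x \<partial>lborel)
        \<le> (\<integral>\<^sup>+x. ennreal ((4 * l) powr q) * indicator {x. 2 * l \<le> \<bar>u x\<bar>} x \<partial>lborel)"
        using q l by (intro nn_integral_mono) (auto simp: indicator_def B_def intro!: ennreal_leI powr_mono2)
      also have "\<dots> = ennreal ((4 * l) powr q) * emeasure lborel {x. 2 * l \<le> \<bar>u x\<bar>}"
        by (rule nn_integral_cmult_indicator) simp
      also have "\<dots> \<le> ennreal ((4 * l) powr q) * ennreal ((C / l) powr q * d powr (q / p))"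
        by (intro mult_left_mono C(2)[OF u l(1) d(2) ad]) simp
      also have "\<dots> = ennreal ((4 * C) powr q * d powr (q / p))"
      proof -
        have "(4 * l) powr q * (C / l) powr q = (4 * C) powr q"
          using l C(1) by (simp add: powr_mult[symmetric])
        then show ?thesis by (simp add: ennreal_mult'[symmetric] mult.assoc[symmetric])
      qed
      also have "\<dots> \<le> ennreal (?c * d)"
      proof -
        have "d powr (q / p) = d powr (q / p - 1) * d"
          using d(2) by (cases "d = 0") (auto simp: powr_diff)
        also have "\<dots> \<le> D powr (q / p - 1) * d" using d(2) dD q(2) by (intro mult_right_mono powr_mono2) auto
        finally show ?thesis unfolding mult.assoc by (intro ennreal_leI mult_left_mono) auto
      qed
      finally show ?thesis using d by (simp add: ennreal_mult')
    qed
    have "(\<integral>\<^sup>+x. ?W x \<partial>lborel) = (\<integral>\<^sup>+x. ?W x * indicator (\<Union>n. B n) x \<partial>lborel)"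
      using cover q by (intro nn_integral_cong) (fastforce simp: indicator_def)
    also have "\<dots> = (\<Sum>n. \<integral>\<^sup>+x. ?W x * indicator (B n) x \<partial>lborel)"
      by (rule nn_integral_disjoint_family) (use disj in auto)
    also have "\<dots> \<le> (\<Sum>n. ennreal ?c * a (Suc n))"
      by (intro suminf_le step) auto
    also have "\<dots> = ennreal ?c * (\<Sum>n. a (Suc n))" by simp
    also have "(\<Sum>n. a (Suc n)) = (\<integral>\<^sup>+x. ?N x * indicator (\<Union>n. B (Suc n)) x \<partial>lborel)"
    proof -
      have "disjoint_family (\<lambda>n. B (Suc n))" using disj unfolding disjoint_family_on_def by simp
      then show ?thesis unfolding a_def by (intro nn_integral_disjoint_family[symmetric]) auto
    qed
    also have "ennreal ?c * \<dots> \<le> ennreal ?c * ennreal D"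
    proof (intro mult_left_mono)
      show "(\<integral>\<^sup>+x. ?N x * indicator (\<Union>n. B (Suc n)) x \<partial>lborel) \<le> ennreal D"
        by (rule order_trans[OF nn_integral_mono D(2)]) (auto simp: indicator_def)
    qed simp
    also have "\<dots> = ennreal ((4 * C) powr q * D powr (q / p))"
      using D(1) by (cases "D = 0") (auto simp: ennreal_mult'[symmetric] powr_diff)
    finally show "(\<integral>\<^sup>+x. ?W x \<partial>lborel) \<le> ennreal ((4 * C) powr q * D powr (q / p))" .
  qed
qed

section \<open>Functions approximated by test functions\<close>

text \<open>The \<open>p\<close>-th power of the norm, with value infinity for measurable functions off the Lebesgue space; inequalities between energies therefore
  need no integrability hypotheses.\<close>

definition lp_energy :: "'a measure \<Rightarrow> real \<Rightarrow> ('a \<Rightarrow> 'b::euclidean_space) \<Rightarrow> ennreal" where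
  "lp_energy M p f = (\<integral>\<^sup>+x. ennreal (norm (f x) powr p) \<partial>M)"

lemma lp_space_iff:
  "f \<in> lp_space M p \<longleftrightarrow> f \<in> borel_measurable M \<and> lp_energy M p f < \<infinity>"
  unfolding lp_space_def lp_energy_def by (auto simp: integrable_iff_bounded)

lemma lp_energy_eq_LINT:
  assumes "f \<in> lp_space M p"
  shows "lp_energy M p f = ennreal (LINT x|M. norm (f x) powr p)"
  using assms unfolding lp_energy_def lp_space_def by (intro nn_integral_eq_integral) auto

lemma lp_norm_nonneg: "0 \<le> lp_norm M p f"
  by (simp add: lp_norm_def)

lemma lp_energy_eq_norm:
  assumes "f \<in> lp_space M p" "p > 0"
  shows "lp_energy M p f = ennreal (lp_norm M p f powr p)"
  using assms by (simp add: lp_energy_eq_LINT lp_norm_def powr_powr Bochner_Integration.integral_nonneg)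

lemma lp_norm_tendsto_0_iff:
  assumes "\<And>k. f k \<in> lp_space M p" "p > 0"
  shows "(\<lambda>k. lp_norm M p (f k)) \<longlonglongrightarrow> 0 \<longleftrightarrow> (\<lambda>k::nat. lp_energy M p (f k)) \<longlonglongrightarrow> 0"
proof -
  have "(\<lambda>k. lp_energy M p (f k)) \<longlonglongrightarrow> 0 \<longleftrightarrow> (\<lambda>k. lp_norm M p (f k) powr p) \<longlonglongrightarrow> 0"
    using assms by (subst ennreal_tendsto_0_iff[symmetric]) (auto simp: lp_energy_eq_norm)
  also have "\<dots> \<longleftrightarrow> (\<lambda>k. lp_norm M p (f k)) \<longlonglongrightarrow> 0"
  proof
    assume "(\<lambda>k. lp_norm M p (f k) powr p) \<longlonglongrightarrow> 0"
    then have "(\<lambda>k. (lp_norm M p (f k) powr p) powr (1 / p)) \<longlonglongrightarrow> 0 powr (1 / p)"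
      using assms(2) by (intro tendsto_powr2 tendsto_const) auto
    then show "(\<lambda>k. lp_norm M p (f k)) \<longlonglongrightarrow> 0"
      using assms(2) by (simp add: powr_powr lp_norm_nonneg)
  next
    assume "(\<lambda>k. lp_norm M p (f k)) \<longlonglongrightarrow> 0"
    then have "(\<lambda>k. lp_norm M p (f k) powr p) \<longlonglongrightarrow> 0 powr p"
      using assms(2) by (intro tendsto_powr2 tendsto_const) (auto simp: lp_norm_nonneg)
    then show "(\<lambda>k. lp_norm M p (f k) powr p) \<longlonglongrightarrow> 0" by simp
  qed
  finally show ?thesis by simp
qed

lemma norm_add_powr_le:
  fixes a b :: "'b::real_normed_vector"
  assumes "p > 0"
  shows "norm (a + b) powr p \<le> 2 powr p * (norm a powr p + norm b powr p)"
proof -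
  have "norm (a + b) \<le> 2 * max (norm a) (norm b)" using norm_triangle_ineq[of a b] by linarith
  then have "norm (a + b) powr p \<le> (2 * max (norm a) (norm b)) powr p"
    using assms by (intro powr_mono2) auto
  also have "\<dots> = 2 powr p * max (norm a) (norm b) powr p" by (simp add: powr_mult)
  also have "\<dots> \<le> 2 powr p * (norm a powr p + norm b powr p)"
    by (intro mult_left_mono) (auto simp: max_def)
  finally show ?thesis .
qed

lemma lp_energy_add_le:
  assumes [measurable]: "f \<in> borel_measurable M" "g \<in> borel_measurable M" and "p > 0"
  shows "lp_energy M p (\<lambda>x. f x + g x) \<le> ennreal (2 powr p) * (lp_energy M p f + lp_energy M p g)"
proof -
  have "lp_energy M p (\<lambda>x. f x + g x)
      \<le> (\<integral>\<^sup>+x. ennreal (2 powr p) * (ennreal (norm (f x) powr p) + ennreal (norm (g x) powr p)) \<partial>M)"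
    unfolding lp_energy_def
  proof (intro nn_integral_mono)
    fix x
    show "ennreal (norm (f x + g x) powr p) \<le> ennreal (2 powr p) * (ennreal (norm (f x) powr p) + ennreal (norm (g x) powr p))"
      using ennreal_leI[OF norm_add_powr_le[OF assms(3), of "f x" "g x"]]
      by (simp add: ennreal_mult' ennreal_plus)
  qed
  also have "\<dots> = ennreal (2 powr p) * (lp_energy M p f + lp_energy M p g)"
    unfolding lp_energy_def by (subst nn_integral_cmult) (auto simp: nn_integral_add)
  finally show ?thesis .
qed

lemma lp_energy_uminus: "lp_energy M p (\<lambda>x. - f x) = lp_energy M p f"
  by (simp add: lp_energy_def)

lemma lp_energy_mono: "(\<And>x. norm (f x) \<le> norm (g x)) \<Longrightarrow> p > 0 \<Longrightarrow> lp_energy M p f \<le> lp_energy M p g"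
  unfolding lp_energy_def by (intro nn_integral_mono ennreal_leI powr_mono2) auto

lemma lp_space_add:
  assumes "f \<in> lp_space M p" "g \<in> lp_space M p" "p > 0"
  shows "(\<lambda>x. f x + g x) \<in> lp_space M p"
proof -
  have "ennreal (2 powr p) * (lp_energy M p f + lp_energy M p g) < \<infinity>"
    using assms by (auto simp: lp_space_iff ennreal_mult_less_top)
  then have "lp_energy M p (\<lambda>x. f x + g x) < \<infinity>"
    using lp_energy_add_le[of f M g p] assms unfolding lp_space_iff by (meson le_less_trans)
  then show ?thesis using assms by (auto simp: lp_space_iff)
qed

lemma lp_space_diff:
  assumes "f \<in> lp_space M p" "g \<in> lp_space M p" "p > 0"
  shows "(\<lambda>x. f x - g x) \<in> lp_space M p"
  using lp_space_add[of f M p "\<lambda>x. - g x"] assms by (auto simp: lp_space_iff lp_energy_uminus)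

lemma lp_space_bounded_mult:
  fixes f :: "'a \<Rightarrow> 'b::euclidean_space"
  assumes "f \<in> lp_space M p" "c \<in> borel_measurable M" "\<And>x. \<bar>c x\<bar> \<le> 1" "p > 0"
  shows "(\<lambda>x. c x *\<^sub>R f x) \<in> lp_space M p"
proof -
  have "lp_energy M p (\<lambda>x. c x *\<^sub>R f x) \<le> lp_energy M p f"
    using assms by (intro lp_energy_mono) (auto simp: mult_left_le_one_le)
  then show ?thesis using assms unfolding lp_space_iff by (auto intro: le_less_trans)
qed

lemma lp_energy_AE_cong:
  "AE x in M. f x = g x \<Longrightarrow> lp_energy M p f = lp_energy M p g"
  unfolding lp_energy_def by (intro nn_integral_cong_AE) auto

lemma emeasure_lebesgue_on_finite:
  fixes \<Omega> :: "'a::euclidean_space set"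
  assumes "open \<Omega>" "bounded \<Omega>"
  shows "emeasure (lebesgue_on \<Omega>) \<Omega> < \<infinity>"
  using assms emeasure_bounded_finite[of \<Omega>] by (simp add: emeasure_restrict_space)

lemma finite_measure_lebesgue_on:
  fixes \<Omega> :: "'a::euclidean_space set"
  assumes "open \<Omega>" "bounded \<Omega>"
  shows "finite_measure (lebesgue_on \<Omega>)"
  using emeasure_lebesgue_on_finite[OF assms] by (intro finite_measureI) auto

lemma measurable_lebesgue_on_continuous:
  fixes f :: "'a::euclidean_space \<Rightarrow> 'b::euclidean_space"
  assumes "continuous_on UNIV f"
  shows "f \<in> borel_measurable (lebesgue_on \<Omega>)"
  by (intro measurable_restrict_space1 measurable_completion) (simp add: borel_measurable_continuous_onI[OF assms])

lemma borel_measurable_AE_lebesgue_on: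
  fixes f :: "'a::euclidean_space \<Rightarrow> 'b::euclidean_space"
  assumes "open \<Omega>" "f \<in> borel_measurable (lebesgue_on \<Omega>)" "AE x in lebesgue_on \<Omega>. f x = g x"
  shows "g \<in> borel_measurable (lebesgue_on \<Omega>)"
proof -
  have S: "\<Omega> \<inter> space lebesgue \<in> sets lebesgue" using assms(1) by auto
  have "(\<lambda>x. indicator \<Omega> x *\<^sub>R f x) \<in> borel_measurable lebesgue"
    using assms(2) borel_measurable_restrict_space_iff[OF S, of f] by simp
  moreover have "AE x in lebesgue. indicator \<Omega> x *\<^sub>R f x = indicator \<Omega> x *\<^sub>R g x"
    using assms(3) unfolding AE_restrict_space_iff[OF S] by eventually_elim (auto simp: indicator_def)
  ultimately have "(\<lambda>x. indicator \<Omega> x *\<^sub>R g x) \<in> borel_measurable lebesgue"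
    by (rule borel_measurable_AE)
  then show ?thesis using borel_measurable_restrict_space_iff[OF S, of g] by simp
qed

lemma lp_space_AE_cong:
  fixes f :: "'a::euclidean_space \<Rightarrow> 'b::euclidean_space"
  assumes "open \<Omega>" "f \<in> lp_space (lebesgue_on \<Omega>) p" "AE x in lebesgue_on \<Omega>. f x = g x"
  shows "g \<in> lp_space (lebesgue_on \<Omega>) p"
  using assms borel_measurable_AE_lebesgue_on[OF assms(1) _ assms(3)] lp_energy_AE_cong[OF assms(3), of p]
  unfolding lp_space_iff by auto

lemma bounded_in_lp_space:
  fixes f :: "'a::euclidean_space \<Rightarrow> 'b::euclidean_space"
  assumes "open \<Omega>" "bounded \<Omega>" "f \<in> borel_measurable (lebesgue_on \<Omega>)" "\<And>x. norm (f x) \<le> B" "p > 0"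
  shows "f \<in> lp_space (lebesgue_on \<Omega>) p"
proof -
  have "lp_energy (lebesgue_on \<Omega>) p f \<le> (\<integral>\<^sup>+x. ennreal (B powr p) \<partial>lebesgue_on \<Omega>)"
    unfolding lp_energy_def using assms by (intro nn_integral_mono ennreal_leI powr_mono2) auto
  also have "\<dots> < \<infinity>" using emeasure_lebesgue_on_finite[OF assms(1,2)] by (simp add: ennreal_mult_less_top)
  finally show ?thesis using assms(3) by (simp add: lp_space_iff)
qed

lemma test_function_lp_space:
  fixes \<Omega> :: "'a::euclidean_space set"
  assumes "open \<Omega>" "bounded \<Omega>" "\<psi> \<in> test_functions \<Omega>" "p > 0"
  shows "\<psi> \<in> lp_space (lebesgue_on \<Omega>) p" "grad \<psi> \<in> lp_space (lebesgue_on \<Omega>) p"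
proof -
  obtain B where B: "\<And>x. \<bar>\<psi> x\<bar> \<le> B" "\<And>x. norm (grad \<psi> x) \<le> B"
    by (rule bounded_test_function[OF assms(3)]) blast
  have C: "Ck 1 \<psi>" by (rule test_functionsD(1)[OF assms(3)])
  show "\<psi> \<in> lp_space (lebesgue_on \<Omega>) p"
    using B by (intro bounded_in_lp_space[where B=B] assms measurable_lebesgue_on_continuous Ck_continuous[OF C]) auto
  show "grad \<psi> \<in> lp_space (lebesgue_on \<Omega>) p"
    using B by (intro bounded_in_lp_space[where B=B] assms measurable_lebesgue_on_continuous continuous_on_grad[OF C]) auto
qed

text \<open>On a finite measure space convergence in \<open>L^p\<close> implies convergence in \<open>L^1\<close>.\<close>

lemma nn_integral_le_lp_norm:
  fixes f :: "'a \<Rightarrow> 'b::euclidean_space"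
  assumes "finite_measure M" "f \<in> lp_space M p" "p > 1"
  shows "(\<integral>\<^sup>+x. ennreal (norm (f x)) \<partial>M) \<le> ennreal (lp_norm M p f * measure M (space M) powr (1 - 1 / p))"
proof -
  interpret finite_measure M by fact
  define q where "q = p / (p - 1)"
  have q: "1 < q" "1 / p + 1 / q = 1" using assms(3) by (auto simp: q_def field_simps)
  have "(\<integral>\<^sup>+x. ennreal (norm (f x) * 1) \<partial>M) \<le> ennreal ((lp_norm M p f powr p) powr (1 / p) * measure M (space M) powr (1 / q))"
  proof (rule nn_integral_Hoelder)
    show "(\<lambda>x. norm (f x)) \<in> borel_measurable M" using assms(2) unfolding lp_space_iff by auto
    show "(\<integral>\<^sup>+x. ennreal (norm (f x) powr p) \<partial>M) \<le> ennreal (lp_norm M p f powr p)"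
      using lp_energy_eq_norm[OF assms(2)] assms(3) unfolding lp_energy_def by simp
    show "(\<integral>\<^sup>+x. ennreal (1 powr q) \<partial>M) \<le> ennreal (measure M (space M))"
      by (simp add: emeasure_eq_measure)
  qed (use assms(3) q in auto)
  also have "(lp_norm M p f powr p) powr (1 / p) = lp_norm M p f"
    using assms(3) by (simp add: powr_powr lp_norm_nonneg)
  also have "1 / q = 1 - 1 / p" using q by simp
  finally show ?thesis by simp
qed

lemma lp_space_integrable:
  fixes f :: "'a \<Rightarrow> 'b::euclidean_space"
  assumes "finite_measure M" "f \<in> lp_space M p" "p > 1"
  shows "integrable M f"
proof -
  have "(\<integral>\<^sup>+x. ennreal (norm (f x)) \<partial>M) < \<infinity>"
    by (rule le_less_trans[OF nn_integral_le_lp_norm[OF assms]]) simp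
  then show ?thesis using assms(2) by (auto simp: integrable_iff_bounded lp_space_iff)
qed

lemma integrable_locally_integrable:
  fixes f :: "'a::euclidean_space \<Rightarrow> 'b::euclidean_space"
  assumes "open \<Omega>" "integrable (lebesgue_on \<Omega>) f"
  shows "locally_integrable \<Omega> f"
  unfolding locally_integrable_def
proof (intro allI impI)
  fix K assume K: "compact K" "K \<subseteq> \<Omega>"
  have "set_integrable lebesgue \<Omega> f"
    using assms by (simp add: set_integrable_def integrable_restrict_space)
  then show "f absolutely_integrable_on K"
    by (rule set_integrable_subset) (use K(2) lborelD[OF borel_closed[OF compact_imp_closed[OF K(1)]]] in auto)
qed

lemma lp_space_locally_integrable:
  fixes f :: "'a::euclidean_space \<Rightarrow> 'b::euclidean_space"
  assumes "open \<Omega>" "bounded \<Omega>" "f \<in> lp_space (lebesgue_on \<Omega>) p" "p > 1"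
  shows "locally_integrable \<Omega> f"
  by (rule integrable_locally_integrable[OF assms(1) lp_space_integrable[OF finite_measure_lebesgue_on[OF assms(1,2)] assms(3,4)]])

text \<open>Membership in \<open>W_0^{1,p}\<close> with an explicit gradient \<open>g\<close> and an explicit approximating sequence, which moreover
  converges almost everywhere. Chain rule and Sobolev inequality pass to the limit along this sequence.\<close>

definition smooth_approx :: "'a::euclidean_space set \<Rightarrow> real \<Rightarrow> ('a \<Rightarrow> real) \<Rightarrow> ('a \<Rightarrow> 'a) \<Rightarrow> (nat \<Rightarrow> 'a \<Rightarrow> real) \<Rightarrow> bool" where
  "smooth_approx \<Omega> p u g \<psi> \<longleftrightarrow> u \<in> lp_space (lebesgue_on \<Omega>) p \<and> g \<in> lp_space (lebesgue_on \<Omega>) p \<and>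
     (\<forall>k. \<psi> k \<in> test_functions \<Omega>) \<and>
     (\<lambda>k. lp_energy (lebesgue_on \<Omega>) p (\<lambda>x. u x - \<psi> k x)) \<longlonglongrightarrow> 0 \<and>
     (\<lambda>k. lp_energy (lebesgue_on \<Omega>) p (\<lambda>x. g x - grad (\<psi> k) x)) \<longlonglongrightarrow> 0 \<and>
     (AE x in lebesgue_on \<Omega>. (\<lambda>k. \<psi> k x) \<longlonglongrightarrow> u x)"

lemma has_weak_gradient_diff:
  fixes u v :: "'a::euclidean_space \<Rightarrow> real"
  assumes "open \<Omega>" "has_weak_gradient \<Omega> u g" "has_weak_gradient \<Omega> v h"
  shows "has_weak_gradient \<Omega> (\<lambda>x. u x - v x) (\<lambda>x. g x - h x)"
proof -
  have l: "locally_integrable \<Omega> u" "locally_integrable \<Omega> v" "locally_integrable \<Omega> g" "locally_integrable \<Omega> h"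
    using assms(2,3) unfolding has_weak_gradient_def by auto
  show ?thesis
    unfolding has_weak_gradient_def
  proof (intro conjI ballI locally_integrable_diff l)
    fix \<phi> and i :: 'a assume t: "\<phi> \<in> test_functions \<Omega>" and i: "i \<in> Basis"
    note i1 = integrable_test_pairing(1)[OF assms(1) t] and i2 = integrable_test_pairing(2)[OF assms(1) t]
    have e: "(LINT x|lebesgue_on \<Omega>. u x * (grad \<phi> x \<bullet> i)) = - (LINT x|lebesgue_on \<Omega>. (g x \<bullet> i) * \<phi> x)"
      "(LINT x|lebesgue_on \<Omega>. v x * (grad \<phi> x \<bullet> i)) = - (LINT x|lebesgue_on \<Omega>. (h x \<bullet> i) * \<phi> x)"
      using assms(2)[unfolded has_weak_gradient_def, THEN conjunct2, THEN conjunct2, rule_format, OF t i]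
        assms(3)[unfolded has_weak_gradient_def, THEN conjunct2, THEN conjunct2, rule_format, OF t i]
      by (simp_all add: grad_inner_Basis[OF i])
    show "(LINT x|lebesgue_on \<Omega>. (u x - v x) * frechet_derivative \<phi> (at x) i) =
        - (LINT x|lebesgue_on \<Omega>. ((g x - h x) \<bullet> i) * \<phi> x)"
      unfolding grad_inner_Basis[OF i, symmetric]
      using e i1[OF l(1)] i1[OF l(2)] i2[OF l(3)] i2[OF l(4)]
      by (simp add: left_diff_distrib inner_diff_left)
  qed
qed

lemma lp_energy_0_AE_subseq:
  fixes f :: "nat \<Rightarrow> 'a \<Rightarrow> 'b::euclidean_space"
  assumes "\<And>k. f k \<in> lp_space M p" "p > 0" "(\<lambda>k. lp_energy M p (f k)) \<longlonglongrightarrow> 0"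
  obtains r :: "nat \<Rightarrow> nat" where "strict_mono r" "AE x in M. (\<lambda>k. f (r k) x) \<longlonglongrightarrow> 0"
proof -
  have int: "integrable M (\<lambda>x. norm (f k x) powr p)" for k using assms(1)[of k] by (simp add: lp_space_def)
  have "(\<lambda>k. ennreal (LINT x|M. norm (norm (f k x) powr p))) \<longlonglongrightarrow> 0"
    using assms(3) lp_energy_eq_LINT[OF assms(1)] by simp
  then have "(\<lambda>k. LINT x|M. norm (norm (f k x) powr p)) \<longlonglongrightarrow> 0"
    by (subst (asm) ennreal_tendsto_0_iff) auto
  then obtain r :: "nat \<Rightarrow> nat" where r: "strict_mono r" "AE x in M. (\<lambda>k. norm (f (r k) x) powr p) \<longlonglongrightarrow> 0"
    using tendsto_L1_AE_subseq[of M "\<lambda>k x. norm (f k x) powr p", OF int] by blast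
  have "AE x in M. (\<lambda>k. f (r k) x) \<longlonglongrightarrow> 0"
    using r(2)
  proof eventually_elim
    fix x assume "(\<lambda>k. norm (f (r k) x) powr p) \<longlonglongrightarrow> 0"
    then have "(\<lambda>k. (norm (f (r k) x) powr p) powr (1 / p)) \<longlonglongrightarrow> 0 powr (1 / p)"
      using assms(2) by (intro tendsto_powr2 tendsto_const) auto
    then have "(\<lambda>k. norm (f (r k) x)) \<longlonglongrightarrow> 0" using assms(2) by (simp add: powr_powr)
    then show "(\<lambda>k. f (r k) x) \<longlonglongrightarrow> 0" by (rule tendsto_norm_zero_cancel)
  qed
  then show ?thesis by (rule that[OF r(1)])
qed

text \<open>Uniqueness of weak gradients identifies the gradient of \<open>u - \<psi> k\<close> in the Sobolev norm with \<open>\<nabla>u - \<nabla>(\<psi> k)\<close>; a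
  subsequence converges almost everywhere.\<close>

lemma sobolev_space0_smooth_approx:
  fixes u :: "'a::euclidean_space \<Rightarrow> real"
  assumes O: "open \<Omega>" "bounded \<Omega>" and p: "p > 1" and u: "u \<in> sobolev_space0 \<Omega> p"
  obtains \<psi> where "smooth_approx \<Omega> p u (weak_gradient \<Omega> u) \<psi>"
proof -
  let ?M = "lebesgue_on \<Omega>" let ?w = "weak_gradient \<Omega> u"
  obtain g where uL: "u \<in> lp_space ?M p" and g: "g \<in> lp_space ?M p" "has_weak_gradient \<Omega> u g"
    using u unfolding sobolev_space0_def sobolev_space_def by auto
  note wg = weak_gradient_eq_AE[OF O(1) g(2)]
  have wL: "?w \<in> lp_space ?M p"
    by (rule lp_space_AE_cong[OF O(1) g(1)]) (use wg(1) in \<open>eventually_elim, simp\<close>)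
  obtain \<psi> where \<psi>: "\<And>k. \<psi> k \<in> test_functions \<Omega>" "(\<lambda>k. sobolev_norm \<Omega> p (\<lambda>x. u x - \<psi> k x)) \<longlonglongrightarrow> 0"
    using u unfolding sobolev_space0_def by auto
  have p0: "p > 0" using p by simp
  have d: "AE x in ?M. weak_gradient \<Omega> (\<lambda>x. u x - \<psi> k x) x = ?w x - grad (\<psi> k) x" for k
    by (rule weak_gradient_eq_AE(1)[OF O(1) has_weak_gradient_diff[OF O(1) wg(2) has_weak_gradient_C1[OF O(1) test_functionsD(1)[OF \<psi>(1)]]]])
  note tL = test_function_lp_space[OF O \<psi>(1) p0]
  have dL: "(\<lambda>x. u x - \<psi> k x) \<in> lp_space ?M p" "(\<lambda>x. ?w x - grad (\<psi> k) x) \<in> lp_space ?M p" for k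
    by (intro lp_space_diff uL wL tL p0)+
  have "lp_norm ?M p (weak_gradient \<Omega> (\<lambda>x. u x - \<psi> k x)) = lp_norm ?M p (\<lambda>x. ?w x - grad (\<psi> k) x)" for k
  proof -
    have "weak_gradient \<Omega> (\<lambda>x. u x - \<psi> k x) \<in> lp_space ?M p"
      by (rule lp_space_AE_cong[OF O(1) dL(2)[of k]]) (use d[of k] in \<open>eventually_elim, simp\<close>)
    then have "(LINT x|?M. norm (weak_gradient \<Omega> (\<lambda>x. u x - \<psi> k x) x) powr p) = (LINT x|?M. norm (?w x - grad (\<psi> k) x) powr p)"
      using d[of k] dL(2)[of k]
      by (intro integral_cong_AE) (auto simp: lp_space_def dest: borel_measurable_integrable elim: eventually_mono)
    then show ?thesis by (simp add: lp_norm_def)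
  qed
  then have s: "(\<lambda>k. lp_norm ?M p (\<lambda>x. u x - \<psi> k x) + lp_norm ?M p (\<lambda>x. ?w x - grad (\<psi> k) x)) \<longlonglongrightarrow> 0"
    using \<psi>(2) by (simp add: sobolev_norm_def)
  have "(\<lambda>k. lp_norm ?M p (\<lambda>x. u x - \<psi> k x)) \<longlonglongrightarrow> 0" "(\<lambda>k. lp_norm ?M p (\<lambda>x. ?w x - grad (\<psi> k) x)) \<longlonglongrightarrow> 0"
    by (rule tendsto_sandwich[OF _ _ tendsto_const s]; intro always_eventually allI; simp add: lp_norm_nonneg)+
  then have e: "(\<lambda>k. lp_energy ?M p (\<lambda>x. u x - \<psi> k x)) \<longlonglongrightarrow> 0" "(\<lambda>k. lp_energy ?M p (\<lambda>x. ?w x - grad (\<psi> k) x)) \<longlonglongrightarrow> 0"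
    using lp_norm_tendsto_0_iff[OF dL(1) p0] lp_norm_tendsto_0_iff[OF dL(2) p0] by auto
  obtain r where r: "strict_mono r" "AE x in ?M. (\<lambda>k. u x - \<psi> (r k) x) \<longlonglongrightarrow> 0"
    by (rule lp_energy_0_AE_subseq[OF dL(1) p0 e(1)])
  have "AE x in ?M. (\<lambda>k. \<psi> (r k) x) \<longlonglongrightarrow> u x"
    using r(2)
  proof eventually_elim
    fix x assume "(\<lambda>k. u x - \<psi> (r k) x) \<longlonglongrightarrow> 0"
    then have "(\<lambda>k. u x - (u x - \<psi> (r k) x)) \<longlonglongrightarrow> u x - 0" by (intro tendsto_intros)
    then show "(\<lambda>k. \<psi> (r k) x) \<longlonglongrightarrow> u x" by simp
  qed
  moreover have "(\<lambda>k. lp_energy ?M p (\<lambda>x. u x - \<psi> (r k) x)) \<longlonglongrightarrow> 0" "(\<lambda>k. lp_energy ?M p (\<lambda>x. ?w x - grad (\<psi> (r k)) x)) \<longlonglongrightarrow> 0"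
    using LIMSEQ_subseq_LIMSEQ[OF e(1) r(1)] LIMSEQ_subseq_LIMSEQ[OF e(2) r(1)] by (simp_all add: o_def)
  ultimately have "smooth_approx \<Omega> p u ?w (\<lambda>k. \<psi> (r k))"
    unfolding smooth_approx_def using uL wL \<psi>(1) by simp
  then show ?thesis by (rule that)
qed


text \<open>Integration by parts holds for each \<open>\<psi> k\<close>, and both sides converge because \<open>\<phi>\<close> and its derivatives are bounded.\<close>

lemma smooth_approx_has_weak_gradient:
  fixes u :: "'a::euclidean_space \<Rightarrow> real"
  assumes O: "open \<Omega>" "bounded \<Omega>" and p: "p > 1" and A: "smooth_approx \<Omega> p u g \<psi>"
  shows "has_weak_gradient \<Omega> u g"
proof -
  let ?M = "lebesgue_on \<Omega>"
  have L: "u \<in> lp_space ?M p" "g \<in> lp_space ?M p" and t: "\<And>k. \<psi> k \<in> test_functions \<Omega>"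
    and e: "(\<lambda>k. lp_energy ?M p (\<lambda>x. u x - \<psi> k x)) \<longlonglongrightarrow> 0" "(\<lambda>k. lp_energy ?M p (\<lambda>x. g x - grad (\<psi> k) x)) \<longlonglongrightarrow> 0"
    using A unfolding smooth_approx_def by auto
  have p0: "p > 0" using p by simp
  note F = finite_measure_lebesgue_on[OF O]
  note tL = test_function_lp_space[OF O t p0]
  have dL: "(\<lambda>x. u x - \<psi> k x) \<in> lp_space ?M p" "(\<lambda>x. g x - grad (\<psi> k) x) \<in> lp_space ?M p" for k
    by (intro lp_space_diff L tL p0)+
  note n = lp_norm_tendsto_0_iff[OF dL(1) p0, THEN iffD2, OF e(1)] lp_norm_tendsto_0_iff[OF dL(2) p0, THEN iffD2, OF e(2)]
  have lim: "(\<lambda>k. LINT x|?M. w x * c x - v k x * c x) \<longlonglongrightarrow> 0"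
    if w: "\<And>k. (\<lambda>x. w x - v k x) \<in> lp_space ?M p" "(\<lambda>k. lp_norm ?M p (\<lambda>x. w x - v k x)) \<longlonglongrightarrow> 0"
      and c: "\<And>x. \<bar>c x\<bar> \<le> B" "continuous_on UNIV c" for w c :: "'a \<Rightarrow> real" and v B
  proof (rule Lim_null_comparison)
  let ?L = "\<lambda>k. lp_norm ?M p (\<lambda>x. w x - v k x) * measure ?M (space ?M) powr (1 - 1 / p)"
    show "(\<lambda>k. B * (?L k)) \<longlonglongrightarrow> 0"
      by (intro tendsto_mult_right_zero tendsto_mult_left_zero w)
    show "\<forall>\<^sub>F k in sequentially. norm (LINT x|?M. w x * c x - v k x * c x) \<le> B * (?L k)"
    proof (intro always_eventually allI)
      fix k
      have B: "B \<ge> 0" using c(1)[of 0] by linarith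
      have i: "integrable ?M (\<lambda>x. w x - v k x)" by (rule lp_space_integrable[OF F w(1) p])
      have i2: "integrable ?M (\<lambda>x. B * norm (w x - v k x))" using i by simp
      have "norm (LINT x|?M. w x * c x - v k x * c x) \<le> (LINT x|?M. B * norm (w x - v k x))"
      proof (rule Bochner_Integration.integral_norm_bound_integral[OF _ i2])
        show "integrable ?M (\<lambda>x. w x * c x - v k x * c x)"
        proof (rule Bochner_Integration.integrable_bound[OF i2])
          show "(\<lambda>x. w x * c x - v k x * c x) \<in> borel_measurable ?M"
            using borel_measurable_times[OF borel_measurable_integrable[OF i] measurable_lebesgue_on_continuous[OF c(2)]]
            by (simp add: left_diff_distrib)
        qed (use c B in \<open>auto intro!: AE_I2 mult_right_mono simp: left_diff_distrib[symmetric] abs_mult mult.commute[of B] mult_left_mono\<close>)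
      qed (use c in \<open>auto simp: left_diff_distrib[symmetric] abs_mult mult.commute[of B] mult_left_mono\<close>)
      also have "\<dots> = B * (LINT x|?M. norm (w x - v k x))" by simp
      also have "\<dots> \<le> B * (?L k)"
      proof (intro mult_left_mono B)
        have "ennreal (LINT x|?M. norm (w x - v k x)) = (\<integral>\<^sup>+x. ennreal (norm (w x - v k x)) \<partial>?M)"
          using i by (intro nn_integral_eq_integral[symmetric]) auto
        also have "\<dots> \<le> ennreal (?L k)"
          by (rule nn_integral_le_lp_norm[OF F w(1) p])
        finally show "(LINT x|?M. norm (w x - v k x)) \<le> ?L k"
          by (subst (asm) ennreal_le_iff) (auto simp: lp_norm_nonneg)
      qed
      finally show "norm (LINT x|?M. w x * c x - v k x * c x) \<le> B * (?L k)" .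
    qed
  qed
  have l: "locally_integrable \<Omega> u" "locally_integrable \<Omega> g"
    by (rule lp_space_locally_integrable[OF O _ p], rule L)+
  have lt: "locally_integrable \<Omega> (\<psi> k)" "locally_integrable \<Omega> (grad (\<psi> k))" for k
    by (rule lp_space_locally_integrable[OF O _ p], rule tL)+
  show ?thesis
    unfolding has_weak_gradient_def
  proof (intro conjI ballI l)
    fix \<phi> and i :: 'a assume \<phi>: "\<phi> \<in> test_functions \<Omega>" and i: "i \<in> Basis"
    let ?h = "\<lambda>k x. g x \<bullet> i - grad (\<psi> k) x \<bullet> i"
    have C: "Ck 1 \<phi>" by (rule test_functionsD(1)[OF \<phi>])
    obtain B where B: "\<And>x. \<bar>\<phi> x\<bar> \<le> B" "\<And>x. norm (grad \<phi> x) \<le> B"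
      by (rule bounded_test_function[OF \<phi>]) blast
    have c: "continuous_on UNIV \<phi>" "continuous_on UNIV (\<lambda>x. grad \<phi> x \<bullet> i)"
      using Ck_continuous[OF C] continuous_on_grad[OF C] by (auto intro!: continuous_intros)
    note i1 = integrable_test_pairing(1)[OF O(1) \<phi>] and i2 = integrable_test_pairing(2)[OF O(1) \<phi>]
    have B': "\<bar>grad \<phi> x \<bullet> i\<bar> \<le> B" for x
      using Cauchy_Schwarz_ineq2[of "grad \<phi> x" i] B(2)[of x] i by simp
    have gi: "(\<lambda>x. ?h k x) \<in> lp_space ?M p"
      "lp_norm ?M p (\<lambda>x. ?h k x) \<le> lp_norm ?M p (\<lambda>x. g x - grad (\<psi> k) x)" for k
    proof -
      have le: "lp_energy ?M p (\<lambda>x. ?h k x) \<le> lp_energy ?M p (\<lambda>x. g x - grad (\<psi> k) x)"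
        using i p0 by (intro lp_energy_mono) (auto simp: inner_diff_left[symmetric] Basis_le_norm)
      have m: "(\<lambda>x. ?h k x) \<in> borel_measurable ?M"
        using dL(2)[of k] unfolding lp_space_iff inner_diff_left[symmetric] by auto
      show m': "(\<lambda>x. ?h k x) \<in> lp_space ?M p"
        using le dL(2)[of k] m unfolding lp_space_iff by (auto intro: le_less_trans)
      have "lp_norm ?M p (\<lambda>x. ?h k x) powr p \<le> lp_norm ?M p (\<lambda>x. g x - grad (\<psi> k) x) powr p"
        using le unfolding lp_energy_eq_norm[OF m' p0] lp_energy_eq_norm[OF dL(2) p0] by simp
      then show "lp_norm ?M p (\<lambda>x. ?h k x) \<le> lp_norm ?M p (\<lambda>x. g x - grad (\<psi> k) x)"
        using p0 by (meson lp_norm_nonneg not_le powr_less_mono2)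
    qed
    have ngi: "(\<lambda>k. lp_norm ?M p (\<lambda>x. ?h k x)) \<longlonglongrightarrow> 0"
      by (rule tendsto_sandwich[OF _ _ tendsto_const n(2)]) (auto simp: lp_norm_nonneg gi(2))
    have "(\<lambda>k. LINT x|?M. u x * (grad \<phi> x \<bullet> i) - \<psi> k x * (grad \<phi> x \<bullet> i)) \<longlonglongrightarrow> 0"
      by (rule lim[OF dL(1) n(1) B' c(2)])
    moreover have "(\<lambda>k. LINT x|?M. (g x \<bullet> i) * \<phi> x - (grad (\<psi> k) x \<bullet> i) * \<phi> x) \<longlonglongrightarrow> 0"
      by (rule lim[OF gi(1) ngi B(1) c(1)])
    ultimately have "(\<lambda>k. (LINT x|?M. u x * (grad \<phi> x \<bullet> i) - \<psi> k x * (grad \<phi> x \<bullet> i)) + (LINT x|?M. (g x \<bullet> i) * \<phi> x - (grad (\<psi> k) x \<bullet> i) * \<phi> x)) \<longlonglongrightarrow> 0 + 0"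
      by (rule tendsto_add)
    moreover have "(LINT x|?M. u x * (grad \<phi> x \<bullet> i) - \<psi> k x * (grad \<phi> x \<bullet> i)) + (LINT x|?M. (g x \<bullet> i) * \<phi> x - (grad (\<psi> k) x \<bullet> i) * \<phi> x)
        = (LINT x|?M. u x * (grad \<phi> x \<bullet> i)) + (LINT x|?M. (g x \<bullet> i) * \<phi> x)" for k
    proof -
      have "(LINT x|?M. \<psi> k x * (grad \<phi> x \<bullet> i)) = - (LINT x|?M. (grad (\<psi> k) x \<bullet> i) * \<phi> x)"
        using integration_by_parts_test[OF O(1) \<phi> test_functionsD(1)[OF t] i, of k] by (simp add: grad_inner_Basis[OF i])
      then show ?thesis
        using i1[OF l(1)] i1[OF lt(1)] i2[OF l(2)] i2[OF lt(2)] by simp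
    qed
    ultimately have "(LINT x|?M. u x * (grad \<phi> x \<bullet> i)) + (LINT x|?M. (g x \<bullet> i) * \<phi> x) = 0"
      by (simp add: LIMSEQ_const_iff)
    then show "(LINT x|?M. u x * frechet_derivative \<phi> (at x) i) = - (LINT x|?M. (g x \<bullet> i) * \<phi> x)"
      by (simp add: grad_inner_Basis[OF i])
  qed
qed

lemma smooth_approx_sobolev_space0:
  fixes u :: "'a::euclidean_space \<Rightarrow> real"
  assumes O: "open \<Omega>" "bounded \<Omega>" and p: "p > 1" and A: "smooth_approx \<Omega> p u g \<psi>"
  shows "u \<in> sobolev_space0 \<Omega> p" "AE x in lebesgue_on \<Omega>. weak_gradient \<Omega> u x = g x"
proof -
  let ?M = "lebesgue_on \<Omega>"
  have L: "u \<in> lp_space ?M p" "g \<in> lp_space ?M p" and t: "\<And>k. \<psi> k \<in> test_functions \<Omega>"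
    and e: "(\<lambda>k. lp_energy ?M p (\<lambda>x. u x - \<psi> k x)) \<longlonglongrightarrow> 0" "(\<lambda>k. lp_energy ?M p (\<lambda>x. g x - grad (\<psi> k) x)) \<longlonglongrightarrow> 0"
    using A unfolding smooth_approx_def by auto
  have p0: "p > 0" using p by simp
  note tL = test_function_lp_space[OF O t p0]
  note w = smooth_approx_has_weak_gradient[OF O p A]
  show "AE x in lebesgue_on \<Omega>. weak_gradient \<Omega> u x = g x" by (rule weak_gradient_eq_AE(1)[OF O(1) w])
  have dL: "(\<lambda>x. u x - \<psi> k x) \<in> lp_space ?M p" "(\<lambda>x. g x - grad (\<psi> k) x) \<in> lp_space ?M p" for k
    by (intro lp_space_diff L tL p0)+
  have d: "AE x in ?M. g x - grad (\<psi> k) x = weak_gradient \<Omega> (\<lambda>x. u x - \<psi> k x) x" for k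
    using weak_gradient_eq_AE(1)[OF O(1) has_weak_gradient_diff[OF O(1) w has_weak_gradient_C1[OF O(1) test_functionsD(1)[OF t]]], of k]
    by eventually_elim simp
  have wL: "weak_gradient \<Omega> (\<lambda>x. u x - \<psi> k x) \<in> lp_space ?M p" for k
    by (rule lp_space_AE_cong[OF O(1) dL(2)[of k] d])
  have "(\<lambda>k. lp_energy ?M p (weak_gradient \<Omega> (\<lambda>x. u x - \<psi> k x))) \<longlonglongrightarrow> 0"
    using e(2) lp_energy_AE_cong[OF d, of p] by simp
  then have "(\<lambda>k. lp_norm ?M p (\<lambda>x. u x - \<psi> k x) + lp_norm ?M p (weak_gradient \<Omega> (\<lambda>x. u x - \<psi> k x))) \<longlonglongrightarrow> 0 + 0"
    using lp_norm_tendsto_0_iff[OF dL(1) p0] lp_norm_tendsto_0_iff[OF wL p0] e(1) by (intro tendsto_add) auto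
  then show "u \<in> sobolev_space0 \<Omega> p"
    unfolding sobolev_space0_def sobolev_space_def sobolev_norm_def using L w t
    by (intro CollectI conjI bexI[of _ g] exI[of _ \<psi>]) simp_all
qed

text \<open>The chain rule in \<open>W_0^{1,p}\<close>. As \<open>h 0 = 0\<close>, the functions \<open>h \<circ> \<psi> k\<close> are test functions. Their gradients converge
  since \<open>h'(u) g - h'(\<psi>) \<nabla>\<psi> = (h'(u) - h'(\<psi>)) g + h'(\<psi>) (g - \<nabla>\<psi>)\<close>, where the first summand tends to \<open>0\<close> by
  dominated convergence and the second because \<open>h'\<close> is bounded.\<close>

lemma smooth_approx_compose:
  fixes u :: "'a::euclidean_space \<Rightarrow> real"
  assumes O: "open \<Omega>" "bounded \<Omega>" and p: "p > 1" and A: "smooth_approx \<Omega> p u g \<psi>"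
    and h: "\<And>k. Ck k h" "h 0 = 0" "\<And>s. (h has_real_derivative h' s) (at s)" "\<And>s. \<bar>h' s\<bar> \<le> 1" "continuous_on UNIV h'"
  shows "smooth_approx \<Omega> p (\<lambda>x. h (u x)) (\<lambda>x. h' (u x) *\<^sub>R g x) (\<lambda>k x. h (\<psi> k x))"
proof -
  let ?M = "lebesgue_on \<Omega>"
  have L: "u \<in> lp_space ?M p" "g \<in> lp_space ?M p" and t: "\<And>k. \<psi> k \<in> test_functions \<Omega>"
    and e: "(\<lambda>k. lp_energy ?M p (\<lambda>x. u x - \<psi> k x)) \<longlonglongrightarrow> 0" "(\<lambda>k. lp_energy ?M p (\<lambda>x. g x - grad (\<psi> k) x)) \<longlonglongrightarrow> 0"
    and ae: "AE x in ?M. (\<lambda>k. \<psi> k x) \<longlonglongrightarrow> u x"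
    using A unfolding smooth_approx_def by auto
  have p0: "p > 0" using p by simp
  note tL = test_function_lp_space[OF O t p0]
  have lip: "\<bar>h a - h b\<bar> \<le> \<bar>a - b\<bar>" for a b
    using field_differentiable_bound[of UNIV h h' 1 a b] h(3,4) by (auto simp: has_field_derivative_at_within)
  have hc: "continuous_on UNIV h" by (rule Ck_continuous[OF h(1)[of 0]])
  have [measurable]: "h \<in> borel_measurable borel" "h' \<in> borel_measurable borel"
    using hc h(5) by (auto intro: borel_measurable_continuous_onI)
  have um[measurable]: "u \<in> borel_measurable ?M" "g \<in> borel_measurable ?M" using L by (auto simp: lp_space_iff)
  have tm[measurable]: "\<psi> k \<in> borel_measurable ?M" "grad (\<psi> k) \<in> borel_measurable ?M" for k
    using tL[of k] by (auto simp: lp_space_iff)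
  have ht: "(\<lambda>x. h (\<psi> k x)) \<in> test_functions \<Omega>" for k
  proof -
    obtain K where K: "compact K" "K \<subseteq> \<Omega>" "\<And>x. x \<notin> K \<Longrightarrow> \<psi> k x = 0"
      using t[of k] unfolding test_functions_def by auto
    have "Ck j (\<lambda>x. h (\<psi> k x))" for j
      by (rule Ck_compose[of j h "\<psi> k", OF h(1) test_functionsD(1)[OF t]])
    moreover have "\<forall>x. x \<notin> K \<longrightarrow> h (\<psi> k x) = 0" using K(3) h(2) by simp
    ultimately show ?thesis unfolding test_functions_def using K(1,2) by auto
  qed
  have gr: "grad (\<lambda>x. h (\<psi> k x)) x = h' (\<psi> k x) *\<^sub>R grad (\<psi> k) x" for k x
    by (rule grad_compose[where h=h and h'=h' and u="\<psi> k", OF test_functionsD(1)[OF t] h(3)])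
  have hu: "(\<lambda>x. h (u x)) \<in> lp_space ?M p"
  proof -
    have "lp_energy ?M p (\<lambda>x. h (u x)) \<le> lp_energy ?M p u"
      using lip[of _ 0] h(2) p0 by (intro lp_energy_mono) auto
    then show ?thesis using L unfolding lp_space_iff by (auto intro: le_less_trans)
  qed
  have hg: "(\<lambda>x. h' (u x) *\<^sub>R g x) \<in> lp_space ?M p"
    by (rule lp_space_bounded_mult[OF L(2) _ h(4) p0]) measurable
  have c1: "(\<lambda>k. lp_energy ?M p (\<lambda>x. h (u x) - h (\<psi> k x))) \<longlonglongrightarrow> 0"
    by (rule tendsto_sandwich[OF _ _ tendsto_const e(1)])
       (auto intro!: always_eventually lp_energy_mono lip p0)
  define d where "d k x = (h' (u x) - h' (\<psi> k x)) *\<^sub>R g x" for k x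
  let ?E = "\<lambda>k. lp_energy ?M p (d k) + lp_energy ?M p (\<lambda>x. g x - grad (\<psi> k) x)"
  let ?H = "\<lambda>k x. h' (u x) *\<^sub>R g x - grad (\<lambda>x. h (\<psi> k x)) x"
  have d0: "(\<lambda>k. lp_energy ?M p (d k)) \<longlonglongrightarrow> 0"
  proof -
    have "(\<lambda>k. lp_energy ?M p (d k)) \<longlonglongrightarrow> (\<integral>\<^sup>+x. 0 \<partial>?M)"
      unfolding lp_energy_def
    proof (rule nn_integral_dominated_convergence[where w="\<lambda>x. ennreal (2 powr p) * ennreal (norm (g x) powr p)"])
      show "AE x in ?M. ennreal (norm (d k x) powr p) \<le> ennreal (2 powr p) * ennreal (norm (g x) powr p)" for k
      proof (intro AE_I2)
        fix x
        have "norm (d k x) \<le> 2 * norm (g x)"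
          unfolding d_def norm_scaleR using h(4)[of "u x"] h(4)[of "\<psi> k x"] by (intro mult_right_mono) auto
        then have "norm (d k x) powr p \<le> (2 * norm (g x)) powr p" using p0 by (intro powr_mono2) auto
        then show "ennreal (norm (d k x) powr p) \<le> ennreal (2 powr p) * ennreal (norm (g x) powr p)"
          by (simp add: powr_mult ennreal_mult'[symmetric] ennreal_leI)
      qed
      have "(\<integral>\<^sup>+x. ennreal (2 powr p) * ennreal (norm (g x) powr p) \<partial>?M) = ennreal (2 powr p) * lp_energy ?M p g"
        unfolding lp_energy_def by (rule nn_integral_cmult) measurable
      then show "(\<integral>\<^sup>+x. ennreal (2 powr p) * ennreal (norm (g x) powr p) \<partial>?M) < \<infinity>"
        using L(2) by (simp add: lp_space_iff ennreal_mult_less_top)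
      show "AE x in ?M. (\<lambda>k. ennreal (norm (d k x) powr p)) \<longlonglongrightarrow> 0"
        using ae
      proof eventually_elim
        fix x assume x: "(\<lambda>k. \<psi> k x) \<longlonglongrightarrow> u x"
        have "(\<lambda>k. h' (\<psi> k x)) \<longlonglongrightarrow> h' (u x)"
          using h(5) x continuous_on_tendsto_compose[of UNIV h' "\<lambda>k. \<psi> k x" "u x" sequentially] by auto
        then have "(\<lambda>k. (h' (u x) - h' (\<psi> k x)) *\<^sub>R g x) \<longlonglongrightarrow> (h' (u x) - h' (u x)) *\<^sub>R g x"
          by (intro tendsto_intros)
        then have "(\<lambda>k. d k x) \<longlonglongrightarrow> 0" unfolding d_def by simp
        then have "(\<lambda>k. norm (d k x)) \<longlonglongrightarrow> 0" by (rule tendsto_norm_zero)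
        then have "(\<lambda>k. norm (d k x) powr p) \<longlonglongrightarrow> 0 powr p"
          using p0 by (intro tendsto_powr2 tendsto_const) auto
        then show "(\<lambda>k. ennreal (norm (d k x) powr p)) \<longlonglongrightarrow> 0"
          by (subst ennreal_tendsto_0_iff) auto
      qed
      show "(\<lambda>x. ennreal (norm (d k x) powr p)) \<in> borel_measurable ?M" for k unfolding d_def by measurable
    qed measurable
    then show ?thesis by simp
  qed
  have c2: "(\<lambda>k. lp_energy ?M p (\<lambda>x. ?H k x)) \<longlonglongrightarrow> 0"
  proof (rule tendsto_sandwich[OF _ _ tendsto_const])
    show "(\<lambda>k. ennreal (2 powr p) * (?E k)) \<longlonglongrightarrow> 0"
    proof -
      have "(\<lambda>k. ennreal (2 powr p) * (?E k)) \<longlonglongrightarrow> ennreal (2 powr p) * (0 + 0)"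
        using d0 e(2) by (intro ennreal_tendsto_cmult tendsto_add) auto
      then show ?thesis by simp
    qed
    show "\<forall>\<^sub>F k in sequentially. lp_energy ?M p (\<lambda>x. ?H k x) \<le> ennreal (2 powr p) * (?E k)"
    proof (intro always_eventually allI)
      fix k
      have eq: "?H k x = d k x + h' (\<psi> k x) *\<^sub>R (g x - grad (\<psi> k) x)" for x
        unfolding gr d_def by (simp add: algebra_simps)
      have [measurable]: "d k \<in> borel_measurable ?M" unfolding d_def by measurable
      have "lp_energy ?M p (\<lambda>x. d k x + h' (\<psi> k x) *\<^sub>R (g x - grad (\<psi> k) x))
        \<le> ennreal (2 powr p) * (lp_energy ?M p (d k) + lp_energy ?M p (\<lambda>x. h' (\<psi> k x) *\<^sub>R (g x - grad (\<psi> k) x)))"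
        by (rule lp_energy_add_le[OF _ _ p0]) measurable
      also have "\<dots> \<le> ennreal (2 powr p) * (?E k)"
        using h(4) p0 by (intro mult_left_mono add_left_mono lp_energy_mono) (auto simp: mult_left_le_one_le)
      finally show "lp_energy ?M p (\<lambda>x. ?H k x) \<le> ennreal (2 powr p) * (?E k)"
        unfolding eq .
    qed
  qed auto
  have "AE x in ?M. (\<lambda>k. h (\<psi> k x)) \<longlonglongrightarrow> h (u x)"
    using ae
  proof eventually_elim
    fix x assume "(\<lambda>k. \<psi> k x) \<longlonglongrightarrow> u x"
    then show "(\<lambda>k. h (\<psi> k x)) \<longlonglongrightarrow> h (u x)"
      using hc continuous_on_tendsto_compose[of UNIV h "\<lambda>k. \<psi> k x" "u x" sequentially] by auto
  qed
  then show ?thesis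
    unfolding smooth_approx_def using hu hg ht c1 c2 by simp
qed


lemma lp_energy_lebesgue_on_supported:
  fixes F :: "'a::euclidean_space \<Rightarrow> 'b::euclidean_space"
  assumes "open \<Omega>" "\<And>x. x \<notin> \<Omega> \<Longrightarrow> F x = 0"
  shows "lp_energy (lebesgue_on \<Omega>) p F = lp_energy lborel p F"
proof -
  have "lp_energy (lebesgue_on \<Omega>) p F = (\<integral>\<^sup>+x. ennreal (norm (F x) powr p) * indicator \<Omega> x \<partial>lebesgue)"
    unfolding lp_energy_def using assms(1) by (intro nn_integral_restrict_space) auto
  also have "\<dots> = (\<integral>\<^sup>+x. ennreal (norm (F x) powr p) \<partial>lebesgue)"
    using assms(2) by (intro nn_integral_cong) (auto simp: indicator_def)
  finally show ?thesis by (simp add: lp_energy_def nn_integral_completion)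
qed

text \<open>Fatou's lemma along the approximating sequence. The energies of the approximating gradients are compared with that
  of \<open>g\<close> by the crude triangle inequality for energies, which costs the factor \<open>2 powr q\<close>.\<close>

theorem sobolev_inequality:
  fixes p :: real
  assumes p: "1 < p" "p < real DIM('a::euclidean_space)"
  defines "q \<equiv> sobolev_exp (real DIM('a)) p"
  obtains S where "S > 0" "\<And>(\<Omega> :: 'a set) u g \<psi> D.
    \<lbrakk>open \<Omega>; bounded \<Omega>; smooth_approx \<Omega> p u g \<psi>; 0 \<le> D; lp_energy (lebesgue_on \<Omega>) p g \<le> ennreal D\<rbrakk> \<Longrightarrow>
    lp_energy (lebesgue_on \<Omega>) q u \<le> ennreal (S * D powr (q / p))"
proof -
  obtain S where S: "S > 0" "\<And>(u :: 'a \<Rightarrow> real) D.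
    \<lbrakk>C1_compact u; 0 \<le> D; (\<integral>\<^sup>+x. ennreal (norm (grad u x) powr p) \<partial>lborel) \<le> ennreal D\<rbrakk> \<Longrightarrow>
    (\<integral>\<^sup>+x. ennreal (\<bar>u x\<bar> powr q) \<partial>lborel) \<le> ennreal (S * D powr (q / p))"
    unfolding q_def by (fact sobolev_inequality_C1[OF p])
  have q: "q > 0" using p unfolding q_def sobolev_exp_def by simp
  have p0: "p > 0" using p by simp
  show ?thesis
  proof (rule that[of "S * 2 powr q"])
    show "S * 2 powr q > 0" using S(1) by simp
    fix \<Omega> :: "'a set" and u :: "'a \<Rightarrow> real" and g :: "'a \<Rightarrow> 'a" and \<psi> :: "nat \<Rightarrow> 'a \<Rightarrow> real" and D :: real
    assume O: "open \<Omega>" "bounded \<Omega>" and A: "smooth_approx \<Omega> p u g \<psi>" and D: "0 \<le> D" "lp_energy (lebesgue_on \<Omega>) p g \<le> ennreal D"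
    let ?M = "lebesgue_on \<Omega>"
    have L: "u \<in> lp_space ?M p" "g \<in> lp_space ?M p" and t: "\<And>k. \<psi> k \<in> test_functions \<Omega>"
      and e: "(\<lambda>k. lp_energy ?M p (\<lambda>x. g x - grad (\<psi> k) x)) \<longlonglongrightarrow> 0"
      and ae: "AE x in ?M. (\<lambda>k. \<psi> k x) \<longlonglongrightarrow> u x"
      using A unfolding smooth_approx_def by auto
    note tL = test_function_lp_space[OF O t p0]
    let ?w = "\<lambda>k x. g x - grad (\<psi> k) x"
    have um[measurable]: "u \<in> borel_measurable ?M" "g \<in> borel_measurable ?M" using L by (auto simp: lp_space_iff)
    have tm[measurable]: "\<psi> k \<in> borel_measurable ?M" "grad (\<psi> k) \<in> borel_measurable ?M" for k
      using tL[of k] by (auto simp: lp_space_iff)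
    have dL: "(\<lambda>x. ?w k x) \<in> lp_space ?M p" for k
      by (intro lp_space_diff L tL p0)
    define \<delta> where "\<delta> k = lp_norm ?M p (\<lambda>x. ?w k x) powr p" for k
    have \<delta>: "lp_energy ?M p (\<lambda>x. ?w k x) = ennreal (\<delta> k)" "\<delta> k \<ge> 0" for k
      unfolding \<delta>_def using lp_energy_eq_norm[OF dL p0] by auto
    have \<delta>0: "\<delta> \<longlonglongrightarrow> 0" using e \<delta>(2) unfolding \<delta>(1) by (subst (asm) ennreal_tendsto_0_iff) auto
    have b: "lp_energy ?M q (\<psi> k) \<le> ennreal (S * (2 powr p * (D + \<delta> k)) powr (q / p))" for k
    proof -
      have "lp_energy ?M p (grad (\<psi> k)) = lp_energy ?M p (\<lambda>x. g x + - (?w k x))" by simp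
      also have "\<dots> \<le> ennreal (2 powr p) * (lp_energy ?M p g + lp_energy ?M p (\<lambda>x. - (?w k x)))"
        by (rule lp_energy_add_le[OF _ _ p0]) measurable
      also have "\<dots> \<le> ennreal (2 powr p) * (ennreal D + ennreal (\<delta> k))"
        unfolding lp_energy_uminus \<delta>(1) by (intro mult_left_mono add_right_mono D) simp
      also have "\<dots> = ennreal (2 powr p * (D + \<delta> k))" using D \<delta>(2)[of k] by (simp add: ennreal_mult' ennreal_plus)
      finally have "lp_energy lborel p (grad (\<psi> k)) \<le> ennreal (2 powr p * (D + \<delta> k))"
        using lp_energy_lebesgue_on_supported[OF O(1), of "grad (\<psi> k)" p] test_functionsD(4)[OF t] by simp
      then have "(\<integral>\<^sup>+x. ennreal (\<bar>\<psi> k x\<bar> powr q) \<partial>lborel) \<le> ennreal (S * (2 powr p * (D + \<delta> k)) powr (q / p))"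
        using D \<delta>(2)[of k] unfolding lp_energy_def by (intro S(2) test_functionsD(2)[OF t]) auto
      then show ?thesis
        using lp_energy_lebesgue_on_supported[OF O(1), of "\<psi> k" q] test_functionsD(3)[OF t] by (simp add: lp_energy_def)
    qed
    have "lp_energy ?M q u = (\<integral>\<^sup>+x. liminf (\<lambda>k. ennreal (norm (\<psi> k x) powr q)) \<partial>?M)"
      unfolding lp_energy_def
    proof (rule nn_integral_cong_AE)
      show "AE x in ?M. ennreal (norm (u x) powr q) = liminf (\<lambda>k. ennreal (norm (\<psi> k x) powr q))"
        using ae
      proof eventually_elim
        fix x assume "(\<lambda>k. \<psi> k x) \<longlonglongrightarrow> u x"
        then have "(\<lambda>k. ennreal (norm (\<psi> k x) powr q)) \<longlonglongrightarrow> ennreal (norm (u x) powr q)"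
          using q by (intro tendsto_ennrealI tendsto_powr2 tendsto_norm tendsto_const) auto
        then show "ennreal (norm (u x) powr q) = liminf (\<lambda>k. ennreal (norm (\<psi> k x) powr q))"
          by (rule lim_imp_Liminf[OF trivial_limit_sequentially, symmetric])
      qed
    qed
    also have "\<dots> \<le> liminf (\<lambda>k. lp_energy ?M q (\<psi> k))"
      unfolding lp_energy_def by (rule nn_integral_liminf) measurable
    also have "\<dots> \<le> liminf (\<lambda>k. ennreal (S * (2 powr p * (D + \<delta> k)) powr (q / p)))"
      by (intro Liminf_mono always_eventually allI b)
    also have "\<dots> = ennreal (S * (2 powr p * (D + 0)) powr (q / p))"
    proof (rule lim_imp_Liminf)
      have "(\<lambda>k. (2 powr p * (D + \<delta> k)) powr (q / p)) \<longlonglongrightarrow> (2 powr p * (D + 0)) powr (q / p)"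
        using q p0 D \<delta>(2) by (intro tendsto_powr2 tendsto_intros \<delta>0) (auto intro!: always_eventually)
      then show "(\<lambda>k. ennreal (S * (2 powr p * (D + \<delta> k)) powr (q / p))) \<longlonglongrightarrow> ennreal (S * (2 powr p * (D + 0)) powr (q / p))"
        by (intro tendsto_ennrealI tendsto_mult tendsto_const)
    qed simp
    also have "(2 powr p * (D + 0)) powr (q / p) = 2 powr q * D powr (q / p)"
      using p0 by (subst powr_mult) (auto simp: powr_powr)
    finally show "lp_energy ?M q u \<le> ennreal (S * 2 powr q * D powr (q / p))" by (simp add: mult.assoc)
  qed
qed

section \<open>Testing the equation with truncations of the solution\<close>

text \<open>The absolute value of the truncation \<open>G_k\<close>.\<close>

definition excess :: "real \<Rightarrow> real \<Rightarrow> real" where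
  "excess k s = max 0 (\<bar>s\<bar> - k)"

text \<open>The truncation is \<open>G_k(s) = s + (|s - k| - |s + k|)/2\<close>; here each absolute value \<open>|t|\<close> is replaced by the smooth function
  \<open>sqrt (t^2 + e)\<close>. It is smooth and vanishes at \<open>0\<close>, as composition with test functions requires.\<close>

definition smooth_excess :: "real \<Rightarrow> real \<Rightarrow> real \<Rightarrow> real" where
  "smooth_excess k e s = s + (((s - k)\<^sup>2 + e) powr (1 / 2) - ((s + k)\<^sup>2 + e) powr (1 / 2)) / 2"

definition smooth_excess_deriv :: "real \<Rightarrow> real \<Rightarrow> real \<Rightarrow> real" where
  "smooth_excess_deriv k e s = 1 + ((s - k) / sqrt ((s - k)\<^sup>2 + e) - (s + k) / sqrt ((s + k)\<^sup>2 + e)) / 2"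

lemma Ck_smooth_excess:
  assumes "e > 0" shows "Ck n (smooth_excess k e)"
proof -
  have lin: "Ck n (\<lambda>s. s + c)" for c :: real by (intro Ck_add Ck_id_real Ck_const)
  have 1: "Ck n (\<lambda>s. ((s + c)\<^sup>2 + e) powr (1 / 2))" for c
    by (rule Ck_compose[of n "\<lambda>t. (t\<^sup>2 + e) powr (1 / 2)" "\<lambda>s. s + c", OF Ck_square_plus_powr[OF assms] lin])
  have "Ck n (\<lambda>s. s + (1 / 2) * (((s + (- k))\<^sup>2 + e) powr (1 / 2) - ((s + k)\<^sup>2 + e) powr (1 / 2)))"
    by (rule Ck_add[OF Ck_id_real Ck_mult[OF Ck_const Ck_minus[OF 1 1]]])
  then show ?thesis unfolding smooth_excess_def[abs_def] by simp
qed

lemma smooth_excess_has_derivative: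
  assumes "e > 0"
  shows "(smooth_excess k e has_real_derivative smooth_excess_deriv k e s) (at s)"
proof -
  have pos: "t\<^sup>2 + e > 0" for t using assms by (smt (verit) zero_le_power2)
  have 1: "((\<lambda>s. ((s + c)\<^sup>2 + e) powr (1 / 2)) has_real_derivative (s + c) / sqrt ((s + c)\<^sup>2 + e)) (at s)" for c
    using pos[of "s + c"]
    by (auto intro!: derivative_eq_intros simp: powr_minus powr_half_sqrt powr_diff field_simps real_sqrt_mult_self)
  have "((\<lambda>s. s + (((s + (- k))\<^sup>2 + e) powr (1 / 2) - ((s + k)\<^sup>2 + e) powr (1 / 2)) / 2) has_real_derivative
     1 + ((s + (- k)) / sqrt ((s + (- k))\<^sup>2 + e) - (s + k) / sqrt ((s + k)\<^sup>2 + e)) / 2) (at s)"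
    by (intro DERIV_add DERIV_ident DERIV_cdivide DERIV_diff 1)
  then show ?thesis unfolding smooth_excess_def[abs_def] smooth_excess_deriv_def by simp
qed

text \<open>The function \<open>t / sqrt (t^2 + e)\<close> is increasing with values between \<open>-1\<close> and \<open>1\<close>.\<close>

lemma smooth_excess_deriv_bounds:
  assumes "e > 0" "k \<ge> 0"
  shows "0 \<le> smooth_excess_deriv k e s" "smooth_excess_deriv k e s \<le> 1"
proof -
  have pos: "t\<^sup>2 + e > 0" for t using assms by (smt (verit) zero_le_power2)
  define b where "b t = t / sqrt (t\<^sup>2 + e)" for t
  have b: "\<bar>b t\<bar> \<le> 1" for t
  proof -
    have "\<bar>t\<bar> \<le> sqrt (t\<^sup>2 + e)" using assms by (intro real_le_rsqrt) simp
    then show ?thesis using pos[of t] by (simp add: b_def abs_divide)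
  qed
  have mono: "b t \<le> b t'" if "t \<le> t'" for t t'
  proof (rule DERIV_nonneg_imp_nondecreasing[OF that])
    fix x
    have "(b has_real_derivative e / sqrt (x\<^sup>2 + e) ^ 3) (at x)"
    proof -
      have s: "sqrt (x\<^sup>2 + e) > 0" using pos by simp
      have "((\<lambda>x. sqrt (x\<^sup>2 + e)) has_real_derivative x / sqrt (x\<^sup>2 + e)) (at x)"
        using pos[of x] by (auto intro!: derivative_eq_intros simp: field_simps)
      from DERIV_divide[OF DERIV_ident this]
      have "(b has_real_derivative (1 * sqrt (x\<^sup>2 + e) - x * (x / sqrt (x\<^sup>2 + e))) / (sqrt (x\<^sup>2 + e) * sqrt (x\<^sup>2 + e))) (at x)"
        using s unfolding b_def[abs_def] by simp
      moreover have "(1 * sqrt (x\<^sup>2 + e) - x * (x / sqrt (x\<^sup>2 + e))) / (sqrt (x\<^sup>2 + e) * sqrt (x\<^sup>2 + e)) = e / sqrt (x\<^sup>2 + e) ^ 3"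
      proof -
        have "sqrt (x\<^sup>2 + e) * sqrt (x\<^sup>2 + e) = x * x + e" using pos[of x] by (simp add: power2_eq_square)
        then show ?thesis using s by (simp add: field_simps power3_eq_cube)
      qed
      ultimately show ?thesis by simp
    qed
    moreover have "e / sqrt (x\<^sup>2 + e) ^ 3 \<ge> 0" using assms pos[of x] by simp
    ultimately show "\<exists>y. (b has_real_derivative y) (at x) \<and> 0 \<le> y" by blast
  qed
  have eq: "smooth_excess_deriv k e s = 1 + (b (s - k) - b (s + k)) / 2"
    by (simp add: smooth_excess_deriv_def b_def)
  have "0 \<le> 1 + (x - y) / 2" if "\<bar>x\<bar> \<le> 1" "\<bar>y\<bar> \<le> 1" for x y :: real
    using that by (simp add: field_simps)
  then show "0 \<le> smooth_excess_deriv k e s" unfolding eq using b by blast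
  show "smooth_excess_deriv k e s \<le> 1" unfolding eq using mono[of "s - k" "s + k"] assms by simp
qed

lemma continuous_smooth_excess_deriv:
  assumes "e > 0" shows "continuous_on UNIV (smooth_excess_deriv k e)"
proof -
  have "sqrt (t\<^sup>2 + e) \<noteq> 0" for t using assms by (smt (verit) zero_le_power2 real_sqrt_gt_zero)
  then show ?thesis unfolding smooth_excess_deriv_def[abs_def] by (intro continuous_intros) auto
qed

lemma smooth_excess_0: "smooth_excess k e 0 = 0"
  by (simp add: smooth_excess_def)

lemma smooth_excess_abs_le:
  assumes "e > 0" "k \<ge> 0" shows "\<bar>smooth_excess k e s\<bar> \<le> \<bar>s\<bar>"
  using field_differentiable_bound[of UNIV "smooth_excess k e" "smooth_excess_deriv k e" 1 s 0]
    smooth_excess_has_derivative[OF assms(1)] smooth_excess_deriv_bounds[OF assms] smooth_excess_0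
  by (auto simp: has_field_derivative_at_within)

lemma smooth_excess_tendsto:
  assumes "k \<ge> 0"
  shows "(\<lambda>n. \<bar>smooth_excess k (1 / real (Suc n)) s\<bar>) \<longlonglongrightarrow> excess k s"
proof -
  have z: "(\<lambda>n. 1 / real (Suc n)) \<longlonglongrightarrow> 0" using LIMSEQ_inverse_real_of_nat by (simp add: inverse_eq_divide)
  have "(\<lambda>n. s + (sqrt ((s - k)\<^sup>2 + 1 / real (Suc n)) - sqrt ((s + k)\<^sup>2 + 1 / real (Suc n))) / 2)
      \<longlonglongrightarrow> s + (sqrt ((s - k)\<^sup>2 + 0) - sqrt ((s + k)\<^sup>2 + 0)) / 2"
    by (intro tendsto_intros z) auto
  then have "(\<lambda>n. \<bar>smooth_excess k (1 / real (Suc n)) s\<bar>) \<longlonglongrightarrow> \<bar>s + (\<bar>s - k\<bar> - \<bar>s + k\<bar>) / 2\<bar>"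
    unfolding smooth_excess_def
    by (intro tendsto_rabs) (simp add: powr_half_sqrt add_nonneg_nonneg del: of_nat_Suc)
  also have "\<bar>s + (\<bar>s - k\<bar> - \<bar>s + k\<bar>) / 2\<bar> = excess k s"
    using assms unfolding excess_def by (auto simp: abs_if max_def)
  finally show ?thesis .
qed

text \<open>Testing with \<open>h(u)\<close> gives \<open>\<integral> h'(u) |\<nabla>u|^p = \<integral> f(x,u) h(u)\<close>, and \<open>0 \<le> h' \<le> 1\<close> implies \<open>h'^p \<le> h'\<close>, so the left side
  dominates the energy of the gradient of \<open>h(u)\<close>.\<close>

lemma weak_solution_test:
  fixes u :: "'a::euclidean_space \<Rightarrow> real"
  assumes O: "open \<Omega>" "bounded \<Omega>" and p: "p > 1" and ws: "weak_solution \<Omega> p f u"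
    and A: "smooth_approx \<Omega> p u (weak_gradient \<Omega> u) \<psi>"
    and h: "\<And>k. Ck k h" "h 0 = 0" "\<And>s. (h has_real_derivative h' s) (at s)" "\<And>s. 0 \<le> h' s" "\<And>s. h' s \<le> 1" "continuous_on UNIV h'"
  shows "lp_energy (lebesgue_on \<Omega>) p (\<lambda>x. h' (u x) *\<^sub>R weak_gradient \<Omega> u x)
     \<le> (\<integral>\<^sup>+x. ennreal (\<bar>f x (u x)\<bar> * \<bar>h (u x)\<bar>) \<partial>lebesgue_on \<Omega>)"
proof -
  let ?M = "lebesgue_on \<Omega>" let ?w = "weak_gradient \<Omega> u"
  have h'abs: "\<bar>h' s\<bar> \<le> 1" for s using h(4,5)[of s] by simp
  have L: "u \<in> lp_space ?M p" "?w \<in> lp_space ?M p" using A unfolding smooth_approx_def by auto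
  note B = smooth_approx_compose[OF O p A h(1,2,3) h'abs h(6)]
  note S = smooth_approx_sobolev_space0[OF O p B]
  have [measurable]: "h' \<in> borel_measurable borel" using h(6) by (rule borel_measurable_continuous_onI)
  have [measurable]: "u \<in> borel_measurable ?M" "?w \<in> borel_measurable ?M" using L by (auto simp: lp_space_iff)
  have [measurable]: "weak_gradient \<Omega> (\<lambda>x. h (u x)) \<in> borel_measurable ?M"
    by (rule borel_measurable_AE_lebesgue_on[OF O(1), of "\<lambda>x. h' (u x) *\<^sub>R ?w x"]) 
       (measurable, use S(2) in \<open>eventually_elim, simp\<close>)
  \<comment> \<open>Also correct where \<open>w\<close> vanishes, since \<open>0 powr p = 0\<close>.\<close>
  have pt: "(norm w powr (p - 2) *\<^sub>R w) \<bullet> (c *\<^sub>R w) = c * norm w powr p" for w :: 'a and c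
  proof (cases "w = 0")
    case False
    then have "norm w powr (p - 2) * (norm w)\<^sup>2 = norm w powr p"
      by (simp add: powr_diff)
    then show ?thesis by (simp add: power2_norm_eq_inner mult.assoc mult.left_commute)
  qed simp
  have int: "integrable ?M (\<lambda>x. h' (u x) * norm (?w x) powr p)"
  proof (rule Bochner_Integration.integrable_bound)
    show "integrable ?M (\<lambda>x. norm (?w x) powr p)" using L(2) by (simp add: lp_space_def)
    show "AE x in ?M. norm (h' (u x) * norm (?w x) powr p) \<le> norm (norm (?w x) powr p)"
      using h(4,5) by (intro AE_I2) (simp add: abs_mult mult_left_le_one_le)
  qed measurable
  have "(LINT x|?M. h' (u x) * norm (?w x) powr p) = (LINT x|?M. (norm (?w x) powr (p - 2) *\<^sub>R ?w x) \<bullet> weak_gradient \<Omega> (\<lambda>x. h (u x)) x)"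
  proof (rule integral_cong_AE)
    show "AE x in ?M. h' (u x) * norm (?w x) powr p = (norm (?w x) powr (p - 2) *\<^sub>R ?w x) \<bullet> weak_gradient \<Omega> (\<lambda>x. h (u x)) x"
      using S(2) by eventually_elim (simp only: pt)
  qed measurable
  also have "\<dots> = (LINT x|?M. f x (u x) * h (u x))"
    using ws S(1) unfolding weak_solution_def by blast
  finally have eq: "(LINT x|?M. h' (u x) * norm (?w x) powr p) = (LINT x|?M. f x (u x) * h (u x))" .
  have "lp_energy ?M p (\<lambda>x. h' (u x) *\<^sub>R ?w x) \<le> (\<integral>\<^sup>+x. ennreal (h' (u x) * norm (?w x) powr p) \<partial>?M)"
    unfolding lp_energy_def
  proof (intro nn_integral_mono ennreal_leI)
    fix x
    have "h' (u x) powr p \<le> h' (u x) powr 1"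
      using h(4,5)[of "u x"] p by (intro powr_mono') auto
    then have "h' (u x) powr p \<le> h' (u x)" using h(4)[of "u x"] by simp
    then show "norm (h' (u x) *\<^sub>R ?w x) powr p \<le> h' (u x) * norm (?w x) powr p"
      using h(4)[of "u x"] by (simp add: powr_mult mult_right_mono)
  qed
  also have "\<dots> = ennreal (LINT x|?M. h' (u x) * norm (?w x) powr p)"
    using h(4) by (intro nn_integral_eq_integral int AE_I2) simp
  also have "\<dots> = ennreal (LINT x|?M. f x (u x) * h (u x))" unfolding eq ..
  also have "\<dots> \<le> (\<integral>\<^sup>+x. ennreal (\<bar>f x (u x)\<bar> * \<bar>h (u x)\<bar>) \<partial>?M)"
  proof (cases "integrable ?M (\<lambda>x. f x (u x) * h (u x))")
    case True
    have "ennreal (LINT x|?M. f x (u x) * h (u x)) \<le> ennreal (norm (LINT x|?M. f x (u x) * h (u x)))"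
      by (intro ennreal_leI) simp
    also have "\<dots> \<le> (\<integral>\<^sup>+x. ennreal (norm (f x (u x) * h (u x))) \<partial>?M)"
      by (rule integral_norm_bound_ennreal[OF True])
    finally show ?thesis by (simp add: abs_mult)
  qed (simp add: not_integrable_integral_eq)
  finally show ?thesis .
qed

text \<open>The smooth truncations satisfy the inequality by the two preceding results; in the limit \<open>e \<rightarrow> 0\<close> no gradient is
  involved any more, so Fatou's lemma on the left and dominated convergence on the right suffice. The dominating
  function \<open>|f(x,u)| |u|\<close> is integrable because \<open>f(x,u)\<close> lies in the dual of \<open>L^q\<close>.\<close>

theorem weak_solution_excess_bound:
  fixes p :: real
  assumes p: "1 < p" "p < real DIM('a::euclidean_space)"
  defines "q \<equiv> sobolev_exp (real DIM('a)) p"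
  obtains S where "S > 0" "\<And>(\<Omega> :: 'a set) f u k.
    \<lbrakk>open \<Omega>; bounded \<Omega>; weak_solution \<Omega> p f u; 0 \<le> k\<rbrakk> \<Longrightarrow>
      u \<in> lp_space (lebesgue_on \<Omega>) q \<and>
      integrable (lebesgue_on \<Omega>) (\<lambda>x. \<bar>f x (u x)\<bar> * excess k (u x)) \<and>
      lp_energy (lebesgue_on \<Omega>) q (\<lambda>x. excess k (u x)) \<le>
        ennreal (S * (LINT x|lebesgue_on \<Omega>. \<bar>f x (u x)\<bar> * excess k (u x)) powr (q / p))"
proof -
  obtain S where S: "S > 0" "\<And>(\<Omega> :: 'a set) u g \<psi> D.
    \<lbrakk>open \<Omega>; bounded \<Omega>; smooth_approx \<Omega> p u g \<psi>; 0 \<le> D; lp_energy (lebesgue_on \<Omega>) p g \<le> ennreal D\<rbrakk> \<Longrightarrow>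
    lp_energy (lebesgue_on \<Omega>) q u \<le> ennreal (S * D powr (q / p))"
    unfolding q_def by (fact sobolev_inequality[OF p])
  have q: "q > 1" using p unfolding q_def sobolev_exp_def by (simp add: field_simps) (smt (verit) mult_less_cancel_right2)
  have p0: "p > 0" using p by simp
  define q' where "q' = conj_exp q"
  have q': "q' > 1" "1 / q + 1 / q' = 1" using q by (auto simp: q'_def conj_exp_def field_simps)
  show ?thesis
  proof (rule that[OF S(1)])
    fix \<Omega> :: "'a set" and f :: "'a \<Rightarrow> real \<Rightarrow> real" and u :: "'a \<Rightarrow> real" and k :: real
    assume O: "open \<Omega>" "bounded \<Omega>" and ws: "weak_solution \<Omega> p f u" and k: "0 \<le> k"
    let ?M = "lebesgue_on \<Omega>" let ?w = "weak_gradient \<Omega> u"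
    obtain \<psi> where A: "smooth_approx \<Omega> p u ?w \<psi>"
      by (rule sobolev_space0_smooth_approx[OF O p(1)]) (use ws in \<open>auto simp: weak_solution_def\<close>)
    have L: "u \<in> lp_space ?M p" "?w \<in> lp_space ?M p" using A unfolding smooth_approx_def by auto
    have fL: "(\<lambda>x. f x (u x)) \<in> lp_space ?M q'" using ws unfolding weak_solution_def q'_def q_def by auto
    have [measurable]: "u \<in> borel_measurable ?M" "(\<lambda>x. f x (u x)) \<in> borel_measurable ?M"
      using L fL by (auto simp: lp_space_iff)
    have "lp_energy ?M q u \<le> ennreal (S * (lp_norm ?M p ?w powr p) powr (q / p))"
      by (rule S(2)[OF O A]) (simp_all add: lp_energy_eq_norm[OF L(2) p0])
    then have uL: "u \<in> lp_space ?M q"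
      unfolding lp_space_iff by (auto intro: le_less_trans)
    have exm[measurable]: "excess k \<in> borel_measurable borel" unfolding excess_def[abs_def] by measurable
    have fu: "integrable ?M (\<lambda>x. \<bar>f x (u x)\<bar> * \<bar>u x\<bar>)"
    proof -
      have "(\<integral>\<^sup>+x. ennreal (\<bar>u x\<bar> * \<bar>f x (u x)\<bar>) \<partial>?M) \<le> ennreal ((lp_norm ?M q u powr q) powr (1 / q) * (lp_norm ?M q' (\<lambda>x. f x (u x)) powr q') powr (1 / q'))"
      proof (rule nn_integral_Hoelder)
        show "(\<integral>\<^sup>+x. ennreal (\<bar>u x\<bar> powr q) \<partial>?M) \<le> ennreal (lp_norm ?M q u powr q)"
          using lp_energy_eq_norm[OF uL] q by (simp add: lp_energy_def)
        show "(\<integral>\<^sup>+x. ennreal (\<bar>f x (u x)\<bar> powr q') \<partial>?M) \<le> ennreal (lp_norm ?M q' (\<lambda>x. f x (u x)) powr q')"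
          using lp_energy_eq_norm[OF fL] q' by (simp add: lp_energy_def)
      qed (use q q' in auto)
      then show ?thesis
        by (intro integrableI_bounded) (auto simp: abs_mult mult.commute intro: le_less_trans)
    qed
    have ex: "0 \<le> excess k s" "excess k s \<le> \<bar>s\<bar>" for s using k by (auto simp: excess_def)
    have fe: "integrable ?M (\<lambda>x. \<bar>f x (u x)\<bar> * excess k (u x))"
      by (rule Bochner_Integration.integrable_bound[OF fu]) (auto intro!: AE_I2 mult_left_mono simp: ex abs_mult)
    define e where "e n = 1 / real (Suc n)" for n
    have e: "e n > 0" for n by (simp add: e_def)
    define h where "h n = smooth_excess k (e n)" for n
    have hc: "continuous_on UNIV (h n)" for n unfolding h_def by (rule Ck_continuous[OF Ck_smooth_excess[OF e, where n=0]])
    have [measurable]: "h n \<in> borel_measurable borel" for n using hc by (rule borel_measurable_continuous_onI)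
    have hle: "\<bar>h n s\<bar> \<le> \<bar>s\<bar>" for n s unfolding h_def by (rule smooth_excess_abs_le[OF e k])
    have hlim: "(\<lambda>n. \<bar>h n s\<bar>) \<longlonglongrightarrow> excess k s" for s
      unfolding h_def e_def by (rule smooth_excess_tendsto[OF k])
    define d where "d n = (LINT x|?M. \<bar>f x (u x)\<bar> * \<bar>h n (u x)\<bar>)" for n
    have fh: "integrable ?M (\<lambda>x. \<bar>f x (u x)\<bar> * \<bar>h n (u x)\<bar>)" for n
      by (rule Bochner_Integration.integrable_bound[OF fu]) (auto intro!: AE_I2 mult_left_mono simp: hle abs_mult)
    have d0: "d n \<ge> 0" for n unfolding d_def by (intro Bochner_Integration.integral_nonneg) auto
    have dlim: "d \<longlonglongrightarrow> (LINT x|?M. \<bar>f x (u x)\<bar> * excess k (u x))"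
      unfolding d_def
      by (rule integral_dominated_convergence[where w="\<lambda>x. \<bar>f x (u x)\<bar> * \<bar>u x\<bar>"])
         (auto intro!: AE_I2 fu tendsto_mult tendsto_const hlim mult_left_mono hle simp: abs_mult)
    have b: "lp_energy ?M q (\<lambda>x. h n (u x)) \<le> ennreal (S * d n powr (q / p))" for n
    proof -
      have ab: "\<bar>smooth_excess_deriv k (e n) s\<bar> \<le> 1" for s using smooth_excess_deriv_bounds[OF e k, of n s] by simp
      note B = smooth_approx_compose[OF O p(1) A Ck_smooth_excess[OF e] smooth_excess_0 smooth_excess_has_derivative[OF e] ab continuous_smooth_excess_deriv[OF e]]
      have "lp_energy ?M p (\<lambda>x. smooth_excess_deriv k (e n) (u x) *\<^sub>R ?w x) \<le> (\<integral>\<^sup>+x. ennreal (\<bar>f x (u x)\<bar> * \<bar>smooth_excess k (e n) (u x)\<bar>) \<partial>?M)"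
        by (rule weak_solution_test[OF O p(1) ws A Ck_smooth_excess[OF e] smooth_excess_0 smooth_excess_has_derivative[OF e]
              smooth_excess_deriv_bounds[OF e k] continuous_smooth_excess_deriv[OF e]])
      also have "\<dots> = ennreal (d n)"
        unfolding d_def h_def[symmetric] by (intro nn_integral_eq_integral fh AE_I2) simp
      finally show ?thesis unfolding h_def by (rule S(2)[OF O B d0])
    qed
    have "lp_energy ?M q (\<lambda>x. excess k (u x)) = (\<integral>\<^sup>+x. liminf (\<lambda>n. ennreal (norm (h n (u x)) powr q)) \<partial>?M)"
      unfolding lp_energy_def
    proof (rule nn_integral_cong)
      fix x
      have "(\<lambda>n. ennreal (norm (h n (u x)) powr q)) \<longlonglongrightarrow> ennreal (norm (excess k (u x)) powr q)"
        using hlim[of "u x"] ex(1)[of "u x"] q by (intro tendsto_ennrealI tendsto_powr2 tendsto_const) auto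
      then show "ennreal (norm (excess k (u x)) powr q) = liminf (\<lambda>n. ennreal (norm (h n (u x)) powr q))"
        by (rule lim_imp_Liminf[OF trivial_limit_sequentially, symmetric])
    qed
    also have "\<dots> \<le> liminf (\<lambda>n. lp_energy ?M q (\<lambda>x. h n (u x)))"
      unfolding lp_energy_def by (rule nn_integral_liminf) measurable
    also have "\<dots> \<le> liminf (\<lambda>n. ennreal (S * d n powr (q / p)))"
      by (intro Liminf_mono always_eventually allI b)
    also have "\<dots> = ennreal (S * (LINT x|?M. \<bar>f x (u x)\<bar> * excess k (u x)) powr (q / p))"
      using q p0 d0 by (intro lim_imp_Liminf tendsto_ennrealI tendsto_mult tendsto_const tendsto_powr2 dlim) auto
    finally show "u \<in> lp_space ?M q \<and> integrable ?M (\<lambda>x. \<bar>f x (u x)\<bar> * excess k (u x)) \<and>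
      lp_energy ?M q (\<lambda>x. excess k (u x)) \<le> ennreal (S * (LINT x|?M. \<bar>f x (u x)\<bar> * excess k (u x)) powr (q / p))"
      using uL fe by blast
  qed
qed

section \<open>Decay of level sets\<close>

text \<open>Along the levels \<open>k0 + d (1 - 2^(-n))\<close> the step inequality gains more by the power \<open>\<gamma> > 1\<close> than it loses by the shrinking
  distances, and \<open>\<phi>\<close> decays geometrically once it starts small enough. The rate \<open>2^(-n/(\<gamma>-1))\<close> is the one that the
  recursion reproduces.\<close>

lemma stampacchia_iteration:
  fixes \<phi> :: "real \<Rightarrow> real"
  assumes \<gamma>: "\<gamma> > 1" and K: "K \<ge> 0" and d: "d > 0"
    and nn: "\<And>k. 0 \<le> \<phi> k" and anti: "\<And>k l. k0 \<le> k \<Longrightarrow> k \<le> l \<Longrightarrow> \<phi> l \<le> \<phi> k"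
    and step: "\<And>k l. k0 \<le> k \<Longrightarrow> k < l \<Longrightarrow> l \<le> k0 + d \<Longrightarrow> (l - k) * \<phi> l \<le> K * \<phi> k powr \<gamma>"
    and start: "2 powr (\<gamma> / (\<gamma> - 1)) * K * \<phi> k0 powr (\<gamma> - 1) \<le> d"
  shows "\<phi> (k0 + d) = 0"
proof -
  define \<beta> where "\<beta> = 1 / (\<gamma> - 1)"
  have \<beta>: "\<beta> > 0" "\<gamma> / (\<gamma> - 1) = 1 + \<beta>" "\<gamma> * \<beta> = 1 + \<beta>" using \<gamma> by (auto simp: \<beta>_def field_simps)
  define k where "k n = k0 + d * (1 - 1 / 2 ^ n)" for n :: nat
  have k: "k0 \<le> k n" "k n < k (Suc n)" "k (Suc n) - k n = d / 2 ^ Suc n" "k n \<le> k0 + d" for n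
    using d by (auto simp: k_def field_simps)
  have \<phi>0: "K * \<phi> k0 powr \<gamma> \<le> d * 2 powr (- (1 + \<beta>)) * \<phi> k0"
  proof (cases "\<phi> k0 = 0")
    case False
    then have pos: "\<phi> k0 > 0" using nn[of k0] by simp
    have "\<phi> k0 powr \<gamma> = \<phi> k0 powr (\<gamma> - 1) * \<phi> k0" using pos by (simp add: powr_diff)
    moreover have "K * \<phi> k0 powr (\<gamma> - 1) \<le> d * 2 powr (- (1 + \<beta>))"
      using start unfolding \<beta>(2) by (subst powr_minus) (simp add: field_simps)
    ultimately show ?thesis using pos by (simp add: mult.assoc[symmetric])
  qed (use \<gamma> in simp)
  have ind: "\<phi> (k n) \<le> \<phi> k0 * 2 powr (- (real n * \<beta>))" for n
  proof (induction n)
    case 0 then show ?case by (simp add: k_def)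
  next
    case (Suc n)
    have "d / 2 ^ Suc n * \<phi> (k (Suc n)) \<le> K * \<phi> (k n) powr \<gamma>"
      using step[OF k(1) k(2) k(4)] unfolding k(3) .
    also have "\<dots> \<le> K * (\<phi> k0 * 2 powr (- (real n * \<beta>))) powr \<gamma>"
      using Suc.IH nn \<gamma> K by (intro mult_left_mono powr_mono2) auto
    also have "\<dots> = (K * \<phi> k0 powr \<gamma>) * 2 powr (- (real n * (1 + \<beta>)))"
      using nn \<beta>(3) by (simp add: powr_mult powr_powr mult.assoc mult.commute[of \<beta> \<gamma>])
    also have "\<dots> \<le> (d * 2 powr (- (1 + \<beta>)) * \<phi> k0) * 2 powr (- (real n * (1 + \<beta>)))"
      by (intro mult_right_mono \<phi>0) auto
    also have "\<dots> = d * (\<phi> k0 * (2 powr (- (1 + \<beta>)) * 2 powr (- (real n * (1 + \<beta>)))))" by simp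
    also have "2 powr (- (1 + \<beta>)) * 2 powr (- (real n * (1 + \<beta>))) = 2 powr (- (real (Suc n) * \<beta>)) / 2 ^ Suc n"
    proof -
      have "(2::real) ^ Suc n = 2 powr real (Suc n)" by (subst powr_realpow) auto
      then show ?thesis
        by (simp only: powr_add[symmetric] powr_diff[symmetric])
           (rule arg_cong[where f="\<lambda>t. 2 powr t"], simp add: algebra_simps)
    qed
    finally have "d / 2 ^ Suc n * \<phi> (k (Suc n)) \<le> d / 2 ^ Suc n * (\<phi> k0 * 2 powr (- (real (Suc n) * \<beta>)))"
      by simp
    then show ?case using d by (subst (asm) mult_le_cancel_left_pos) auto
  qed
  have "(\<lambda>n. \<phi> k0 * 2 powr (- (real n * \<beta>))) \<longlonglongrightarrow> 0"
    using \<beta>(1) by real_asymp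
  moreover have "\<phi> (k0 + d) \<le> \<phi> k0 * 2 powr (- (real n * \<beta>))" for n
    using anti[OF k(1) k(4)] ind by (rule order_trans)
  ultimately have "\<phi> (k0 + d) \<le> 0" by (intro LIMSEQ_le_const) auto
  then show ?thesis using nn[of "k0 + d"] by simp
qed

text \<open>The \<open>q\<close>-th root makes Chebyshev's inequality and the iteration homogeneous of degree one.\<close>

definition level_size :: "'a measure \<Rightarrow> real \<Rightarrow> ('a \<Rightarrow> real) \<Rightarrow> real \<Rightarrow> real" where
  "level_size M q u k = measure M {x \<in> space M. k < \<bar>u x\<bar>} powr (1 / q)"

definition excess_norm :: "'a measure \<Rightarrow> real \<Rightarrow> ('a \<Rightarrow> real) \<Rightarrow> real \<Rightarrow> real" where
  "excess_norm M q u k = lp_norm M q (\<lambda>x. excess k (u x))"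

lemma excess_nonneg: "0 \<le> excess k s"
  by (simp add: excess_def)

lemma excess_measurable[measurable]: "excess k \<in> borel_measurable borel"
  unfolding excess_def[abs_def] by measurable

lemma excess_lp_space:
  assumes "u \<in> lp_space M q" "0 \<le> k" "q > 0"
  shows "(\<lambda>x. excess k (u x)) \<in> lp_space M q"
proof -
  have [measurable]: "u \<in> borel_measurable M" using assms(1) by (simp add: lp_space_iff)
  have "lp_energy M q (\<lambda>x. excess k (u x)) \<le> lp_energy M q u"
    using assms by (intro lp_energy_mono) (auto simp: excess_def)
  then show ?thesis using assms(1) unfolding lp_space_iff by (auto intro: le_less_trans)
qed

lemma level_size_nonneg: "0 \<le> level_size M q u k"
  by (simp add: level_size_def)

lemma excess_norm_nonneg: "0 \<le> excess_norm M q u k"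
  by (simp add: excess_norm_def lp_norm_nonneg)

lemma level_size_antimono:
  assumes "finite_measure M" "u \<in> borel_measurable M" "k \<le> l" "q > 0"
  shows "level_size M q u l \<le> level_size M q u k"
proof -
  interpret finite_measure M by fact
  note [measurable] = assms(2)
  have "measure M {x \<in> space M. l < \<bar>u x\<bar>} \<le> measure M {x \<in> space M. k < \<bar>u x\<bar>}"
    using assms(3) by (intro finite_measure_mono) auto
  then show ?thesis unfolding level_size_def using assms(4) by (intro powr_mono2) auto
qed

text \<open>Chebyshev's inequality: the excess over \<open>k\<close> is at least \<open>l - k\<close> where \<open>|u| > l\<close>.\<close>

lemma level_size_le_excess_norm:
  assumes "finite_measure M" "u \<in> lp_space M q" "0 \<le> k" "k < l" "q > 0"
  shows "(l - k) * level_size M q u l \<le> excess_norm M q u k"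
proof -
  interpret finite_measure M by fact
  have [measurable]: "u \<in> borel_measurable M" using assms(2) by (simp add: lp_space_iff)
  let ?A = "{x \<in> space M. l < \<bar>u x\<bar>}"
  have "ennreal ((l - k) powr q * measure M ?A) = (\<integral>\<^sup>+x. ennreal ((l - k) powr q) * indicator ?A x \<partial>M)"
    by (subst nn_integral_cmult_indicator) (auto simp: emeasure_eq_measure ennreal_mult')
  also have "\<dots> \<le> lp_energy M q (\<lambda>x. excess k (u x))"
    unfolding lp_energy_def
  proof (intro nn_integral_mono)
    fix x
    show "ennreal ((l - k) powr q) * indicator ?A x \<le> ennreal (norm (excess k (u x)) powr q)"
      using assms(4,5) by (auto simp: indicator_def excess_def intro!: ennreal_leI powr_mono2)
  qed
  also have "\<dots> = ennreal (excess_norm M q u k powr q)"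
    unfolding excess_norm_def by (rule lp_energy_eq_norm[OF excess_lp_space[OF assms(2,3,5)] assms(5)])
  finally have "(l - k) powr q * measure M ?A \<le> excess_norm M q u k powr q" by simp
  then have "((l - k) powr q * measure M ?A) powr (1 / q) \<le> (excess_norm M q u k powr q) powr (1 / q)"
    using assms(5) by (intro powr_mono2) auto
  also have "((l - k) powr q * measure M ?A) powr (1 / q) = (l - k) * level_size M q u l"
    unfolding level_size_def using assms(4,5) by (subst powr_mult) (auto simp: powr_powr)
  finally show ?thesis using assms(5) by (simp add: powr_powr excess_norm_nonneg)
qed

lemma excess_norm_tendsto_0:
  assumes "u \<in> lp_space M q" "q > 0"
  shows "(excess_norm M q u \<longlongrightarrow> 0) at_top"
proof (rule tendsto_at_topI_sequentially)
  fix X :: "nat \<Rightarrow> real" assume X: "filterlim X at_top sequentially"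
  have um[measurable]: "u \<in> borel_measurable M" using assms(1) by (simp add: lp_space_iff)
  have "(\<lambda>n. LINT x|M. norm (excess (max 0 (X n)) (u x)) powr q) \<longlonglongrightarrow> (LINT x|M. 0)"
  proof (rule integral_dominated_convergence[where w="\<lambda>x. norm (u x) powr q"])
    show "integrable M (\<lambda>x. norm (u x) powr q)" using assms(1) by (simp add: lp_space_def)
    show "AE x in M. (\<lambda>n. norm (excess (max 0 (X n)) (u x)) powr q) \<longlonglongrightarrow> 0"
    proof (intro AE_I2 tendsto_eventually)
      fix x
      have "eventually (\<lambda>n. \<bar>u x\<bar> \<le> X n) sequentially" using X by (simp add: filterlim_at_top)
      then show "\<forall>\<^sub>F n in sequentially. norm (excess (max 0 (X n)) (u x)) powr q = 0"
        by eventually_elim (simp add: excess_def)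
    qed
    show "AE x in M. norm (norm (excess (max 0 (X n)) (u x)) powr q) \<le> norm (u x) powr q" for n
      using assms(2) by (intro AE_I2) (auto intro!: powr_mono2 simp: excess_def)
  qed measurable
  then have "(\<lambda>n. (LINT x|M. norm (excess (max 0 (X n)) (u x)) powr q) powr (1 / q)) \<longlonglongrightarrow> 0 powr (1 / q)"
    using assms(2) by (intro tendsto_powr2 tendsto_const) (auto intro!: always_eventually)
  then have lim: "(\<lambda>n. excess_norm M q u (max 0 (X n))) \<longlonglongrightarrow> 0" by (simp add: excess_norm_def lp_norm_def)
  have "eventually (\<lambda>n. 0 \<le> X n) sequentially" using X by (simp add: filterlim_at_top)
  then have "\<forall>\<^sub>F n in sequentially. excess_norm M q u (max 0 (X n)) = excess_norm M q u (X n)"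
    by eventually_elim (simp add: max_def)
  then show "(\<lambda>n. excess_norm M q u (X n)) \<longlonglongrightarrow> 0" by (rule Lim_transform_eventually[OF lim])
qed

text \<open>The exponent \<open>q (1 - 1/r)\<close> is chosen such that Hoelder's inequality with \<open>r\<close> and its conjugate returns the \<open>L^q\<close> norm.\<close>

lemma nn_integral_excess_power:
  fixes r q :: real
  assumes u: "u \<in> lp_space M q" "0 \<le> k" and a: "a \<in> lp_space M r" and r: "1 < r" and q: "0 < q"
  shows "(\<integral>\<^sup>+x. ennreal (\<bar>a x :: real\<bar> * excess k (u x) powr (q * (1 - 1 / r))) \<partial>M)
     \<le> ennreal (lp_norm M r a * excess_norm M q u k powr (q * (1 - 1 / r)))"
proof -
  define r' where "r' = r / (r - 1)"
  have r': "1 < r'" "1 / r + 1 / r' = 1" "1 - 1 / r = 1 / r'" using r by (auto simp: r'_def field_simps)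
  have [measurable]: "u \<in> borel_measurable M" "a \<in> borel_measurable M" using u(1) a by (simp_all add: lp_space_iff)
  have e: "excess_norm M q u k \<ge> 0" by (rule excess_norm_nonneg)
  have "(\<integral>\<^sup>+x. ennreal (\<bar>a x\<bar> * excess k (u x) powr (q / r')) \<partial>M)
     \<le> ennreal ((lp_norm M r a powr r) powr (1 / r) * (excess_norm M q u k powr q) powr (1 / r'))"
  proof (rule nn_integral_Hoelder)
    show "(\<integral>\<^sup>+x. ennreal (\<bar>a x\<bar> powr r) \<partial>M) \<le> ennreal (lp_norm M r a powr r)"
      using lp_energy_eq_norm[OF a] r by (simp add: lp_energy_def)
    show "(\<integral>\<^sup>+x. ennreal ((excess k (u x) powr (q / r')) powr r') \<partial>M) \<le> ennreal (excess_norm M q u k powr q)"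
      using lp_energy_eq_norm[OF excess_lp_space[OF u q] q] r' by (simp add: lp_energy_def powr_powr excess_norm_def excess_nonneg)
  qed (use r r' in auto)
  then show ?thesis using r r' by (simp add: powr_powr lp_norm_nonneg e)
qed

text \<open>Hoelder's inequality with the three exponents \<open>r\<close>, \<open>q\<close> and the remaining one, in two steps; the excess vanishes off the
  level set, which contributes the power of its measure.\<close>

lemma nn_integral_excess:
  fixes r q :: real
  assumes fin: "finite_measure M" and u: "u \<in> lp_space M q" "0 \<le> k" and a: "a \<in> lp_space M r" and r: "1 < r" and q: "1 < q * (1 - 1 / r)"
  shows "(\<integral>\<^sup>+x. ennreal (\<bar>a x :: real\<bar> * excess k (u x)) \<partial>M)
     \<le> ennreal (lp_norm M r a * (excess_norm M q u k * level_size M q u k powr (q * (1 - 1 / r) - 1)))"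
proof -
  interpret finite_measure M by fact
  define r' where "r' = r / (r - 1)"
  have r': "1 < r'" "1 / r + 1 / r' = 1" "1 - 1 / r = 1 / r'" using r by (auto simp: r'_def field_simps)
  define m where "m = q / r'"
  have m: "m > 1" "m * r' = q" "q > 0" using q r' by (auto simp: m_def)
  define m' where "m' = m / (m - 1)"
  have m': "1 < m'" "1 / m + 1 / m' = 1" "1 / m' = 1 - 1 / m" using m by (auto simp: m'_def field_simps)
  have um[measurable]: "u \<in> borel_measurable M" "a \<in> borel_measurable M" using u(1) a by (simp_all add: lp_space_iff)
  let ?A = "{x \<in> space M. k < \<bar>u x\<bar>}"
  define y where "y = excess_norm M q u k"
  have y: "y \<ge> 0" by (simp add: y_def excess_norm_nonneg)
  let ?Y = "(y powr q) powr (1 / m) * measure M ?A powr (1 / m')"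
  have 1: "(\<integral>\<^sup>+x. ennreal (excess k (u x) powr r' * indicator ?A x) \<partial>M) \<le> ennreal ?Y"
  proof (rule nn_integral_Hoelder)
    show "(\<integral>\<^sup>+x. ennreal ((excess k (u x) powr r') powr m) \<partial>M) \<le> ennreal (y powr q)"
      using lp_energy_eq_norm[OF excess_lp_space[OF u m(3)] m(3)] m(2)
      by (simp add: lp_energy_def powr_powr y_def excess_norm_def excess_nonneg mult.commute)
    have "(\<integral>\<^sup>+x. ennreal (indicator ?A x powr m') \<partial>M) = (\<integral>\<^sup>+x. indicator ?A x \<partial>M)"
      by (intro nn_integral_cong) (simp add: indicator_def)
    then show "(\<integral>\<^sup>+x. ennreal (indicator ?A x powr m') \<partial>M) \<le> ennreal (measure M ?A)"
      by (simp add: emeasure_eq_measure)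
  qed (use m m' in auto)
  have 2: "(\<integral>\<^sup>+x. ennreal (excess k (u x) powr r') \<partial>M) \<le> ennreal ?Y"
  proof -
    have "(\<integral>\<^sup>+x. ennreal (excess k (u x) powr r') \<partial>M) = (\<integral>\<^sup>+x. ennreal (excess k (u x) powr r' * indicator ?A x) \<partial>M)"
      by (intro nn_integral_cong) (auto simp: indicator_def excess_def)
    then show ?thesis using 1 by simp
  qed
  have "(\<integral>\<^sup>+x. ennreal (\<bar>a x\<bar> * excess k (u x)) \<partial>M)
     \<le> ennreal ((lp_norm M r a powr r) powr (1 / r) * ?Y powr (1 / r'))"
  proof (rule nn_integral_Hoelder)
    show "(\<integral>\<^sup>+x. ennreal (\<bar>a x\<bar> powr r) \<partial>M) \<le> ennreal (lp_norm M r a powr r)"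
      using lp_energy_eq_norm[OF a] r by (simp add: lp_energy_def)
    show "(\<integral>\<^sup>+x. ennreal (excess k (u x) powr r') \<partial>M) \<le> ennreal ?Y" by (rule 2)
  qed (use r r' in \<open>auto simp: excess_nonneg\<close>)
  also have "(lp_norm M r a powr r) powr (1 / r) = lp_norm M r a" using r by (simp add: powr_powr lp_norm_nonneg)
  also have "?Y powr (1 / r') = y * level_size M q u k powr (m - 1)"
  proof -
    have "q / m / r' = 1" using m(1) r'(1) unfolding m(2)[symmetric] by (simp add: field_simps)
    moreover have "1 / m' / r' = 1 / q * (m - 1)" using m(1) r'(1) unfolding m'(3) m(2)[symmetric] by (simp add: field_simps)
    ultimately show ?thesis
      unfolding level_size_def using y by (subst powr_mult) (auto simp: powr_powr)
  qed
  also have "m = q * (1 - 1 / r)" using r'(3) by (simp add: m_def)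
  finally show ?thesis unfolding y_def .
qed

lemma powr_root_le:
  fixes y :: real
  assumes "0 \<le> y" "0 \<le> c" "y powr p \<le> c * y" "p > 1"
  shows "y \<le> c powr (1 / (p - 1))"
proof (cases "y = 0")
  case False
  then have y: "y > 0" using assms by simp
  then have "y powr (p - 1) * y \<le> c * y" using assms by (simp add: powr_diff)
  then have "y powr (p - 1) \<le> c" using y by simp
  then have "(y powr (p - 1)) powr (1 / (p - 1)) \<le> c powr (1 / (p - 1))" using assms by (intro powr_mono2) auto
  then show ?thesis using y assms(4) by (simp add: powr_powr)
qed simp

lemma excess_norm_powr_le:
  assumes "u \<in> lp_space M q" "0 \<le> k" "q > 0" "p > 0" "S > 0" "0 \<le> c"
    and "integrable M (\<lambda>x. \<bar>g x\<bar> * excess k (u x))"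
    and "lp_energy M q (\<lambda>x. excess k (u x)) \<le> ennreal (S * (LINT x|M. \<bar>g x\<bar> * excess k (u x)) powr (q / p))"
    and "(\<integral>\<^sup>+x. ennreal (\<bar>g x\<bar> * excess k (u x)) \<partial>M) \<le> ennreal c"
  shows "excess_norm M q u k powr p \<le> S powr (p / q) * c"
proof -
  define D where "D = (LINT x|M. \<bar>g x\<bar> * excess k (u x))"
  have D: "0 \<le> D" unfolding D_def by (intro Bochner_Integration.integral_nonneg) (simp add: excess_nonneg)
  have "ennreal D \<le> ennreal c"
    using nn_integral_eq_integral[OF assms(7)] assms(9) by (simp add: D_def excess_nonneg)
  then have Dc: "D \<le> c" using assms(6) by simp
  have "ennreal (excess_norm M q u k powr q) \<le> ennreal (S * D powr (q / p))"
    using assms(8) lp_energy_eq_norm[OF excess_lp_space[OF assms(1,2,3)] assms(3)] by (simp add: excess_norm_def D_def)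
  then have "excess_norm M q u k powr q \<le> S * D powr (q / p)" using assms(5) by (subst (asm) ennreal_le_iff) auto
  then have "(excess_norm M q u k powr q) powr (p / q) \<le> (S * D powr (q / p)) powr (p / q)"
    using assms by (intro powr_mono2) auto
  also have "\<dots> = S powr (p / q) * D" using assms(3,4) D by (subst powr_mult) (auto simp: powr_powr)
  also have "\<dots> \<le> S powr (p / q) * c" using Dc by (intro mult_left_mono) auto
  finally show ?thesis using assms(3) by (simp add: powr_powr)
qed

lemma level_size_eq_0D:
  assumes "finite_measure M" "u \<in> borel_measurable M" "q > 0" "level_size M q u k = 0"
  shows "AE x in M. \<bar>u x\<bar> \<le> k"
proof -
  interpret finite_measure M by fact
  note [measurable] = assms(2)
  have "measure M {x \<in> space M. k < \<bar>u x\<bar>} = 0" using assms(3,4) unfolding level_size_def by simp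
  then have "AE x in M. \<not> (k < \<bar>u x\<bar>)"
    by (subst AE_iff_measurable[OF _ refl]) (auto simp: emeasure_eq_measure)
  then show ?thesis by eventually_elim simp
qed

text \<open>Combined with Chebyshev's inequality, a superlinear bound of the excess by the size of the level set is the step of
  Stampacchia's iteration.\<close>

lemma bounded_if_excess_norm_decay:
  assumes fin: "finite_measure M" and u: "u \<in> lp_space M q" and q: "0 < q" and \<gamma>: "1 < \<gamma>" and "0 \<le> K" "0 < d" "0 \<le> k0"
    and decay: "\<And>k. k0 \<le> k \<Longrightarrow> k \<le> k0 + d \<Longrightarrow> excess_norm M q u k \<le> K * level_size M q u k powr \<gamma>"
    and start: "2 powr (\<gamma> / (\<gamma> - 1)) * K * level_size M q u k0 powr (\<gamma> - 1) \<le> d"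
  shows "AE x in M. \<bar>u x\<bar> \<le> k0 + d"
proof (rule level_size_eq_0D[OF fin _ q])
  show um: "u \<in> borel_measurable M" using u by (simp add: lp_space_iff)
  show "level_size M q u (k0 + d) = 0"
  proof (rule stampacchia_iteration[OF \<gamma> assms(5,6)])
    show "level_size M q u l \<le> level_size M q u k" if "k \<le> l" for k l
      by (rule level_size_antimono[OF fin um that q])
    show "(l - k) * level_size M q u l \<le> K * level_size M q u k powr \<gamma>" if kl: "k0 \<le> k" "k < l" "l \<le> k0 + d" for k l
    proof -
      have "(l - k) * level_size M q u l \<le> excess_norm M q u k"
        by (rule level_size_le_excess_norm[OF fin u]) (use kl assms(7) q in auto)
      also have "\<dots> \<le> K * level_size M q u k powr \<gamma>" by (rule decay) (use kl in auto)
      finally show ?thesis .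
    qed
  qed (use start in \<open>auto simp: level_size_nonneg\<close>)
qed

lemma pos_if_conjugate_multiple_gt:
  fixes p q r :: real
  assumes "0 < p" "1 < r" "p < q * (1 - 1 / r)" shows "0 < q"
proof (rule ccontr)
  assume "\<not> 0 < q"
  then have "q * (1 - 1 / r) \<le> 0" using assms by (intro mult_nonpos_nonneg) auto
  then show False using assms by simp
qed

text \<open>Above the level \<open>k\<close> one has \<open>|u| = k + excess k u\<close>, so the growth \<open>|u|^(m-1)\<close> splits into a constant part, treated as a
  bounded coefficient, and a part that contributes the \<open>m\<close>-th power of the excess norm. For high levels that norm is
  small, and as \<open>m > p\<close> the second part is absorbed on the left. The iteration runs from \<open>k\<close> to \<open>2k\<close>; its starting condition
  holds for large \<open>k\<close> because \<open>k\<close> times the level size tends to \<open>0\<close>.\<close>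

theorem critical_growth_bounded:
  fixes p q r :: real and M :: "'a measure" and u a g :: "'a \<Rightarrow> real"
  defines "m \<equiv> q * (1 - 1 / r)"
  assumes fin: "finite_measure M" and p: "1 < p" and r: "1 < r" and m: "p < m" and S: "S > 0"
    and u: "u \<in> lp_space M q" and a: "a \<in> lp_space M r"
    and int: "\<And>k. 0 \<le> k \<Longrightarrow> integrable M (\<lambda>x. \<bar>g x\<bar> * excess k (u x))"
    and energy: "\<And>k. 0 \<le> k \<Longrightarrow> lp_energy M q (\<lambda>x. excess k (u x)) \<le> ennreal (S * (LINT x|M. \<bar>g x\<bar> * excess k (u x)) powr (q / p))"
    and growth: "AE x in M. R \<le> \<bar>u x\<bar> \<longrightarrow> \<bar>g x\<bar> \<le> \<bar>a x\<bar> * \<bar>u x\<bar> powr (m - 1)"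
  obtains k where "0 < k" "AE x in M. \<bar>u x\<bar> \<le> k"
proof -
  interpret finite_measure M by fact
  have [measurable]: "u \<in> borel_measurable M" "a \<in> borel_measurable M" using u a by (simp_all add: lp_space_iff)
  have q: "q > 0" using pos_if_conjugate_multiple_gt[of p r q] p r m by (simp add: m_def)
  have m1: "m > 1" using m p by simp
  define y where "y k = excess_norm M q u k" for k
  define \<phi> where "\<phi> k = level_size M q u k" for k
  have y0: "0 \<le> y k" and \<phi>0: "0 \<le> \<phi> k" for k by (simp_all add: y_def \<phi>_def excess_norm_nonneg level_size_nonneg)
  define \<alpha> where "\<alpha> = lp_norm M r a"
  have \<alpha>0: "\<alpha> \<ge> 0" by (simp add: \<alpha>_def lp_norm_nonneg)
  define T where "T = S powr (p / q) * 2 powr (m - 1) * \<alpha>"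
  have T0: "T \<ge> 0" using \<alpha>0 by (simp add: T_def)
  \<comment> \<open>Both parts of the split, before absorption.\<close>
  have est: "y k powr p \<le> T * (k powr (m - 1) * (y k * \<phi> k powr (m - 1)) + y k powr m)" if k: "0 \<le> k" "R \<le> k" for k
  proof -
  let ?c = "2 powr (m - 1) * k powr (m - 1)"
  let ?R = "\<lambda>x. ennreal ?c * ennreal (\<bar>a x\<bar> * excess k (u x)) + ennreal (2 powr (m - 1)) * ennreal (\<bar>a x\<bar> * excess k (u x) powr m)"
  let ?E = "k powr (m - 1) * (y k * \<phi> k powr (m - 1)) + y k powr m"
    have "(\<integral>\<^sup>+x. ennreal (\<bar>g x\<bar> * excess k (u x)) \<partial>M)
      \<le> (\<integral>\<^sup>+x. ?R x \<partial>M)"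
    proof (intro nn_integral_mono_AE)
      show "AE x in M. ennreal (\<bar>g x\<bar> * excess k (u x)) \<le> ?R x"
        using growth
      proof eventually_elim
        fix x assume gr: "R \<le> \<bar>u x\<bar> \<longrightarrow> \<bar>g x\<bar> \<le> \<bar>a x\<bar> * \<bar>u x\<bar> powr (m - 1)"
        define s where "s = excess k (u x)"
        have s0: "s \<ge> 0" by (simp add: s_def excess_nonneg)
        have "\<bar>g x\<bar> * s \<le> ?c * (\<bar>a x\<bar> * s) + 2 powr (m - 1) * (\<bar>a x\<bar> * s powr m)"
        proof (cases "s = 0")
          case False
          then have s: "s > 0" using s0 by simp
          then have us: "\<bar>u x\<bar> = k + s" by (simp add: s_def excess_def max_def split: if_splits)
          have "\<bar>g x\<bar> * s \<le> \<bar>a x\<bar> * (k + s) powr (m - 1) * s"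
            using gr us k(2) s by (intro mult_right_mono) auto
          also have "\<dots> \<le> \<bar>a x\<bar> * (2 powr (m - 1) * (k powr (m - 1) + s powr (m - 1))) * s"
            using norm_add_powr_le[of "m - 1" k s] m1 k(1) s by (intro mult_right_mono mult_left_mono) auto
          also have "\<dots> = ?c * (\<bar>a x\<bar> * s) + 2 powr (m - 1) * (\<bar>a x\<bar> * (s powr (m - 1) * s))"
            by (simp add: algebra_simps)
          also have "s powr (m - 1) * s = s powr m" using s by (simp add: powr_diff)
          finally show ?thesis .
        qed simp
        then show "ennreal (\<bar>g x\<bar> * excess k (u x)) \<le> ?R x"
          unfolding s_def[symmetric] using s0
          by (subst (1 2) ennreal_mult'[symmetric]) (auto simp: ennreal_plus[symmetric] simp del: ennreal_plus intro!: ennreal_leI)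
      qed
    qed
    also have "\<dots> = ennreal ?c * (\<integral>\<^sup>+x. ennreal (\<bar>a x\<bar> * excess k (u x)) \<partial>M)
        + ennreal (2 powr (m - 1)) * (\<integral>\<^sup>+x. ennreal (\<bar>a x\<bar> * excess k (u x) powr m) \<partial>M)"
      by (subst nn_integral_add) (auto simp: nn_integral_cmult)
    also have "\<dots> \<le> ennreal ?c * ennreal (\<alpha> * (y k * \<phi> k powr (m - 1)))
        + ennreal (2 powr (m - 1)) * ennreal (\<alpha> * y k powr m)"
      unfolding \<alpha>_def y_def \<phi>_def m_def
      by (intro add_mono mult_left_mono nn_integral_excess[OF fin u k(1) a r] nn_integral_excess_power[OF u k(1) a r q])
         (use m1 in \<open>auto simp: m_def\<close>)
    also have "\<dots> = ennreal (2 powr (m - 1) * \<alpha> * ?E)"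
      using \<alpha>0 y0 by (subst (1 2) ennreal_mult'[symmetric]) (auto simp: ennreal_plus[symmetric] algebra_simps simp del: ennreal_plus)
    finally have "(\<integral>\<^sup>+x. ennreal (\<bar>g x\<bar> * excess k (u x)) \<partial>M) \<le> ennreal (2 powr (m - 1) * \<alpha> * (?E))" .
    then have "y k powr p \<le> S powr (p / q) * (2 powr (m - 1) * \<alpha> * (?E))"
      using p \<alpha>0 y0
      by (subst (1) y_def, intro excess_norm_powr_le[OF u k(1) q _ S _ int energy]) (auto simp: k)
    then show ?thesis unfolding T_def by (simp only: mult.assoc)
  qed
  have ylim: "(y \<longlongrightarrow> 0) at_top" unfolding y_def[abs_def] by (rule excess_norm_tendsto_0[OF u q])
  have "((\<lambda>k. T * y k powr (m - p)) \<longlongrightarrow> T * 0 powr (m - p)) at_top"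
    using m y0 by (intro tendsto_mult tendsto_const tendsto_powr2 ylim) auto
  then have "((\<lambda>k. T * y k powr (m - p)) \<longlongrightarrow> 0) at_top" by simp
  then have ev1: "\<forall>\<^sub>F k in at_top. T * y k powr (m - p) < 1 / 2" by (rule order_tendstoD) simp
  define \<gamma> where "\<gamma> = (m - 1) / (p - 1)"
  have \<gamma>: "\<gamma> > 1" using m p by (simp add: \<gamma>_def)
  define T' where "T' = (2 * T) powr (1 / (p - 1))"
  have y_le: "y k \<le> T' * (k * \<phi> k) powr \<gamma>" if k: "0 \<le> k" "R \<le> k" "T * y k powr (m - p) < 1 / 2" for k
  proof -
    have "y k \<le> (2 * T * (k * \<phi> k) powr (m - 1)) powr (1 / (p - 1))"
    proof (rule powr_root_le[OF y0 _ _ p])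
      show "0 \<le> 2 * T * (k * \<phi> k) powr (m - 1)" using T0 by simp
      have "T * y k powr m \<le> 1 / 2 * y k powr p"
      proof (cases "y k = 0")
        case False
        then have "y k > 0" using y0[of k] by simp
        then have "T * y k powr m = (T * y k powr (m - p)) * y k powr p" by (simp add: powr_diff)
        also have "\<dots> \<le> 1 / 2 * y k powr p" using k(3) by (intro mult_right_mono) auto
        finally show ?thesis .
      qed simp
      then have "y k powr p \<le> 2 * (T * (k powr (m - 1) * (y k * \<phi> k powr (m - 1))))"
        using est[OF k(1,2)] by (simp add: distrib_left)
      then show "y k powr p \<le> 2 * T * (k * \<phi> k) powr (m - 1) * y k"
        using k(1) \<phi>0 by (simp add: powr_mult mult_ac)
    qed
    also have "\<dots> = T' * (k * \<phi> k) powr \<gamma>"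
      unfolding T'_def \<gamma>_def using T0 by (subst powr_mult) (auto simp: powr_powr)
    finally show ?thesis .
  qed
  \<comment> \<open>Chebyshev's inequality between the levels \<open>k/2\<close> and \<open>k\<close>.\<close>
  have klim: "((\<lambda>k. k * \<phi> k) \<longlongrightarrow> 0) at_top"
  proof (rule tendsto_sandwich[OF _ _ tendsto_const])
    show "((\<lambda>k. 2 * y (k / 2)) \<longlongrightarrow> 0) at_top"
    proof -
      have "filterlim (\<lambda>k::real. k / 2) at_top at_top" by real_asymp
      then have "((\<lambda>k. 2 * y (k / 2)) \<longlongrightarrow> 2 * 0) at_top"
        by (intro tendsto_mult tendsto_const filterlim_compose[OF ylim])
      then show ?thesis by simp
    qed
    show "\<forall>\<^sub>F k in at_top. k * \<phi> k \<le> 2 * y (k / 2)"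
      using eventually_gt_at_top[of 0]
    proof eventually_elim
      fix k :: real assume "0 < k"
      then have "(k - k / 2) * \<phi> k \<le> y (k / 2)"
        unfolding \<phi>_def y_def by (intro level_size_le_excess_norm[OF fin u]) (use q in auto)
      then show "k * \<phi> k \<le> 2 * y (k / 2)" by (simp add: field_simps)
    qed
    show "\<forall>\<^sub>F k in at_top. 0 \<le> k * \<phi> k"
      using eventually_ge_at_top[of 0] by eventually_elim (simp add: \<phi>0)
  qed
  define c where "c = 2 powr (\<gamma> / (\<gamma> - 1)) * T' * 2 powr \<gamma>"
  have c0: "c \<ge> 0" by (simp add: c_def T'_def)
  have "((\<lambda>k. c * \<bar>k * \<phi> k\<bar> powr (\<gamma> - 1)) \<longlongrightarrow> c * \<bar>0\<bar> powr (\<gamma> - 1)) at_top"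
    using \<gamma> by (intro tendsto_mult tendsto_const tendsto_powr2 tendsto_rabs klim) auto
  then have "((\<lambda>k. c * \<bar>k * \<phi> k\<bar> powr (\<gamma> - 1)) \<longlongrightarrow> 0) at_top" by simp
  then have ev2: "\<forall>\<^sub>F k in at_top. c * \<bar>k * \<phi> k\<bar> powr (\<gamma> - 1) < 1" by (rule order_tendstoD) simp
  obtain k1 where k1: "\<And>k. k1 \<le> k \<Longrightarrow> T * y k powr (m - p) < 1 / 2 \<and> c * \<bar>k * \<phi> k\<bar> powr (\<gamma> - 1) < 1"
    using eventually_conj[OF ev1 ev2] unfolding eventually_at_top_linorder by blast
  \<comment> \<open>The level itself serves as the distance \<open>d\<close>, so that \<open>k \<le> 2 k0\<close> throughout the iteration.\<close>
  define k0 where "k0 = max (max k1 R) 1"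
  have k0: "k0 \<ge> k1" "k0 \<ge> R" "k0 > 0" by (auto simp: k0_def)
  have "AE x in M. \<bar>u x\<bar> \<le> k0 + k0"
  proof (rule bounded_if_excess_norm_decay[where K="T' * (2 * k0) powr \<gamma>", OF fin u q \<gamma>])
    show "0 \<le> T' * (2 * k0) powr \<gamma>" by (simp add: T'_def)
    show "excess_norm M q u k \<le> T' * (2 * k0) powr \<gamma> * level_size M q u k powr \<gamma>" if k: "k0 \<le> k" "k \<le> k0 + k0" for k
    proof -
      have "y k \<le> T' * (k * \<phi> k) powr \<gamma>" by (rule y_le) (use k k0 k1[of k] in auto)
      also have "\<dots> \<le> T' * (2 * k0 * \<phi> k) powr \<gamma>"
        using k k0 \<gamma> \<phi>0 by (intro mult_left_mono powr_mono2 mult_right_mono) (auto simp: T'_def)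
      also have "\<dots> = T' * (2 * k0) powr \<gamma> * \<phi> k powr \<gamma>" using k0 \<phi>0 by (simp add: powr_mult)
      finally show ?thesis unfolding y_def \<phi>_def .
    qed
    have "2 powr (\<gamma> / (\<gamma> - 1)) * (T' * (2 * k0) powr \<gamma>) * \<phi> k0 powr (\<gamma> - 1) = (c * \<bar>k0 * \<phi> k0\<bar> powr (\<gamma> - 1)) * k0"
      using k0(3) \<phi>0[of k0] unfolding c_def by (simp add: powr_mult powr_diff abs_mult)
    also have "\<dots> \<le> 1 * k0" using k1[OF k0(1)] k0(3) by (intro mult_right_mono) auto
    finally show "2 powr (\<gamma> / (\<gamma> - 1)) * (T' * (2 * k0) powr \<gamma>) * level_size M q u k0 powr (\<gamma> - 1) \<le> k0"
      by (simp add: \<phi>_def)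
  qed (use k0 in auto)
  then show ?thesis using k0(3) by (intro that[of "k0 + k0"]) auto
qed

text \<open>The iteration starts at half of the essential supremum \<open>s\<close> of \<open>|u|\<close>. It cannot end before \<open>s\<close>, so the distance \<open>D\<close> that it
  needs is at least \<open>s/2\<close>; with Chebyshev's inequality for the level \<open>s/2\<close> this is the asserted bound.\<close>

theorem sup_bound_of_bounded_coefficient:
  fixes p q r :: real and M :: "'a measure" and u a g :: "'a \<Rightarrow> real"
  defines "m \<equiv> q * (1 - 1 / r)"
  defines "\<gamma> \<equiv> (m - 1) / (p - 1)"
  assumes fin: "finite_measure M" and p: "1 < p" and r: "1 < r" and m: "p < m" and S: "S > 0"
    and u: "u \<in> lp_space M q" and a: "a \<in> lp_space M r"
    and int: "\<And>k. 0 \<le> k \<Longrightarrow> integrable M (\<lambda>x. \<bar>g x\<bar> * excess k (u x))"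
    and energy: "\<And>k. 0 \<le> k \<Longrightarrow> lp_energy M q (\<lambda>x. excess k (u x)) \<le> ennreal (S * (LINT x|M. \<bar>g x\<bar> * excess k (u x)) powr (q / p))"
    and growth: "AE x in M. \<bar>g x\<bar> \<le> L * \<bar>a x\<bar>" and L: "0 \<le> L"
    and sup: "0 < s" "\<And>k. k < s \<Longrightarrow> \<not> (AE x in M. \<bar>u x\<bar> \<le> k)"
  shows "s powr (m - 1) \<le> 2 powr (\<gamma> / (\<gamma> - 1) * (p - 1) + m - 1) * S powr (p / q) * L * lp_norm M r a * lp_norm M q u powr (m - p)"
proof -
  interpret finite_measure M by fact
  have [measurable]: "u \<in> borel_measurable M" "a \<in> borel_measurable M" using u a by (simp_all add: lp_space_iff)
  have q: "q > 0" using pos_if_conjugate_multiple_gt[of p r q] p r m by (simp add: m_def)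
  have m1: "m > 1" using m p by simp
  have \<gamma>: "\<gamma> > 1" using m p by (simp add: \<gamma>_def)
  define y where "y k = excess_norm M q u k" for k
  define \<phi> where "\<phi> k = level_size M q u k" for k
  have y0: "0 \<le> y k" and \<phi>0: "0 \<le> \<phi> k" for k by (simp_all add: y_def \<phi>_def excess_norm_nonneg level_size_nonneg)
  define \<alpha> where "\<alpha> = lp_norm M r a"
  have \<alpha>0: "\<alpha> \<ge> 0" by (simp add: \<alpha>_def lp_norm_nonneg)
  define T where "T = S powr (p / q) * L * \<alpha>"
  have T0: "T \<ge> 0" using \<alpha>0 L by (simp add: T_def)
  have est: "y k \<le> T powr (1 / (p - 1)) * \<phi> k powr \<gamma>" if k: "0 \<le> k" for k
  proof -
    have "(\<integral>\<^sup>+x. ennreal (\<bar>g x\<bar> * excess k (u x)) \<partial>M) \<le> (\<integral>\<^sup>+x. ennreal L * ennreal (\<bar>a x\<bar> * excess k (u x)) \<partial>M)"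
    proof (intro nn_integral_mono_AE)
      show "AE x in M. ennreal (\<bar>g x\<bar> * excess k (u x)) \<le> ennreal L * ennreal (\<bar>a x\<bar> * excess k (u x))"
        using growth
      proof eventually_elim
        fix x assume "\<bar>g x\<bar> \<le> L * \<bar>a x\<bar>"
        then have "\<bar>g x\<bar> * excess k (u x) \<le> L * \<bar>a x\<bar> * excess k (u x)"
          by (intro mult_right_mono excess_nonneg)
        then show "ennreal (\<bar>g x\<bar> * excess k (u x)) \<le> ennreal L * ennreal (\<bar>a x\<bar> * excess k (u x))"
          using L by (simp add: ennreal_mult'[symmetric] mult.assoc ennreal_leI)
      qed
    qed
    also have "\<dots> = ennreal L * (\<integral>\<^sup>+x. ennreal (\<bar>a x\<bar> * excess k (u x)) \<partial>M)"
      by (rule nn_integral_cmult) measurable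
    also have "\<dots> \<le> ennreal L * ennreal (\<alpha> * (y k * \<phi> k powr (m - 1)))"
      unfolding \<alpha>_def y_def \<phi>_def m_def
      by (intro mult_left_mono nn_integral_excess[OF fin u k a r]) (use m1 in \<open>auto simp: m_def\<close>)
    also have "\<dots> = ennreal (L * (\<alpha> * (y k * \<phi> k powr (m - 1))))" using L by (simp add: ennreal_mult')
    finally have "(\<integral>\<^sup>+x. ennreal (\<bar>g x\<bar> * excess k (u x)) \<partial>M) \<le> ennreal (L * (\<alpha> * (y k * \<phi> k powr (m - 1))))" .
    then have "y k powr p \<le> S powr (p / q) * (L * (\<alpha> * (y k * \<phi> k powr (m - 1))))"
      using p \<alpha>0 y0 L
      by (subst (1) y_def, intro excess_norm_powr_le[OF u k q _ S _ int energy]) (auto simp: k)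
    then have "y k powr p \<le> T * \<phi> k powr (m - 1) * y k" unfolding T_def by (simp add: mult_ac)
    then have "y k \<le> (T * \<phi> k powr (m - 1)) powr (1 / (p - 1))"
      using T0 p y0 by (intro powr_root_le) auto
    also have "\<dots> = T powr (1 / (p - 1)) * \<phi> k powr \<gamma>"
      unfolding \<gamma>_def using T0 by (subst powr_mult) (auto simp: powr_powr)
    finally show ?thesis .
  qed
  define K where "K = T powr (1 / (p - 1))"
  define D where "D = 2 powr (\<gamma> / (\<gamma> - 1)) * K * \<phi> (s / 2) powr (\<gamma> - 1)"
  have D: "s / 2 \<le> D"
  proof (rule ccontr)
    assume "\<not> s / 2 \<le> D"
    \<comment> \<open>The iteration needs a positive distance even if \<open>D\<close> vanishes.\<close>
    define d where "d = max D (s / 4)"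
    have d: "d > 0" "D \<le> d" "s / 2 + d < s" using \<open>\<not> s / 2 \<le> D\<close> sup(1) by (auto simp: d_def)
    have "AE x in M. \<bar>u x\<bar> \<le> s / 2 + d"
      using est D_def d sup(1) unfolding y_def \<phi>_def
      by (intro bounded_if_excess_norm_decay[where K=K, OF fin u q \<gamma>]) (auto simp: K_def)
    then show False using sup(2)[OF d(3)] by simp
  qed
  define n where "n = lp_norm M q u"
  have n0: "n \<ge> 0" by (simp add: n_def lp_norm_nonneg)
  have \<phi>n: "\<phi> (s / 2) \<le> 2 * n / s"
  proof -
    have "(s / 2 - 0) * \<phi> (s / 2) \<le> excess_norm M q u 0"
      unfolding \<phi>_def by (rule level_size_le_excess_norm[OF fin u]) (use sup(1) q in auto)
    also have "\<dots> = n" by (simp add: n_def excess_norm_def lp_norm_def excess_def)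
    finally show ?thesis using sup(1) by (simp add: field_simps)
  qed
  have "s / 2 \<le> 2 powr (\<gamma> / (\<gamma> - 1)) * K * (2 * n / s) powr (\<gamma> - 1)"
  proof -
    have "D \<le> 2 powr (\<gamma> / (\<gamma> - 1)) * K * (2 * n / s) powr (\<gamma> - 1)"
      unfolding D_def using \<phi>n \<phi>0 \<gamma> by (intro mult_left_mono powr_mono2) (auto simp: K_def)
    with D show ?thesis by simp
  qed
  then have "(s / 2) powr (p - 1) \<le> (2 powr (\<gamma> / (\<gamma> - 1)) * K * (2 * n / s) powr (\<gamma> - 1)) powr (p - 1)"
    using sup(1) p by (intro powr_mono2) auto
  also have "\<dots> = 2 powr (\<gamma> / (\<gamma> - 1) * (p - 1)) * T * (2 * n / s) powr (m - p)"
  proof -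
    have "(\<gamma> - 1) * (p - 1) = m - p" using p by (simp add: \<gamma>_def field_simps)
    then show ?thesis
      unfolding K_def using p T0 by (simp add: powr_mult powr_powr)
  qed
  finally have fin': "(s / 2) powr (p - 1) \<le> 2 powr (\<gamma> / (\<gamma> - 1) * (p - 1)) * T * (2 * n / s) powr (m - p)" .
  have "s powr (m - 1) = 2 powr (p - 1) * s powr (m - p) * (s / 2) powr (p - 1)"
    using sup(1) by (simp add: powr_divide powr_add[symmetric])
  also have "\<dots> \<le> 2 powr (p - 1) * s powr (m - p) * (2 powr (\<gamma> / (\<gamma> - 1) * (p - 1)) * T * (2 * n / s) powr (m - p))"
    by (intro mult_left_mono fin') auto
  also have "(2 * n / s) powr (m - p) = 2 powr (m - p) * n powr (m - p) / s powr (m - p)"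
    using sup(1) n0 by (simp add: powr_divide powr_mult)
  also have "2 powr (p - 1) * s powr (m - p) * (2 powr (\<gamma> / (\<gamma> - 1) * (p - 1)) * T * (2 powr (m - p) * n powr (m - p) / s powr (m - p)))
     = (2 powr (\<gamma> / (\<gamma> - 1) * (p - 1)) * (2 powr (p - 1) * 2 powr (m - p))) * T * n powr (m - p)"
    using sup(1) by simp
  also have "2 powr (\<gamma> / (\<gamma> - 1) * (p - 1)) * (2 powr (p - 1) * 2 powr (m - p)) = 2 powr (\<gamma> / (\<gamma> - 1) * (p - 1) + m - 1)"
    by (simp add: powr_add[symmetric] algebra_simps)
  finally show ?thesis unfolding T_def n_def \<alpha>_def by (simp add: mult_ac)
qed

section \<open>The a priori estimate\<close>

lemma sobolev_exp_sub_gt: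
  assumes "1 < p" "p < N" "N / p < r"
  shows "p < sobolev_exp_sub N p r"
proof -
  have r: "r > 1" using assms by (smt (verit) less_divide_eq_1_pos)
  have "N / r < p" using assms r by (simp add: field_simps)
  then have "N - p < N - N / r" by simp
  then have "p * (N - p) < p * (N - N / r)" using assms by simp
  then have "p < p * (N - N / r) / (N - p)" using assms by (simp add: pos_less_divide_eq)
  also have "\<dots> = sobolev_exp_sub N p r" by (simp add: sobolev_exp_sub_def sobolev_exp_def right_diff_distrib diff_divide_distrib mult.commute)
  finally show ?thesis .
qed

text \<open>For \<open>r > N\<close> the numerator exceeds its value at \<open>r = N\<close>, which equals the denominator.\<close>

lemma A_exp_ge_1:
  assumes "1 < p" "p < N" shows "1 \<le> A_exp N p r"
proof (cases "r \<le> N")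
  case False
  define Q where "Q = sobolev_exp N p"
  have Q: "Q > 0" using assms by (simp add: Q_def sobolev_exp_def)
  have "1 / r \<le> 1 / N" using False assms by (intro divide_left_mono) auto
  then have "Q * (1 - 1 / N) \<le> Q * (1 - 1 / r)" using Q by (intro mult_left_mono) auto
  moreover have "Q * (1 - 1 / N) - 1 = Q * (1 - 1 / p)"
    using assms unfolding Q_def sobolev_exp_def by (simp add: field_simps)
  moreover have "Q * (1 - 1 / p) > 0" using Q assms by simp
  ultimately show ?thesis using False by (simp add: A_exp_def sobolev_exp_sub_def Q_def)
qed (simp add: A_exp_def)

lemma H0_eventually_le:
  assumes "((\<lambda>s. F s / \<bar>s\<bar> powr e) \<longlongrightarrow> (0::real)) at_top" "((\<lambda>s. F s / \<bar>s\<bar> powr e) \<longlongrightarrow> 0) at_bot"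
  shows "\<forall>\<^sub>F s in at_top. F s \<le> s powr e \<and> F (- s) \<le> s powr e"
proof -
  have "\<forall>\<^sub>F s in at_top. F s / \<bar>s\<bar> powr e < 1" using assms(1) by (rule order_tendstoD) simp
  moreover have "\<forall>\<^sub>F s in at_top. F (- s) / \<bar>- s\<bar> powr e < 1"
    using order_tendstoD(2)[OF assms(2), of 1] unfolding at_bot_mirror eventually_filtermap by simp
  ultimately show ?thesis
    using eventually_gt_at_top[of 0] by eventually_elim (simp add: pos_divide_less_eq)
qed

lemma H1_eventually_le:
  assumes "H1 F c0" "\<And>s. s0 < \<bar>s\<bar> \<Longrightarrow> 0 < F s"
  shows "\<forall>\<^sub>F s in at_top. (SUP t\<in>{- s..s}. F t) \<le> (c0 + 1) * max (F (- s)) (F s)"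
proof -
  have "Limsup at_top (\<lambda>s. ereal ((SUP t\<in>{- s..s}. F t) / max (F (- s)) (F s))) < ereal (c0 + 1)"
    using assms(1) unfolding H1_def by (rule le_less_trans) simp
  then have "\<forall>\<^sub>F s in at_top. ereal ((SUP t\<in>{- s..s}. F t) / max (F (- s)) (F s)) < ereal (c0 + 1)"
    by (rule Limsup_lessD)
  then show ?thesis
    using eventually_gt_at_top[of "max 0 s0"]
  proof eventually_elim
    fix s assume s: "ereal ((SUP t\<in>{- s..s}. F t) / max (F (- s)) (F s)) < ereal (c0 + 1)" "max 0 s0 < s"
    then have "0 < max (F (- s)) (F s)" using assms(2)[of s] by auto
    then show "(SUP t\<in>{- s..s}. F t) \<le> (c0 + 1) * max (F (- s)) (F s)"
      using s(1) by (simp add: pos_divide_less_eq del: max_less_iff_conj less_max_iff_disj)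
  qed
qed

theorem theorem1p3:
  fixes \<Omega> :: "(real ^ 'n) set" and N p r c0 :: real
  assumes N: "N = real CARD('n)"
    and p: "1 < p" "p < N"
    and \<Omega>: "open \<Omega>" "bounded \<Omega>" "strictly_convex \<Omega>" "C2_boundary \<Omega>"
    and r: "N / p < r"
    and c0: "0 < c0"
  shows "\<exists>C :: real \<Rightarrow> real. (\<forall>\<epsilon>>0. 0 < C \<epsilon>) \<and>
    (\<forall>(f :: real ^ 'n \<Rightarrow> real \<Rightarrow> real) (a :: real ^ 'n \<Rightarrow> real) (F :: real \<Rightarrow> real) (s0 :: real).
       caratheodory \<Omega> f \<longrightarrow> H0 \<Omega> p r f a F s0 \<longrightarrow> H1 F c0 \<longrightarrow>
       (\<exists>C0>0. \<forall>u. weak_solution \<Omega> p f u \<longrightarrow>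
          linf_norm (lebesgue_on \<Omega>) u \<le> ennreal C0 \<or>
          (ennreal s0 < linf_norm (lebesgue_on \<Omega>) u \<and> linf_norm (lebesgue_on \<Omega>) u < \<infinity> \<and>
           (\<forall>\<epsilon>>0. h_fun N p r F (enn2real (linf_norm (lebesgue_on \<Omega>) u))
              \<le> C \<epsilon> * lp_norm (lebesgue_on \<Omega>) r a powr (A_exp N p r + \<epsilon>)
                * (1 + lp_norm (lebesgue_on \<Omega>) (sobolev_exp N p) u)
                  powr ((sobolev_exp_sub N p r - p) * (A_exp N p r + \<epsilon>))))))"
proof -
  have dim: "real DIM(real ^ 'n) = N" using N by simp
  define q where "q = sobolev_exp N p"
  define m where "m = sobolev_exp_sub N p r"
  have m_eq: "m = q * (1 - 1 / r)" by (simp add: m_def q_def sobolev_exp_sub_def)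
  have r1: "1 < r" using r p by (smt (verit) less_divide_eq_1_pos)
  have mp: "p < m" unfolding m_def by (rule sobolev_exp_sub_gt[OF p r])
  have pd: "p < real DIM(real ^ 'n)" using p dim by simp
  obtain S where S: "S > 0" "\<And>(\<Omega> :: (real ^ 'n) set) f u k.
    \<lbrakk>open \<Omega>; bounded \<Omega>; weak_solution \<Omega> p f u; 0 \<le> k\<rbrakk> \<Longrightarrow>
      u \<in> lp_space (lebesgue_on \<Omega>) q \<and>
      integrable (lebesgue_on \<Omega>) (\<lambda>x. \<bar>f x (u x)\<bar> * excess k (u x)) \<and>
      lp_energy (lebesgue_on \<Omega>) q (\<lambda>x. excess k (u x)) \<le>
        ennreal (S * (LINT x|lebesgue_on \<Omega>. \<bar>f x (u x)\<bar> * excess k (u x)) powr (q / p))"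
    unfolding q_def dim[symmetric] by (fact weak_solution_excess_bound[OF p(1) pd])
  define \<gamma> where "\<gamma> = (m - 1) / (p - 1)"
  define B where "B = 2 powr (\<gamma> / (\<gamma> - 1) * (p - 1) + m - 1) * S powr (p / q) * (c0 + 1)"
  have B: "B > 0" unfolding B_def using S(1) c0 by (intro mult_pos_pos) auto
  let ?M = "lebesgue_on \<Omega>"
  note fin = finite_measure_lebesgue_on[OF \<Omega>(1,2)]
  show ?thesis
  proof (intro exI[of _ "\<lambda>\<epsilon>. B powr (A_exp N p r + \<epsilon>)"] conjI allI impI)
    show "0 < B powr (A_exp N p r + \<epsilon>)" for \<epsilon> using B by simp
    fix f :: "real ^ 'n \<Rightarrow> real \<Rightarrow> real" and a :: "real ^ 'n \<Rightarrow> real" and F :: "real \<Rightarrow> real" and s0 :: real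
    assume h0: "H0 \<Omega> p r f a F s0" and h1: "H1 F c0"
    have fa: "AE x in ?M. \<forall>s. \<bar>f x s\<bar> \<le> \<bar>a x\<bar> * F s" and a: "a \<in> lp_space ?M r"
      and Fc: "continuous_on UNIV F" and F0: "\<And>s. 0 \<le> F s" and s0: "0 \<le> s0" and Fpos: "\<And>s. s0 < \<bar>s\<bar> \<Longrightarrow> 0 < F s"
      and Flim: "((\<lambda>s. F s / \<bar>s\<bar> powr (m - 1)) \<longlongrightarrow> 0) at_top" "((\<lambda>s. F s / \<bar>s\<bar> powr (m - 1)) \<longlongrightarrow> 0) at_bot"
      using h0 unfolding H0_def m_def dim by auto
    obtain C1 where C1: "\<And>s. C1 \<le> s \<Longrightarrow> (F s \<le> s powr (m - 1) \<and> F (- s) \<le> s powr (m - 1)) \<and> (SUP t\<in>{- s..s}. F t) \<le> (c0 + 1) * max (F (- s)) (F s)"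
      using eventually_conj[OF H0_eventually_le[OF Flim] H1_eventually_le[OF h1 Fpos]]
      unfolding eventually_at_top_linorder by blast
    \<comment> \<open>Beyond \<open>C0\<close> the growth function is at most \<open>s^(m-1)\<close> on both sides, and its supremum over \<open>[-s,s]\<close> is controlled by its
      values at the end points.\<close>
    define C0 where "C0 = max (max C1 s0) 1"
    have C0: "C0 > 0" "C0 \<ge> C1" "C0 \<ge> s0" by (auto simp: C0_def)
    show "\<exists>C0>0. \<forall>u. weak_solution \<Omega> p f u \<longrightarrow>
          linf_norm ?M u \<le> ennreal C0 \<or>
          (ennreal s0 < linf_norm ?M u \<and> linf_norm ?M u < \<infinity> \<and>
           (\<forall>\<epsilon>>0. h_fun N p r F (enn2real (linf_norm ?M u))
              \<le> B powr (A_exp N p r + \<epsilon>) * lp_norm ?M r a powr (A_exp N p r + \<epsilon>)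
                * (1 + lp_norm ?M (sobolev_exp N p) u) powr ((sobolev_exp_sub N p r - p) * (A_exp N p r + \<epsilon>))))"
    proof (intro exI[of _ C0] conjI allI impI C0(1))
      fix u assume ws: "weak_solution \<Omega> p f u"
      note est = S(2)[OF \<Omega>(1,2) ws]
      have u: "u \<in> lp_space ?M q" using est[of 0] by simp
      have um[measurable]: "u \<in> borel_measurable ?M" using u by (simp add: lp_space_iff)
      have crit: "AE x in ?M. C0 \<le> \<bar>u x\<bar> \<longrightarrow> \<bar>f x (u x)\<bar> \<le> \<bar>a x\<bar> * \<bar>u x\<bar> powr (m - 1)"
        using fa
      proof eventually_elim
        fix x assume fx: "\<forall>s. \<bar>f x s\<bar> \<le> \<bar>a x\<bar> * F s"
        show "C0 \<le> \<bar>u x\<bar> \<longrightarrow> \<bar>f x (u x)\<bar> \<le> \<bar>a x\<bar> * \<bar>u x\<bar> powr (m - 1)"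
        proof
          assume "C0 \<le> \<bar>u x\<bar>"
          then have "F (u x) \<le> \<bar>u x\<bar> powr (m - 1)" using C1[of "\<bar>u x\<bar>"] C0 by (cases "u x \<ge> 0") auto
          then have "\<bar>a x\<bar> * F (u x) \<le> \<bar>a x\<bar> * \<bar>u x\<bar> powr (m - 1)" by (intro mult_left_mono) auto
          then show "\<bar>f x (u x)\<bar> \<le> \<bar>a x\<bar> * \<bar>u x\<bar> powr (m - 1)" using fx order_trans by blast
        qed
      qed
      obtain k where k: "0 < k" "AE x in ?M. \<bar>u x\<bar> \<le> k"
        by (rule critical_growth_bounded[where g="\<lambda>x. f x (u x)" and R=C0, OF fin p(1) r1 mp[unfolded m_eq] S(1) u a _ _ crit[unfolded m_eq]])
           (use est in auto)
      let ?s = "linf_norm ?M u"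
      have linf_le: "?s \<le> ennreal c" if "AE x in ?M. \<bar>u x\<bar> \<le> c" for c
        unfolding linf_norm_def
        by (rule esssup_I) (measurable, use that in \<open>eventually_elim, simp add: ennreal_leI\<close>)
      have finite: "?s < \<infinity>" using linf_le[OF k(2)] by (simp add: le_less_trans)
      show "?s \<le> ennreal C0 \<or> (ennreal s0 < ?s \<and> ?s < \<infinity> \<and>
           (\<forall>\<epsilon>>0. h_fun N p r F (enn2real ?s)
              \<le> B powr (A_exp N p r + \<epsilon>) * lp_norm ?M r a powr (A_exp N p r + \<epsilon>)
                * (1 + lp_norm ?M (sobolev_exp N p) u) powr ((sobolev_exp_sub N p r - p) * (A_exp N p r + \<epsilon>))))"
      proof (cases "?s \<le> ennreal C0")
        case False
        define s where "s = enn2real ?s"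
        have s: "?s = ennreal s" unfolding s_def using finite by simp
        have sC: "C0 < s" using False C0(1) unfolding s by (simp add: not_le ennreal_less_iff)
        have s_pos: "0 < s" using sC C0 by simp
        define Fm where "Fm = max (F (- s)) (F s)"
        have Fm: "Fm > 0" using Fpos[of s] sC C0 s_pos by (simp add: Fm_def less_max_iff_disj)
        have gr: "AE x in ?M. \<bar>f x (u x)\<bar> \<le> ((c0 + 1) * Fm) * \<bar>a x\<bar>"
        proof -
          have "AE x in ?M. ennreal \<bar>u x\<bar> \<le> ennreal s"
            using esssup_AE[where f="\<lambda>x. ennreal \<bar>u x\<bar>" and M="?M"] s unfolding linf_norm_def by simp
          then show ?thesis using fa
          proof eventually_elim
            fix x assume "ennreal \<bar>u x\<bar> \<le> ennreal s" and fx: "\<forall>s. \<bar>f x s\<bar> \<le> \<bar>a x\<bar> * F s"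
            then have "u x \<in> {- s..s}" using s_pos by (auto simp: abs_le_iff)
            moreover have "bdd_above (F ` {- s..s})"
              by (intro bounded_imp_bdd_above compact_imp_bounded compact_continuous_image continuous_on_subset[OF Fc]) auto
            ultimately have "F (u x) \<le> (SUP t\<in>{- s..s}. F t)" by (rule cSUP_upper)
            also have "\<dots> \<le> (c0 + 1) * Fm" using C1[of s] sC C0 by (simp add: Fm_def)
            finally have "\<bar>a x\<bar> * F (u x) \<le> \<bar>a x\<bar> * ((c0 + 1) * Fm)" by (intro mult_left_mono) auto
            then show "\<bar>f x (u x)\<bar> \<le> ((c0 + 1) * Fm) * \<bar>a x\<bar>"
              using fx[rule_format, of "u x"] by (simp add: mult.commute)
          qed
        qed
        have sup: "\<not> (AE x in ?M. \<bar>u x\<bar> \<le> c)" if "c < s" for c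
          using linf_le[of c] that s_pos unfolding s by (auto simp: ennreal_le_iff2)
        have "s powr (m - 1) \<le> 2 powr (\<gamma> / (\<gamma> - 1) * (p - 1) + m - 1) * S powr (p / q) * ((c0 + 1) * Fm) * lp_norm ?M r a * lp_norm ?M q u powr (m - p)"
          unfolding \<gamma>_def m_eq
          by (rule sup_bound_of_bounded_coefficient[where g="\<lambda>x. f x (u x)", OF fin p(1) r1 mp[unfolded m_eq] S(1) u a _ _ gr _ s_pos sup])
             (use est c0 Fm in auto)
        also have "\<dots> = B * lp_norm ?M r a * lp_norm ?M q u powr (m - p) * Fm" by (simp add: B_def mult_ac)
        finally have "s powr (m - 1) / Fm \<le> B * lp_norm ?M r a * lp_norm ?M q u powr (m - p)"
          using Fm by (simp add: pos_divide_le_eq)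
        also have "\<dots> \<le> B * lp_norm ?M r a * (1 + lp_norm ?M q u) powr (m - p)"
          using B mp by (intro mult_left_mono powr_mono2) (auto simp: lp_norm_nonneg)
        finally have hle: "h_fun N p r F s \<le> B * lp_norm ?M r a * (1 + lp_norm ?M q u) powr (m - p)"
          using s_pos by (simp add: h_fun_def m_def Fm_def)
        \<comment> \<open>This is what allows the power \<open>A + \<epsilon>\<close> below.\<close>
        have h1: "1 \<le> h_fun N p r F s"
        proof -
          have "Fm \<le> s powr (m - 1)" using C1[of s] sC C0 by (simp add: Fm_def)
          then show ?thesis using Fm s_pos by (simp add: h_fun_def m_def[symmetric] Fm_def[symmetric])
        qed
        have bound: "h_fun N p r F s \<le> B powr (A_exp N p r + \<epsilon>) * lp_norm ?M r a powr (A_exp N p r + \<epsilon>)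
                * (1 + lp_norm ?M q u) powr ((m - p) * (A_exp N p r + \<epsilon>))" if "\<epsilon> > 0" for \<epsilon>
        proof -
          let ?X = "B * lp_norm ?M r a * (1 + lp_norm ?M q u) powr (m - p)"
          have X: "1 \<le> ?X" using h1 hle by simp
          have "h_fun N p r F s \<le> ?X powr 1" using hle X by simp
          also have "\<dots> \<le> ?X powr (A_exp N p r + \<epsilon>)"
            using X A_exp_ge_1[OF p, of r] that by (intro powr_mono) auto
          also have "\<dots> = B powr (A_exp N p r + \<epsilon>) * lp_norm ?M r a powr (A_exp N p r + \<epsilon>)
                * (1 + lp_norm ?M q u) powr ((m - p) * (A_exp N p r + \<epsilon>))"
            using B by (simp add: powr_mult powr_powr lp_norm_nonneg)
          finally show ?thesis .
        qed
        have "ennreal s0 < ?s" using sC C0 s0 unfolding s by (simp add: ennreal_less_iff)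
        then show ?thesis using finite bound unfolding s_def[symmetric] q_def m_def by blast
      qed simp
    qed
  qed
qed

end
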